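(* For every $n>0$, the map $\mathrm{T}$ is a bijection from $\mathcal{M}_n$ to $\mathcal{T}_n$, and $\mathrm{S}$ is its inverse.
   Context: A planar map is a connected graph (loops and multiple edges allowed) embedded in the sphere, considered up to homeomorphism, with a distinguished oriented edge called the root. A planar map is separable if its edges can be partitioned into two nonempty sets such that exactly one vertex is incident to edges of both sets. A non-separable planar map is a planar map with at least two edges that is not separable. $\mathcal{M}_n$ is the set of non-separable planar maps with $n+1$ edges. Rooted plane trees: children of each vertex are linearly ordered; the root has depth $0$; a leaf is a non-root vertex without children, other vertices are internal; the traversal order of leaves (counterclockwise order) is the order in which the depth-first traversal from the root, visiting children in order, meets them. A decorated tree is a rooted plane tree with an integer label $\geq -1$ on each leaf such that: (1) if a leaf $\ell$ has parent of depth $p$, the label of $\ell$ is $<p$; (2) every internal vertex of depth $p>0$ has a descendant leaf with label $\le p-2$; (3) for any vertex $t$ of depth $p$ and any subtree $T'$ rooted at a child of $t$, if a leaf $\ell$ of $T'$ has label $p$ then every leaf of $T'$ preceding $\ell$ in traversal order has label $\ge p$. $\mathcal{T}_n$ is the set of decorated trees with $n$ edges. The map $\mathrm{T}$: for $M$ with root oriented from $v$ to $u$, perform a depth-first exploration of the vertices of $M$ starting from $v$ and the root edge, examining edges around each vertex in clockwise order, each edge examined once. When, from the current vertex $w$, an examined edge leads to an already visited vertex $x$, this edge is replaced by a new leaf attached to $w$ (in the position of that edge) labeled by the depth of $x$ in the exploration tree, with $v$ of depth $-1$. Deleting the edge $\{v,u\}$ yields $\mathrm{T}(M)$, rooted at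 $u$, with plane structure inherited from $M$. The map $\mathrm{S}$: for a decorated tree $T$ rooted at $u$, (1) attach to $u$ a new edge $\{u,v\}$ with a new vertex $v$ (of depth $-1$), made the root and oriented from $v$ to $u$; (2) process the leaves in reverse traversal order; for a leaf $\ell$ with parent $t$ and label $p$, let $s$ be the ancestor of $\ell$ of depth $p$ (with $s=v$ if $p=-1$) and $e$ the first edge of the path from $s$ to $\ell$; replace $\ell$ by an edge from $t$ to $s$ whose end at $s$ is inserted immediately after $e$ in clockwise order around $s$. *)

theory Defs
  imports "HOL-Combinatorics.Orbits" "HOL-Combinatorics.Cycles"
begin

section \<open>Rooted planar maps\<close>

text \<open>
  A map on an oriented surface is encoded by its darts (half-edges): \<open>opp\<close> exchanges the two darts
  of an edge and \<open>rot\<close> sends a dart to the next one in clockwise order around its vertex.  The root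
  is the dart at the origin of the root edge.
\<close>

record 'd cmap =
  darts :: "'d set"
  rot :: "'d \<Rightarrow> 'd"
  opp :: "'d \<Rightarrow> 'd"
  root_dart :: 'd

definition vertex :: "'d cmap \<Rightarrow> 'd \<Rightarrow> 'd set" where
  "vertex m d = orbit (rot m) d"

definition vertices :: "'d cmap \<Rightarrow> 'd set set" where
  "vertices m = vertex m ` darts m"

definition edges :: "'d cmap \<Rightarrow> 'd set set" where
  "edges m = (\<lambda>d. {d, opp m d}) ` darts m"

definition faces :: "'d cmap \<Rightarrow> 'd set set" where
  "faces m = orbit (rot m \<circ> opp m) ` darts m"

definition rooted_map :: "'d cmap \<Rightarrow> bool" where
  "rooted_map m \<longleftrightarrow>
     finite (darts m) \<and> rot m permutes darts m \<and> opp m permutes darts m \<and>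
     (\<forall>d\<in>darts m. opp m d \<noteq> d \<and> opp m (opp m d) = d) \<and>
     root_dart m \<in> darts m \<and>
     (\<forall>d\<in>darts m. \<forall>e\<in>darts m. (d, e) \<in> ({(x, rot m x) |x. True} \<union> {(x, opp m x) |x. True})\<^sup>*)"

text \<open>The underlying surface is the sphere iff Euler's relation holds.\<close>

definition planar_map :: "'d cmap \<Rightarrow> bool" where
  "planar_map m \<longleftrightarrow>
     rooted_map m \<and> card (vertices m) + card (faces m) = card (edges m) + 2"

definition incident :: "'d set \<Rightarrow> 'd set set \<Rightarrow> bool" where
  "incident v E \<longleftrightarrow> (\<exists>e\<in>E. v \<inter> e \<noteq> {})"

definition separable :: "'d cmap \<Rightarrow> bool" where
  "separable m \<longleftrightarrow>
     (\<exists>E1 E2. E1 \<noteq> {} \<and> E2 \<noteq> {} \<and> E1 \<inter> E2 = {} \<and> E1 \<union> E2 = edges m \<and>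
        (\<exists>!v. v \<in> vertices m \<and> incident v E1 \<and> incident v E2))"

definition nonseparable :: "'d cmap \<Rightarrow> bool" where
  "nonseparable m \<longleftrightarrow> planar_map m \<and> card (edges m) \<ge> 2 \<and> \<not> separable m"

text \<open>
  Root-preserving isomorphisms commuting with \<open>rot\<close> and \<open>opp\<close> are the combinatorial counterpart of
  orientation-preserving homeomorphisms of the sphere that respect the roots.  A planar map is an
  isomorphism class of encodings; every class has representatives with darts in \<open>nat\<close>.
\<close>

definition map_iso :: "('d \<Rightarrow> 'e) \<Rightarrow> 'd cmap \<Rightarrow> 'e cmap \<Rightarrow> bool" where
  "map_iso f m m' \<longleftrightarrow>
     bij_betw f (darts m) (darts m') \<and>
     (\<forall>d\<in>darts m. f (rot m d) = rot m' (f d) \<and> f (opp m d) = opp m' (f d)) \<and>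
     f (root_dart m) = root_dart m'"

definition iso_class :: "'d cmap \<Rightarrow> nat cmap set" where
  "iso_class m = {m'. planar_map m' \<and> (\<exists>f. map_iso f m m')}"

definition nonsep_maps :: "nat \<Rightarrow> nat cmap set set" where
  "nonsep_maps n = iso_class ` {m :: nat cmap. nonseparable m \<and> card (edges m) = n + 1}"


section \<open>Decorated trees\<close>

text \<open>
  The root of a tree is always a \<open>Node\<close>, and \<open>Node []\<close> is only allowed there, since a childless
  non-root vertex is a leaf.
\<close>

datatype dtree = Leaf int | Node "dtree list"

text \<open>
  A vertex is addressed by the list of child indices leading to it from the root, so that its depth
  is the length of its address.  Vertices are listed in depth-first (traversal) order, each with the
  subtree hanging from it.
\<close>

lemma size_nth_less [termination_simp]:
  "i < length ts \<Longrightarrow> size (ts ! i) < Suc (size_list size ts)"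
  by (meson less_Suc_eq_le nth_mem size_list_estimation' order_refl)

fun subtrees :: "dtree \<Rightarrow> (nat list \<times> dtree) list" where
  "subtrees (Leaf p) = [([], Leaf p)]"
| "subtrees (Node ts) =
     ([], Node ts) #
     concat (map (\<lambda>i. map (\<lambda>(a, s). (i # a, s)) (subtrees (ts ! i))) [0..<length ts])"

definition tree_vertices :: "dtree \<Rightarrow> nat list set" where
  "tree_vertices t = fst ` set (subtrees t)"

definition leaves :: "dtree \<Rightarrow> (nat list \<times> int) list" where
  "leaves t = [(a, p). (a, Leaf p) \<leftarrow> subtrees t]"

definition labels :: "dtree \<Rightarrow> int list" where
  "labels t = map snd (leaves t)"

definition tree_edges :: "dtree \<Rightarrow> nat" where
  "tree_edges t = card (tree_vertices t - {[]})"

definition plane_tree :: "dtree \<Rightarrow> bool" where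
  "plane_tree t \<longleftrightarrow>
     (\<exists>ts. t = Node ts) \<and> (\<forall>a. (a, Node []) \<in> set (subtrees t) \<longrightarrow> a = [])"

definition decorated :: "dtree \<Rightarrow> bool" where
  "decorated t \<longleftrightarrow>
     plane_tree t \<and>
     (\<forall>p\<in>set (labels t). p \<ge> -1) \<and>
     (\<forall>a i p. (a @ [i], Leaf p) \<in> set (subtrees t) \<longrightarrow> p < int (length a)) \<and>
     (\<forall>a ts. (a, Node ts) \<in> set (subtrees t) \<and> length a > 0 \<longrightarrow>
        (\<exists>p\<in>set (labels (Node ts)). p \<le> int (length a) - 2)) \<and>
     (\<forall>a i s. (a @ [i], s) \<in> set (subtrees t) \<longrightarrow>
        (\<forall>j k. k < j \<and> j < length (labels s) \<and> labels s ! j = int (length a) \<longrightarrow>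
           labels s ! k \<ge> int (length a)))"

definition decorated_trees :: "nat \<Rightarrow> dtree set" where
  "decorated_trees n = {t. decorated t \<and> tree_edges t = n}"


section \<open>From maps to trees\<close>

text \<open>
  \<open>explore k m p ds (dep, ex)\<close> examines the darts \<open>ds\<close> of the current vertex, which has depth \<open>p\<close>;
  \<open>dep\<close> records the visited vertices with their depths and \<open>ex\<close> the darts of the examined edges.
  The result lists the children of the current vertex in order of exploration, i.e. clockwise.
  As the children of a \<open>Node\<close> are in traversal order, which is counterclockwise, they have to be
  reversed.  The number \<open>k\<close> only serves termination: it bounds the number of nested descents, each of
  which visits a new vertex, so the number of darts is always sufficient.
\<close>

fun explore :: "nat \<Rightarrow> 'd cmap \<Rightarrow> int \<Rightarrow> 'd list \<Rightarrow> ('d set \<rightharpoonup> int) \<times> 'd set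
    \<Rightarrow> dtree list \<times> ('d set \<rightharpoonup> int) \<times> 'd set" where
  "explore k m p [] st = ([], st)"
| "explore k m p (d # ds) (dep, ex) =
     (if d \<in> ex then explore k m p ds (dep, ex)
      else
        let x = vertex m (opp m d); ex' = ex \<union> {d, opp m d} in
        case dep x of
          Some q \<Rightarrow>
            let (ts, st) = explore k m p ds (dep, ex') in (Leaf q # ts, st)
        | None \<Rightarrow>
            (case k of
               0 \<Rightarrow> ([], (dep, ex))
             | Suc k' \<Rightarrow>
                 let (us, st) =
                       explore k' m (p + 1) (support (rot m) (opp m d)) (dep(x \<mapsto> p + 1), ex');
                     (ts, st') = explore k m p ds st
                 in (Node (rev us) # ts, st')))"

text \<open>
  The tree explored from \<open>v\<close> has \<open>u\<close> as the first child of its root, and deleting the edge between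
  them leaves the subtree at \<open>u\<close>.
\<close>

definition dfs_tree :: "'d cmap \<Rightarrow> dtree" where
  "dfs_tree m =
     hd (fst (explore (card (darts m)) m (-1) (support (rot m) (root_dart m))
                ([vertex m (root_dart m) \<mapsto> -1], {})))"

context
  fixes f :: "'d \<Rightarrow> 'e" and m :: "'d cmap" and m' :: "'e cmap"
  assumes m: "rooted_map m" and iso: "map_iso f m m'"
begin

lemma iso_facts:
  "inj_on f (darts m)"
  "d \<in> darts m \<Longrightarrow> f (rot m d) = rot m' (f d)"
  "d \<in> darts m \<Longrightarrow> f (opp m d) = opp m' (f d)"
  "d \<in> darts m \<Longrightarrow> opp m d \<in> darts m"
  "d \<in> darts m \<Longrightarrow> rot m d \<in> darts m"
  using m iso by (auto simp: map_iso_def rooted_map_def bij_betw_def permutes_in_image)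

lemma funpow_rot_iso:
  assumes "d \<in> darts m"
  shows "(rot m ^^ i) d \<in> darts m" "(rot m' ^^ i) (f d) = f ((rot m ^^ i) d)"
  using assms by (induction i) (auto simp: iso_facts)

lemma vertex_subset: "d \<in> darts m \<Longrightarrow> vertex m d \<subseteq> darts m"
  by (auto simp: vertex_def orbit_altdef funpow_rot_iso)

lemma vertex_iso: "d \<in> darts m \<Longrightarrow> vertex m' (f d) = f ` vertex m d"
  by (auto simp: vertex_def orbit_altdef funpow_rot_iso)

lemma vertex_iso_eq:
  "d \<in> darts m \<Longrightarrow> e \<in> darts m \<Longrightarrow>
     vertex m' (f d) = vertex m' (f e) \<longleftrightarrow> vertex m d = vertex m e"
  by (simp add: vertex_iso inj_on_image_eq_iff[OF iso_facts(1)] vertex_subset)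

lemma support_iso:
  assumes "d \<in> darts m"
  shows "support (rot m') (f d) = map f (support (rot m) d)"
    and "set (support (rot m) d) \<subseteq> darts m"
proof -
  have "(rot m' ^^ i) (f d) = f d \<longleftrightarrow> (rot m ^^ i) d = d" for i
    using assms by (simp add: funpow_rot_iso inj_on_eq_iff[OF iso_facts(1)])
  then show "support (rot m') (f d) = map f (support (rot m) d)"
    using assms by (simp add: least_power_def funpow_rot_iso)
  show "set (support (rot m) d) \<subseteq> darts m"
    using assms by (auto simp: funpow_rot_iso)
qed

definition st_rel where
  "st_rel st st' \<longleftrightarrow>
     snd st \<subseteq> darts m \<and> snd st' = f ` snd st \<and>
     (\<forall>d\<in>darts m. fst st' (vertex m' (f d)) = fst st (vertex m d))"

lemma explore_iso:
  assumes "set ds \<subseteq> darts m" "st_rel st st'"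
  shows "fst (explore k m' p (map f ds) st') = fst (explore k m p ds st) \<and>
    st_rel (snd (explore k m p ds st)) (snd (explore k m' p (map f ds) st'))"
  using assms
proof (induction k arbitrary: p ds st st' rule: less_induct)
  case (less k)
  note IHk = less.IH
  from less.prems show ?case
  proof (induction ds arbitrary: st st')
    case Nil
    then show ?case by simp
  next
    case (Cons d ds)
    obtain dep ex where st: "st = (dep, ex)" by (cases st)
    obtain dep' ex' where st': "st' = (dep', ex')" by (cases st')
    have d: "d \<in> darts m" and ds: "set ds \<subseteq> darts m" and od: "opp m d \<in> darts m"
      using Cons.prems by (auto simp: iso_facts)
    have ex: "ex \<subseteq> darts m" and ex': "ex' = f ` ex"
      and dep: "\<And>e. e \<in> darts m \<Longrightarrow> dep' (vertex m' (f e)) = dep (vertex m e)"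
      using Cons.prems(2) by (auto simp: st_rel_def st st')
    have mem: "f d \<in> f ` ex \<longleftrightarrow> d \<in> ex"
      using inj_on_image_mem_iff[OF iso_facts(1) d ex] .
    have oo: "opp m' (f d) = f (opp m d)" using d by (simp add: iso_facts)
    define x where "x = vertex m (opp m d)"
    define x' where "x' = vertex m' (f (opp m d))"
    define en where "en = ex \<union> {d, opp m d}"
    have en': "ex' \<union> {f d, f (opp m d)} = f ` en" by (auto simp: en_def ex')
    have depx: "dep' x' = dep x" using dep[OF od] by (simp add: x_def x'_def)
    have rel1: "st_rel (dep, en) (dep', f ` en)"
      using dep d od ex by (auto simp: st_rel_def en_def)
    have rel2: "st_rel (dep(x \<mapsto> p + 1), en) (dep'(x' \<mapsto> p + 1), f ` en)"
      using rel1 od by (auto simp: st_rel_def x_def x'_def vertex_iso_eq)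
    show ?case
    proof (cases "d \<in> ex")
      case True
      have "f d \<in> ex'" using True ex' by simp
      with True Cons.IH[OF ds Cons.prems(2)] show ?thesis by (simp add: st st')
    next
      case False
      then have False': "f d \<notin> ex'" using mem ex' by simp
      show ?thesis
      proof (cases "dep x")
        case (Some q)
        have Some': "dep' x' = Some q" using depx Some by simp
        note IH = Cons.IH[OF ds rel1]
        have L: "explore k m p (d # ds) (dep, ex) =
            (Leaf q # fst (explore k m p ds (dep, en)), snd (explore k m p ds (dep, en)))"
          using False Some
          by (simp add: x_def[symmetric] en_def[symmetric] Let_def case_prod_beta
              del: Un_insert_right)
        have R: "explore k m' p (map f (d # ds)) st' =
            (Leaf q # fst (explore k m' p (map f ds) (dep', f ` en)),
             snd (explore k m' p (map f ds) (dep', f ` en)))"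
          using False' Some' en'
          by (simp add: st' oo x'_def[symmetric] Let_def case_prod_beta del: Un_insert_right)
        show ?thesis unfolding st L R using IH by simp
      next
        case None
        have None': "dep' x' = None" using depx None by simp
        show ?thesis
        proof (cases k)
          case 0
          then show ?thesis using False False' None None' Cons.prems(2) oo
            by (simp add: st st' x_def x'_def Let_def)
        next
          case (Suc k')
          let ?A = "explore k' m (p + 1) (support (rot m) (opp m d)) (dep(x \<mapsto> p + 1), en)"
          let ?A' = "explore k' m' (p + 1) (support (rot m') (f (opp m d)))
            (dep'(x' \<mapsto> p + 1), f ` en)"
          have A: "fst ?A' = fst ?A \<and> st_rel (snd ?A) (snd ?A')"
            using IHk[OF _ support_iso(2)[OF od] rel2, of k' "p + 1"] Suc
            unfolding support_iso(1)[OF od] by simp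
          have B: "fst (explore k m' p (map f ds) (snd ?A')) = fst (explore k m p ds (snd ?A)) \<and>
              st_rel (snd (explore k m p ds (snd ?A))) (snd (explore k m' p (map f ds) (snd ?A')))"
            using Cons.IH[OF ds conjunct2[OF A]] .
          have L: "explore k m p (d # ds) (dep, ex) =
              (Node (rev (fst ?A)) # fst (explore k m p ds (snd ?A)), snd (explore k m p ds (snd ?A)))"
            using False None Suc
            by (simp add: x_def[symmetric] en_def[symmetric] Let_def case_prod_beta
              del: Un_insert_right)
          have R: "explore k m' p (map f (d # ds)) st' =
              (Node (rev (fst ?A')) # fst (explore k m' p (map f ds) (snd ?A')),
               snd (explore k m' p (map f ds) (snd ?A')))"
            using False' None' Suc en'
            by (simp add: st' oo x'_def[symmetric] Let_def case_prod_beta del: Un_insert_right)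
          show ?thesis unfolding st L R using A B by simp
        qed
      qed
    qed
  qed
qed

end

lemma dfs_tree_iso:
  assumes "rooted_map m" "map_iso f m m'"
  shows "dfs_tree m' = dfs_tree m"
proof -
  have r: "root_dart m \<in> darts m" "root_dart m' = f (root_dart m)"
      "card (darts m') = card (darts m)"
    using assms by (auto simp: rooted_map_def map_iso_def bij_betw_same_card)
  have "st_rel f m m' ([vertex m (root_dart m) \<mapsto> -1], {})
          ([vertex m' (f (root_dart m)) \<mapsto> -1], {})"
    using r by (auto simp: st_rel_def[OF assms] vertex_iso_eq[OF assms])
  from explore_iso[OF assms support_iso(2)[OF assms r(1)] this]
  show ?thesis
    by (simp only: dfs_tree_def r support_iso(1)[OF assms r(1)])
qed

definition T_map :: "nat cmap set \<Rightarrow> dtree" where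
  "T_map M = the_elem (dfs_tree ` M)"

lemma T_map_iso_class:
  fixes m :: "nat cmap"
  assumes "planar_map m"
  shows "T_map (iso_class m) = dfs_tree m"
proof -
  have "map_iso id m m" by (simp add: map_iso_def)
  then have "m \<in> iso_class m" using assms by (auto simp: iso_class_def)
  moreover have "dfs_tree m' = dfs_tree m" if "m' \<in> iso_class m" for m'
    using that assms dfs_tree_iso unfolding iso_class_def planar_map_def by blast
  ultimately have "dfs_tree ` iso_class m = {dfs_tree m}" by blast
  then show ?thesis by (simp add: T_map_def)
qed


section \<open>From trees to maps\<close>

text \<open>
  The edges of \<open>S(T)\<close> are indexed by the vertices of \<open>T\<close>: the address \<open>a\<close> stands for the edge from
  \<open>a\<close> to its parent, with \<open>v\<close> as the parent of the root.  The dart \<open>(a, True)\<close> is at the parent's end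
  and \<open>(a, False)\<close> at the end of \<open>a\<close>.  Clockwise around a vertex, the edge to the parent is followed by
  the edges to the children from the last to the first.
\<close>

definition arity :: "dtree \<Rightarrow> nat list \<Rightarrow> nat" where
  "arity t a = card {i. a @ [i] \<in> tree_vertices t}"

fun tree_rot :: "dtree \<Rightarrow> nat list \<times> bool \<Rightarrow> nat list \<times> bool" where
  "tree_rot t (a, True) =
     (if a = [] then (a, True)
      else if last a = 0 then (butlast a, False)
      else (butlast a @ [last a - 1], True))"
| "tree_rot t (a, False) =
     (if arity t a = 0 then (a, False) else (a @ [arity t a - 1], True))"

text \<open>
  For a leaf with address \<open>a\<close> and label \<open>p\<close>, the first edge on the path to it from its ancestor of
  depth \<open>p\<close> has address \<open>take (p + 1) a\<close>.  The dart \<open>(a, False)\<close>, until then alone at its vertex, is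
  inserted right after the upper dart of that edge.
\<close>

fun close_leaf :: "nat list \<times> int \<Rightarrow> (nat list \<times> bool \<Rightarrow> nat list \<times> bool)
    \<Rightarrow> (nat list \<times> bool \<Rightarrow> nat list \<times> bool)" where
  "close_leaf (a, p) r =
     (let e = (take (nat (p + 1)) a, True) in r(e := (a, False), (a, False) := r e))"

definition closure_map :: "dtree \<Rightarrow> (nat list \<times> bool) cmap" where
  "closure_map t =
     (let D = tree_vertices t \<times> UNIV in
      \<lparr>darts = D,
       rot = perm_restrict (fold close_leaf (rev (leaves t)) (tree_rot t)) D,
       opp = perm_restrict (\<lambda>(a, b). (a, \<not> b)) D,
       root_dart = ([], True)\<rparr>)"

definition S_map :: "dtree \<Rightarrow> nat cmap set" where
  "S_map t = iso_class (closure_map t)"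

end

theory Submission
  imports Defs "HOL-Library.Sublist"
begin

text \<open>
  The exploration of a map \<open>M\<close> cuts every back edge at its upper end and so leaves a plane tree, whose
  contour visits all darts in one cyclic word. Gluing the end of one back edge back onto the tree
  composes the face permutation with a transposition, which joins a leaf and a corner of the contour by
  a chord and changes the number of faces by one. By Euler's relation \<open>M\<close> is planar iff each gluing
  creates a face, and restricting this to two back edges at a time shows that the chords of a planar
  map do not cross. Non-separability means that every child subtree of a vertex of depth \<open>p \<ge> 0\<close> has a leaf
  of label less than \<open>p\<close>; the chord of that leaf closes off all corners but the one immediately after the
  first edge of the path, so that the position of every back edge is forced to be the one chosen by \<open>S\<close>.
  Conversely, condition (3) says that when a leaf is closed, in reverse traversal order, the leaf and its
  target corner still lie on the same face.
\<close>

section \<open>Lists\<close>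

abbreviation precedes :: "'a list \<Rightarrow> 'a \<Rightarrow> 'a \<Rightarrow> bool" where
  "precedes xs x y \<equiv> subseq [x, y] xs"

lemma precedes_iff_append: "precedes xs x y \<longleftrightarrow> (\<exists>us vs ws. xs = us @ x # vs @ y # ws)"
proof
  assume "precedes xs x y"
  then obtain us vs where "xs = us @ x # vs" "subseq [y] vs" by (auto dest: list_emb_ConsD)
  then show "\<exists>us vs ws. xs = us @ x # vs @ y # ws"
    by (metis split_list subseq_singleton_left)
next
  assume "\<exists>us vs ws. xs = us @ x # vs @ y # ws"
  then show "precedes xs x y" by (auto simp: subseq_singleton_left intro!: subseq_drop_many)
qed

lemma precedes_nth:
  assumes "i < j" "j < length xs"
  shows "precedes xs (xs ! i) (xs ! j)"
proof -
  have "xs = take i xs @ xs ! i # drop (Suc i) xs" using assms by (intro id_take_nth_drop) simp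
  moreover have "xs ! j \<in> set (drop (Suc i) xs)"
    using assms by (auto simp: in_set_conv_nth intro!: exI[of _ "j - Suc i"])
  ultimately show ?thesis
    by (metis subseq_Cons2 subseq_drop_many subseq_singleton_left)
qed

lemma precedes_iff_nth: "precedes xs x y \<longleftrightarrow> (\<exists>i j. i < j \<and> j < length xs \<and> xs ! i = x \<and> xs ! j = y)"
proof
  assume "precedes xs x y"
  then obtain us vs ws where xs: "xs = us @ x # vs @ y # ws" unfolding precedes_iff_append by blast
  show "\<exists>i j. i < j \<and> j < length xs \<and> xs ! i = x \<and> xs ! j = y"
    by (rule exI[of _ "length us"], rule exI[of _ "length us + length vs + 1"])
      (simp add: xs nth_append)
qed (auto intro: precedes_nth)

lemma precedes_asym: "distinct xs \<Longrightarrow> precedes xs x y \<Longrightarrow> \<not> precedes xs y x"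
  unfolding precedes_iff_nth by (metis nth_eq_iff_index_eq less_trans order_less_asym)

lemma precedes_total: "x \<in> set xs \<Longrightarrow> y \<in> set xs \<Longrightarrow> x \<noteq> y \<Longrightarrow> precedes xs x y \<or> precedes xs y x"
  unfolding precedes_iff_nth in_set_conv_nth by (metis linorder_neq_iff)

lemma precedes_in_set: "precedes xs x y \<Longrightarrow> x \<in> set xs \<and> y \<in> set xs"
  by (auto simp: precedes_iff_append)

lemma precedes_rev: "precedes (rev xs) x y \<longleftrightarrow> precedes xs y x"
proof -
  have mirror: "precedes (rev xs) x y" if "precedes xs y x" for xs :: "'a list" and x y
  proof -
    from that obtain us vs ws where "xs = us @ y # vs @ x # ws" unfolding precedes_iff_append by blast
    then have "rev xs = rev ws @ x # rev vs @ y # rev us" by simp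
    then show ?thesis unfolding precedes_iff_append by blast
  qed
  then show ?thesis by (metis rev_rev_ident)
qed

lemma precedes_mapE:
  assumes "precedes (map f xs) u v"
  obtains x y where "precedes xs x y" "f x = u" "f y = v"
proof -
  from assms obtain i j where "i < j" "j < length xs" "f (xs ! i) = u" "f (xs ! j) = v"
    unfolding precedes_iff_nth by auto
  then show ?thesis using that precedes_nth by blast
qed

lemma precedes_between:
  assumes "distinct xs" "precedes xs x y" "precedes xs y z"
  obtains us vs ws where "xs = us @ x # vs @ z # ws" "y \<in> set vs"
proof -
  obtain us vs ws where xs: "xs = us @ x # vs @ y # ws" using assms(2) unfolding precedes_iff_append by blast
  have "\<not> precedes xs z y" using precedes_asym[OF assms(1,3)] .
  moreover have "z \<in> set xs" using precedes_in_set[OF assms(3)] by simp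
  moreover have "z \<noteq> y" using precedes_asym[OF assms(1,3)] assms(3) by blast
  moreover have "precedes xs z y" if "z \<in> set (us @ x # vs)"
    using that split_list[OF that] xs unfolding precedes_iff_append by (metis append.assoc append_Cons)
  ultimately have "z \<in> set ws" using xs by auto
  then obtain ws1 ws2 where "ws = ws1 @ z # ws2" by (meson split_list)
  then show ?thesis using that[of us "vs @ y # ws1" ws2] xs by simp
qed

lemma precedes_concat: "xs \<in> set xss \<Longrightarrow> precedes xs x y \<Longrightarrow> precedes (concat xss) x y"
  by (induction xss) (auto intro: subseq_drop_many list_emb_prefix)

lemma precedes_concat_nth:
  assumes "i < j" "j < length xss" "x \<in> set (xss ! i)" "y \<in> set (xss ! j)"
  shows "precedes (concat xss) x y"
  using assms
proof (induction xss arbitrary: i j)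
  case (Cons xs xss)
  obtain j' where j: "j = Suc j'" using Cons.prems(1) by (cases j) auto
  show ?case
  proof (cases i)
    case 0
    have "y \<in> set (concat xss)" using Cons.prems(2,4) j by auto
    then have "subseq ([x] @ [y]) (xs @ concat xss)"
      using Cons.prems(3) 0 by (intro list_emb_append_mono) (auto simp: subseq_singleton_left)
    then show ?thesis by simp
  next
    case (Suc i')
    then show ?thesis using Cons.IH[of i' j'] Cons.prems j by (auto intro: subseq_drop_many)
  qed
qed simp

lemma distinct_concat_nth_unique:
  assumes "distinct (concat xss)" "i < length xss" "j < length xss" "x \<in> set (xss ! i)" "x \<in> set (xss ! j)"
  shows "i = j"
  using precedes_concat_nth[of i j xss x x] precedes_concat_nth[of j i xss x x] precedes_asym assms
  by (metis linorder_neqE_nat)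

lemma sorted_wrt_precedes: "sorted_wrt (precedes xs) xs"
  by (simp add: sorted_wrt_iff_nth_less precedes_nth)

lemma sorted_wrt_asym_set_unique:
  assumes "sorted_wrt R xs" "sorted_wrt R ys" "set xs = set ys" "\<And>x y. R x y \<Longrightarrow> \<not> R y x"
  shows "xs = ys"
  using assms(1-3)
proof (induction xs arbitrary: ys)
  case (Cons x xs)
  then obtain y zs where ys: "ys = y # zs" by (cases ys) auto
  have "x = y"
  proof (rule ccontr)
    assume "x \<noteq> y"
    then have "x \<in> set zs" "y \<in> set xs" using Cons.prems(3) ys by auto
    then have "R y x" "R x y" using Cons.prems(1,2) ys by auto
    then show False using assms(4) by blast
  qed
  moreover have "x \<notin> set xs" "y \<notin> set zs" using Cons.prems(1,2) ys assms(4) by auto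
  ultimately have "set xs = set zs" using Cons.prems(3) ys by (metis insert_ident list.simps(15))
  then show ?case using Cons.IH[of zs] Cons.prems ys \<open>x = y\<close> by simp
qed simp

lemma distinct_concat_map:
  assumes "distinct xs" "\<And>x. x \<in> set xs \<Longrightarrow> distinct (f x)"
    "\<And>x y. x \<in> set xs \<Longrightarrow> y \<in> set xs \<Longrightarrow> x \<noteq> y \<Longrightarrow> set (f x) \<inter> set (f y) = {}"
  shows "distinct (concat (map f xs))"
  using assms
proof (induction xs)
  case (Cons x xs)
  have "set (f x) \<inter> set (f y) = {}" if "y \<in> set xs" for y
    using Cons.prems(1) Cons.prems(3)[of x y] that by auto
  then have "set (f x) \<inter> set (concat (map f xs)) = {}" by auto
  then show ?case using Cons by simp
qed simp

lemma filter_notin_insert: "filter (\<lambda>y. y \<notin> insert x Z) xs = filter (\<lambda>y. y \<noteq> x) (filter (\<lambda>y. y \<notin> Z) xs)"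
  by (auto intro: filter_cong)

lemma filter_neq_middle: "distinct (us @ x # vs) \<Longrightarrow> filter (\<lambda>y. y \<noteq> x) (us @ x # vs) = us @ vs"
  by (auto intro!: arg_cong2[of _ _ _ _ append] filter_True)

lemma in_set_predecessor: "x \<in> set xs \<Longrightarrow> hd xs \<noteq> x \<Longrightarrow> \<exists>us e vs. xs = us @ e # x # vs"
  by (metis append_Nil append_butlast_last_id append_Cons append_assoc list.sel(1) split_list)

lemma sorted_wrt_concat_upt:
  assumes "\<And>i. i < n \<Longrightarrow> sorted_wrt R (f i)"
    and "\<And>i j x y. i < j \<Longrightarrow> j < n \<Longrightarrow> x \<in> set (f i) \<Longrightarrow> y \<in> set (f j) \<Longrightarrow> R x y"
  shows "sorted_wrt R (concat (map f [0..<n]))"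
  using assms by (induction n) (auto simp: sorted_wrt_append)

lemma concat_map_upt_single:
  assumes "i < n" "\<And>j. j < n \<Longrightarrow> j \<noteq> i \<Longrightarrow> f j = []"
  shows "concat (map f [0..<n]) = f i"
proof -
  have "[0..<n] = [0..<i] @ i # [Suc i..<n]"
    using assms(1) by (metis less_imp_le_nat upt_add_eq_append le_add_diff_inverse upt_conv_Cons zero_le)
  moreover have "concat (map f [0..<i]) = []" "concat (map f [Suc i..<n]) = []"
    using assms by auto
  ultimately show ?thesis
    by (metis append_Nil append_Nil2 concat.simps(2) concat_append list.simps(9) map_append)
qed

lemma concat_map2_nth:
  assumes "i < length xs" "length yss = length xs"
  shows "\<exists>us vs. concat (map2 f xs yss) = us @ f (xs ! i) (yss ! i) @ vs"
proof -
  let ?zss = "map2 f xs yss"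
  have "?zss = take i ?zss @ f (xs ! i) (yss ! i) # drop (Suc i) ?zss"
    using assms id_take_nth_drop[of i ?zss] by simp
  then show ?thesis by (metis concat.simps(2) concat_append)
qed

lemma concat_map2_Cons_eq_map:
  assumes "length yss = length xs" "concat (map2 (\<lambda>x ys. f x # ys) xs yss) = map f xs"
  shows "\<forall>ys\<in>set yss. ys = []"
proof -
  have "length xs \<le> length (concat (map2 (\<lambda>x ys. f x # ys) xs yss)) \<and>
      (length (concat (map2 (\<lambda>x ys. f x # ys) xs yss)) = length xs \<longrightarrow> (\<forall>ys\<in>set yss. length ys = 0))"
    using assms(1) by (induction yss xs rule: list_induct2) (auto simp del: length_0_conv)
  then show ?thesis using assms(2) by simp
qed

lemma map_concat_chain:
  assumes "\<And>c. c \<in> set cs \<Longrightarrow> map f (x c # w c) = w c @ [nx c]" and "map nx cs = tl (map x cs) @ [y]"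
  shows "map f (concat (map (\<lambda>c. x c # w c) cs)) = tl (concat (map (\<lambda>c. x c # w c) cs)) @ [y]"
  using assms
proof (induction cs)
  case (Cons c cs)
  show ?case
  proof (cases cs)
    case Nil
    then show ?thesis using Cons.prems by simp
  next
    case (Cons c' ds)
    have nx: "nx c = x c'" "map nx cs = tl (map x cs) @ [y]" using Cons.prems(2) Cons by auto
    have "map f (concat (map (\<lambda>c. x c # w c) cs)) = tl (concat (map (\<lambda>c. x c # w c) cs)) @ [y]"
      using Cons.IH[OF Cons.prems(1) nx(2)] by simp
    then show ?thesis using Cons.prems(1)[of c] Cons nx(1) by simp
  qed
qed simp


section \<open>Cycles of permutations\<close>

definition is_cycle :: "('a \<Rightarrow> 'a) \<Rightarrow> 'a list \<Rightarrow> bool" where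
  "is_cycle f xs \<longleftrightarrow> distinct xs \<and> map f xs = rotate1 xs"

lemma is_cycle_Cons_iff: "is_cycle f (x # xs) \<longleftrightarrow> distinct (x # xs) \<and> map f (x # xs) = xs @ [x]"
  by (simp add: is_cycle_def)

lemma is_cycle_append_iff:
  "is_cycle f (x # xs @ y # ys) \<longleftrightarrow>
     distinct (x # xs @ y # ys) \<and> map f (x # xs) = xs @ [y] \<and> map f (y # ys) = ys @ [x]"
proof -
  have "map f (x # xs @ y # ys) = (xs @ [y]) @ (ys @ [x]) \<longleftrightarrow>
      map f (x # xs) = xs @ [y] \<and> map f (y # ys) = ys @ [x]"
    using append_eq_append_conv[of "map f (x # xs)" "xs @ [y]" "map f (y # ys)" "ys @ [x]"] by simp
  then show ?thesis by (simp add: is_cycle_def)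
qed

lemma is_cycle_rotate: "is_cycle f xs \<Longrightarrow> is_cycle f (rotate n xs)"
  by (induction n) (auto simp: is_cycle_def rotate1_map[symmetric])

lemma is_cycle_append_commute: "is_cycle f (xs @ ys) \<Longrightarrow> is_cycle f (ys @ xs)"
  using is_cycle_rotate[of f "xs @ ys" "length xs"] by (simp add: rotate_append)

lemma is_cycle_image: "is_cycle f xs \<Longrightarrow> f ` set xs = set xs"
  by (metis is_cycle_def list.set_map set_rotate1)

lemma is_cycle_map_commute:
  assumes "is_cycle r xs" "is_cycle r' (map f xs)" "x \<in> set xs"
  shows "f (r x) = r' (f x)"
proof -
  have "map r' (map f xs) = map f (map r xs)"
    using assms(1,2) by (simp only: is_cycle_def rotate1_map)
  then show ?thesis using assms(3) by simp
qed

lemma is_cycle_funpow: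
  assumes "is_cycle f (x # xs)"
  shows "i \<le> length xs \<Longrightarrow> (f ^^ i) x = (x # xs) ! i" and "(f ^^ Suc (length xs)) x = x"
proof -
  have step: "f ((x # xs) ! i) = (xs @ [x]) ! i" if "i \<le> length xs" for i
    using assms that by (metis is_cycle_Cons_iff length_Cons less_Suc_eq_le nth_map)
  show power: "(f ^^ i) x = (x # xs) ! i" if "i \<le> length xs" for i
    using that step by (induction i) (simp_all add: nth_append)
  show "(f ^^ Suc (length xs)) x = x"
    using power[of "length xs"] step[of "length xs"] by (simp add: nth_append)
qed

lemma support_eq_if_is_cycle:
  assumes "is_cycle f (x # xs)"
  shows "support f x = x # xs"
proof -
  have minimal: "Suc (length xs) \<le> n" if "(f ^^ n) x = x" "n > 0" for n
  proof (rule ccontr)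
    assume "\<not> Suc (length xs) \<le> n"
    with is_cycle_funpow(1)[OF assms, of n] that have "xs ! (n - 1) = x" "n - 1 < length xs" by auto
    then show False using assms by (metis is_cycle_Cons_iff distinct.simps(2) nth_mem)
  qed
  have "least_power f x = Suc (length xs)"
    unfolding least_power_def by (rule Least_equality) (use is_cycle_funpow(2)[OF assms] minimal in auto)
  then show ?thesis
    using is_cycle_funpow(1)[OF assms] by (intro nth_equalityI) (auto simp del: upt_Suc)
qed

lemma orbit_eq_if_is_cycle:
  assumes "is_cycle f xs" "x \<in> set xs"
  shows "orbit f x = set xs"
proof -
  obtain ys zs where xs: "xs = ys @ x # zs" using assms(2) by (meson split_list)
  then have c: "is_cycle f (x # zs @ ys)" using is_cycle_append_commute[of f ys "x # zs"] assms(1) by simp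
  have "orbit f x = {(f ^^ i) x |i. i < length (x # zs @ ys)}"
    using orbit_altdef_bounded[OF is_cycle_funpow(2)[OF c]] by simp
  also have "\<dots> = {(x # zs @ ys) ! i |i. i < length (x # zs @ ys)}"
    using is_cycle_funpow(1)[OF c] by (metis (lifting) length_Cons less_Suc_eq_le)
  also have "\<dots> = set xs" unfolding xs set_conv_nth[symmetric] by auto
  finally show ?thesis .
qed

lemma is_cycle_support:
  assumes "permutation f"
  shows "is_cycle f (support f x)" and "support f x = x # tl (support f x)"
proof -
  obtain k where k: "least_power f x = Suc k" and return: "(f ^^ Suc k) x = x"
    using least_power_of_permutation[OF assms] by (metis gr0_implies_Suc)
  have "map f (support f x) = map (\<lambda>i. (f ^^ Suc i) x) [0..<Suc k]" by (simp add: k comp_def)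
  also have "\<dots> = map (\<lambda>i. (f ^^ i) x) [Suc 0..<Suc (Suc k)]"
    by (simp only: map_Suc_upt[symmetric] map_map comp_def)
  also have "\<dots> = rotate1 (support f x)"
    using return by (simp add: k upt_conv_Cons[of 0 "Suc k"] del: upt_Suc) (simp add: upt_Suc_append)
  finally show "is_cycle f (support f x)" using cycle_of_permutation[OF assms] by (simp add: is_cycle_def)
  show "support f x = x # tl (support f x)" by (simp add: k upt_conv_Cons del: upt_Suc)
qed

lemma orbit_eqI_in_orbit: "permutation f \<Longrightarrow> y \<in> orbit f x \<Longrightarrow> orbit f y = orbit f x"
  using cyclic_on_orbit' orbit_cyclic_eq3 by metis

lemma perm_restrict_permutes:
  assumes cover: "\<And>x. x \<in> D \<Longrightarrow> \<exists>xs. is_cycle f xs \<and> x \<in> set xs \<and> set xs \<subseteq> D" and "finite D"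
  shows "perm_restrict f D permutes D"
proof (rule bij_imp_permutes)
  have "f x \<in> D \<and> x \<in> f ` D" if x: "x \<in> D" for x
    using cover[OF x] is_cycle_image by (metis image_mono imageI subsetD)
  then have "f ` D = D" by blast
  then have "perm_restrict f D ` D = D" by (auto simp: perm_restrict_def)
  then show "bij_betw (perm_restrict f D) D D"
    using \<open>finite D\<close> by (simp add: bij_betw_def eq_card_imp_inj_on)
qed (auto simp: perm_restrict_def)


subsection \<open>Composition with a transposition\<close>

lemma map_comp_transpose_other:
  "x \<notin> set xs \<Longrightarrow> y \<notin> set xs \<Longrightarrow> map (f \<circ> transpose x y) xs = map f xs"
  by (auto simp: transpose_def)

lemma is_cycle_comp_transpose_other:
  "is_cycle f xs \<Longrightarrow> x \<notin> set xs \<Longrightarrow> y \<notin> set xs \<Longrightarrow> is_cycle (f \<circ> transpose x y) xs"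
  unfolding is_cycle_def by (metis map_comp_transpose_other)

lemma is_cycle_comp_transpose_split:
  assumes "is_cycle f (us @ x # vs @ y # ws)"
  shows "is_cycle (f \<circ> transpose x y) (us @ x # ws)" "is_cycle (f \<circ> transpose x y) (vs @ [y])"
proof -
  let ?g = "f \<circ> transpose x y"
  have "is_cycle f (x # vs @ y # (ws @ us))" using is_cycle_append_commute[OF assms] by simp
  then have d: "distinct (x # vs @ y # (ws @ us))"
    and x: "f x # map f vs = vs @ [y]" and y: "f y # map f (ws @ us) = (ws @ us) @ [x]"
    unfolding is_cycle_append_iff by auto
  have vs: "map ?g vs = map f vs" and ws: "map ?g (ws @ us) = map f (ws @ us)"
    using d by (auto intro!: map_comp_transpose_other simp del: map_eq_conv map_append)
  have "is_cycle ?g (x # ws @ us)" unfolding is_cycle_Cons_iff list.map ws using d y by simp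
  then show "is_cycle ?g (us @ x # ws)" using is_cycle_append_commute[of ?g "x # ws" us] by simp
  have "is_cycle ?g (y # vs)" unfolding is_cycle_Cons_iff list.map vs using d x by simp
  then show "is_cycle ?g (vs @ [y])" using is_cycle_append_commute[of ?g "[y]" vs] by simp
qed

lemma is_cycle_comp_transpose_merge:
  assumes "is_cycle f (x # xs)" "is_cycle f (y # ys)" "set (x # xs) \<inter> set (y # ys) = {}"
  shows "is_cycle (f \<circ> transpose x y) (x # ys @ y # xs)"
proof -
  have xs: "map (f \<circ> transpose x y) xs = map f xs" and ys: "map (f \<circ> transpose x y) ys = map f ys"
    using assms by (auto intro!: map_comp_transpose_other simp: is_cycle_def simp del: map_eq_conv)
  show ?thesis unfolding is_cycle_append_iff list.map xs ys
    using assms by (auto simp: is_cycle_Cons_iff)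
qed

lemma permutes_comp_transpose:
  "f permutes D \<Longrightarrow> x \<in> D \<Longrightarrow> y \<in> D \<Longrightarrow> (f \<circ> transpose x y) permutes D"
  by (metis permutes_compose permutes_swap_id)

lemma transpose_comp_involution:
  assumes "\<And>x. h (h x) = x"
  shows "transpose x y \<circ> h = h \<circ> transpose (h x) (h y)"
  using assms by (auto simp: fun_eq_iff transpose_def)

lemma orbit_comp_transpose_other:
  assumes "permutation f" "x \<notin> orbit f z" "y \<notin> orbit f z"
  shows "orbit (f \<circ> transpose x y) z = orbit f z"
proof (rule orbit_cong[OF permutation_self_in_orbit[OF assms(1)]])
  fix s assume "s \<in> orbit f z"
  then have "s \<noteq> x" "s \<noteq> y" using assms(2,3) by auto
  then show "(f \<circ> transpose x y) s = f s" by simp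
qed

lemma orbit_comp_transpose_merge:
  assumes perm: "permutation f" and "y \<notin> orbit f x" and z: "z \<in> orbit f x \<union> orbit f y"
  shows "orbit (f \<circ> transpose x y) z = orbit f x \<union> orbit f y"
proof -
  have cycle: "is_cycle f (u # tl (support f u))" for u using is_cycle_support[OF perm] by metis
  have orb: "orbit f u = set (u # tl (support f u))" for u
    using orbit_eq_if_is_cycle[OF cycle[of u]] by simp
  have "orbit f x \<inter> orbit f y = {}"
    using orbit_eqI_in_orbit[OF perm] permutation_self_in_orbit[OF perm] assms(2) by blast
  then have "is_cycle (f \<circ> transpose x y) (x # tl (support f y) @ y # tl (support f x))"
    using is_cycle_comp_transpose_merge[OF cycle cycle] unfolding orb by blast
  then show ?thesis using orbit_eq_if_is_cycle z unfolding orb by fastforce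
qed


subsection \<open>Number of cycles\<close>

definition num_cycles :: "('a \<Rightarrow> 'a) \<Rightarrow> 'a set \<Rightarrow> nat" where
  "num_cycles f D = card (orbit f ` D)"

lemma num_cycles_eq_1:
  assumes "is_cycle f xs" "set xs = D" "D \<noteq> {}"
  shows "num_cycles f D = 1"
proof -
  have "orbit f ` D = (\<lambda>_. D) ` D" using orbit_eq_if_is_cycle[OF assms(1)] assms(2) by (intro image_cong) auto
  then show ?thesis using assms(3) by (simp add: num_cycles_def image_constant_conv)
qed

lemma num_cycles_merge:
  assumes f: "f permutes D" "finite D" and xy: "x \<in> D" "y \<in> D" "y \<notin> orbit f x"
  shows "num_cycles f D = Suc (num_cycles (f \<circ> transpose x y) D)"
proof -
  have perm: "permutation f" using f permutation_permutes by blast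
  note self = permutation_self_in_orbit[OF perm] and eq = orbit_eqI_in_orbit[OF perm]
  let ?g = "f \<circ> transpose x y" and ?U = "orbit f x \<union> orbit f y"
  define R where "R = orbit f ` (D - ?U)"
  have D: "D = ?U \<union> (D - ?U)" using permutes_orbit_subset[OF f(1)] xy by blast
  have "orbit f ` ?U = {orbit f x, orbit f y}" using self eq by blast
  then have orbits_f: "orbit f ` D = {orbit f x, orbit f y} \<union> R" unfolding R_def by (metis D image_Un)
  have "orbit ?g ` (D - ?U) = R"
    unfolding R_def using self eq by (intro image_cong refl orbit_comp_transpose_other[OF perm]) blast+
  moreover have "orbit ?g ` ?U = {?U}"
    using orbit_comp_transpose_merge[OF perm xy(3)] self[of x] by blast
  ultimately have orbits_g: "orbit ?g ` D = {?U} \<union> R" by (metis D image_Un)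
  have "orbit f x \<notin> R" "orbit f y \<notin> R" "?U \<notin> R" using self unfolding R_def by blast+
  moreover have "orbit f x \<noteq> orbit f y" using self xy(3) by blast
  moreover have "finite R" using f by (simp add: R_def)
  ultimately show ?thesis by (simp add: num_cycles_def orbits_f orbits_g)
qed

lemma num_cycles_split:
  assumes f: "f permutes D" "finite D" and xy: "x \<in> D" "y \<in> orbit f x" "x \<noteq> y"
  shows "num_cycles (f \<circ> transpose x y) D = Suc (num_cycles f D)"
proof -
  let ?g = "f \<circ> transpose x y"
  have perm: "permutation f" using f permutation_permutes by blast
  have y: "y \<in> D" using permutes_orbit_subset[OF f(1) xy(1)] xy(2) by auto
  have cycle: "is_cycle f (x # tl (support f x))" using is_cycle_support[OF perm] by metis
  then have "y \<in> set (tl (support f x))" using xy orbit_eq_if_is_cycle[OF cycle, of x] by auto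
  then obtain vs ws where "tl (support f x) = vs @ y # ws" by (meson split_list)
  with cycle have split: "is_cycle f ([] @ x # vs @ y # ws)" by simp
  then have "y \<notin> set (x # ws)" by (auto simp: is_cycle_def)
  then have "y \<notin> orbit ?g x"
    using orbit_eq_if_is_cycle[OF is_cycle_comp_transpose_split(1)[OF split], of x] by simp
  then have "num_cycles ?g D = Suc (num_cycles (?g \<circ> transpose x y) D)"
    using num_cycles_merge permutes_comp_transpose f xy y by metis
  then show ?thesis by (simp add: comp_assoc)
qed

lemma num_cycles_comp_transpose_le:
  assumes "f permutes D" "finite D" "x \<in> D" "y \<in> D"
  shows "num_cycles (f \<circ> transpose x y) D \<le> Suc (num_cycles f D)"
proof (cases "x = y")
  case False
  then show ?thesis
    using num_cycles_split[OF assms(1-3), of y] num_cycles_merge[OF assms] by (cases "y \<in> orbit f x") auto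
qed simp

text \<open>Every transposition adds a cycle, so the second one must join two elements of the same cycle.\<close>

lemma transpositions_noncrossing:
  assumes f: "f permutes D" "finite D"
    and cycle: "is_cycle f (us @ x1 # vs @ y1 # ws)" "set (us @ x1 # vs @ y1 # ws) = D"
    and "x2 \<in> D" "y2 \<in> D"
    and three: "num_cycles (f \<circ> transpose x1 y1 \<circ> transpose x2 y2) D \<ge> 3"
  shows "x2 \<in> set (vs @ [y1]) \<longleftrightarrow> y2 \<in> set (vs @ [y1])"
proof (rule ccontr)
  assume crossing: "\<not> ?thesis"
  let ?g = "f \<circ> transpose x1 y1"
  have "x1 \<in> D" "y1 \<in> D" using cycle(2) by auto
  then have g: "?g permutes D" using permutes_comp_transpose f by metis
  then have perm: "permutation ?g" using f(2) permutation_permutes by blast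
  have "num_cycles f D = 1" by (rule num_cycles_eq_1[OF cycle]) (use \<open>x1 \<in> D\<close> in blast)
  then have "num_cycles ?g D \<le> 2" using num_cycles_comp_transpose_le[OF f \<open>x1 \<in> D\<close> \<open>y1 \<in> D\<close>] by simp
  moreover have "y2 \<notin> orbit ?g x2"
    using crossing orbit_eq_if_is_cycle[OF is_cycle_comp_transpose_split(2)[OF cycle(1)]]
      orbit_eqI_in_orbit[OF perm] permutation_self_in_orbit[OF perm] by metis
  then have "num_cycles ?g D = Suc (num_cycles (?g \<circ> transpose x2 y2) D)"
    using num_cycles_merge[OF g f(2)] assms(5,6) by blast
  ultimately show False using three by simp
qed


section \<open>Exploration trees annotated with darts\<close>

text \<open>
  Children are listed clockwise, and the dart of a subtree is the upper dart of the edge leading to it.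
  The contour starts with this dart and goes around the subtree clockwise, whereas \<open>leaf_list\<close> follows
  the traversal order, which is opposite to the contour.
\<close>

datatype 'd dart_tree = DLeaf (dart: 'd) int | DNode (dart: 'd) "'d dart_tree list"

fun contour :: "('d \<Rightarrow> 'd) \<Rightarrow> 'd dart_tree \<Rightarrow> 'd list" where
  "contour op (DLeaf d q) = [d, op d]"
| "contour op (DNode d ts) = d # concat (map (contour op) ts) @ [op d]"

abbreviation contours :: "('d \<Rightarrow> 'd) \<Rightarrow> 'd dart_tree list \<Rightarrow> 'd list" where
  "contours op ts \<equiv> concat (map (contour op) ts)"

fun leaf_list :: "'d dart_tree \<Rightarrow> ('d \<times> int) list" where
  "leaf_list (DLeaf d q) = [(d, q)]"
| "leaf_list (DNode d ts) = concat (map leaf_list (rev ts))"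

abbreviation forest_leaves :: "'d dart_tree list \<Rightarrow> ('d \<times> int) list" where
  "forest_leaves ts \<equiv> concat (map leaf_list (rev ts))"

fun node_list :: "'d dart_tree \<Rightarrow> 'd list" where
  "node_list (DLeaf d q) = []"
| "node_list (DNode d ts) = d # concat (map node_list ts)"

abbreviation forest_nodes :: "'d dart_tree list \<Rightarrow> 'd list" where
  "forest_nodes ts \<equiv> concat (map node_list ts)"

fun descendants :: "'d dart_tree \<Rightarrow> 'd dart_tree set" where
  "descendants (DLeaf d q) = {DLeaf d q}"
| "descendants (DNode d ts) = insert (DNode d ts) (\<Union>c\<in>set ts. descendants c)"

fun erase :: "'d dart_tree \<Rightarrow> dtree" where
  "erase (DLeaf d q) = Leaf q"
| "erase (DNode d ts) = Node (rev (map erase ts))"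

text \<open>The opposite of the dart of a leaf is the upper end of its back edge.\<close>

definition back_ends :: "('d \<Rightarrow> 'd) \<Rightarrow> 'd dart_tree \<Rightarrow> 'd set" where
  "back_ends op c = op ` fst ` set (leaf_list c)"

definition back_ends_at :: "('d \<Rightarrow> 'd) \<Rightarrow> int \<Rightarrow> 'd dart_tree \<Rightarrow> 'd list" where
  "back_ends_at op p c = map (op \<circ> fst) (filter (\<lambda>(d, q). q = p) (leaf_list c))"

lemma self_in_descendants [simp]: "c \<in> descendants c"
  by (cases c) auto

lemma set_leaf_list: "(d, q) \<in> set (leaf_list c) \<longleftrightarrow> DLeaf d q \<in> descendants c"
  by (induction c) auto

lemma set_node_list: "d \<in> set (node_list c) \<longleftrightarrow> (\<exists>us. DNode d us \<in> descendants c)"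
  by (induction c) auto

lemma upper_darts_eq: "fst ` set (leaf_list c) \<union> set (node_list c) = dart ` descendants c"
proof (induction c)
  case (DNode d ts)
  then have "(\<Union>c\<in>set ts. fst ` set (leaf_list c) \<union> set (node_list c)) = (\<Union>c\<in>set ts. dart ` descendants c)"
    by (intro SUP_cong refl)
  then show ?case by (simp add: image_UN UN_Un_distrib)
qed simp

lemma descendants_contour: "s \<in> descendants c \<Longrightarrow> set (contour op s) \<subseteq> set (contour op c)"
  by (induction c) auto

lemma descendants_parent:
  "s \<in> descendants c \<Longrightarrow> s = c \<or> (\<exists>d us. DNode d us \<in> descendants c \<and> s \<in> set us)"
  by (induction c) auto

lemma contour_eq_Cons: "contour op c = dart c # tl (contour op c)"
  by (cases c) auto

lemma contour_eq_snoc: "\<exists>w. contour op c = w @ [op (dart c)]"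
  by (cases c) auto

lemma dart_in_contour: "dart c \<in> set (contour op c)" "op (dart c) \<in> set (contour op c)"
  by (cases c; auto)+

lemma dart_leaf_or_node: "dart c \<in> fst ` set (leaf_list c) \<union> set (node_list c)"
  unfolding upper_darts_eq by simp

lemma set_contour_eq:
  "set (contour op c) = fst ` set (leaf_list c) \<union> set (node_list c) \<union>
     op ` (fst ` set (leaf_list c) \<union> set (node_list c))"
  by (induction c) (auto 0 4)

lemma set_contours_eq:
  "set (contours op ts) = fst ` set (forest_leaves ts) \<union> set (forest_nodes ts) \<union>
     op ` (fst ` set (forest_leaves ts) \<union> set (forest_nodes ts))"
  by (induction ts) (auto simp: set_contour_eq image_Un)

lemma contour_closed:
  assumes "\<And>d. op (op d) = d"
  shows "op y \<in> set (contour op c) \<longleftrightarrow> y \<in> set (contour op c)"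
proof -
  have "op y \<in> set (contour op c)" if "y \<in> set (contour op c)" for y
    using that assms unfolding set_contour_eq by auto
  from this[of y] this[of "op y"] show ?thesis using assms by auto
qed

lemma precedes_contour_last:
  assumes "y \<in> set (contour op c)" "y \<noteq> op (dart c)"
  shows "precedes (contour op c) y (op (dart c))"
proof -
  obtain w where w: "contour op c = w @ [op (dart c)]" using contour_eq_snoc by blast
  then have "subseq ([y] @ [op (dart c)]) (w @ [op (dart c)])"
    using assms by (intro list_emb_append_mono) (auto simp: subseq_singleton_left)
  then show ?thesis using w by simp
qed

lemma leaf_in_contour: "(d, q) \<in> set (leaf_list c) \<Longrightarrow> d \<in> set (contour op c)"
  unfolding set_contour_eq by force

lemma back_ends_simps [simp]:
  "back_ends op (DLeaf d q) = {op d}"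
  "back_ends op (DNode d ts) = (\<Union>c\<in>set ts. back_ends op c)"
  by (auto simp: back_ends_def)

lemma back_ends_subset_contour: "back_ends op c \<subseteq> set (contour op c)"
  by (auto simp: set_contour_eq back_ends_def)

lemma set_back_ends_at: "set (back_ends_at op p c) = {op d |d. (d, p) \<in> set (leaf_list c)}"
  by (force simp: back_ends_at_def)

lemma back_ends_at_subset: "set (back_ends_at op p c) \<subseteq> back_ends op c"
  by (force simp: set_back_ends_at back_ends_def)

lemma subseq_rev_leaves_contour: "subseq (rev (map fst (leaf_list c))) (contour op c)"
proof (induction c)
  case (DNode d ts)
  then have "subseq (concat (map (\<lambda>c. rev (map fst (leaf_list c))) ts)) (contours op ts)"
    by (induction ts) (auto intro: list_emb_append_mono)
  moreover have "rev (map fst (forest_leaves ts)) = concat (map (\<lambda>c. rev (map fst (leaf_list c))) ts)"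
    by (induction ts) auto
  ultimately show ?case by (auto intro: list_emb_prefix)
qed simp

lemma leaf_list_precedes_contour:
  assumes "precedes (leaf_list c) (d, q) (e, r)"
  shows "precedes (contour op c) e d"
proof -
  have "subseq (map fst [(d, q), (e, r)]) (map fst (leaf_list c))" using assms by (rule subseq_map)
  then have "precedes (rev (map fst (leaf_list c))) e d" by (simp add: precedes_rev)
  then show ?thesis using subseq_rev_leaves_contour subseq_order.trans by blast
qed

lemma back_ends_at_precedes_contour:
  assumes "\<And>d. op (op d) = d" "precedes (back_ends_at op p c) x y"
  shows "precedes (contour op c) (op y) (op x)"
proof -
  obtain u v where uv: "precedes (filter (\<lambda>(d, q). q = p) (leaf_list c)) u v"
    "(op \<circ> fst) u = x" "(op \<circ> fst) v = y"
    using assms(2) unfolding back_ends_at_def by (rule precedes_mapE)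
  have "precedes (leaf_list c) u v" using uv(1) subseq_filter_left by (rule subseq_order.trans)
  then have "precedes (contour op c) (fst v) (fst u)"
    by (metis leaf_list_precedes_contour prod.collapse)
  then show ?thesis using uv(2,3) assms(1) by auto
qed

lemma mset_contour:
  "mset (contour op c) = mset (map fst (leaf_list c)) + mset (node_list c) +
     image_mset op (mset (map fst (leaf_list c)) + mset (node_list c))"
proof (induction c)
  case (DNode d ts)
  have "mset (contours op ts) = mset (map fst (forest_leaves ts)) + mset (forest_nodes ts) +
     image_mset op (mset (map fst (forest_leaves ts)) + mset (forest_nodes ts))"
    using DNode by (induction ts) (auto simp: ac_simps)
  then show ?case by simp
qed simp

lemma distinct_contours_darts:
  assumes "distinct (contours op ts)"
  shows "distinct (map fst (forest_leaves ts))" "distinct (forest_nodes ts)"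
    "fst ` set (forest_leaves ts) \<inter> set (forest_nodes ts) = {}"
    "(fst ` set (forest_leaves ts) \<union> set (forest_nodes ts)) \<inter>
       op ` (fst ` set (forest_leaves ts) \<union> set (forest_nodes ts)) = {}"
proof -
  define ls where "ls = map fst (forest_leaves ts)"
  define ns where "ns = forest_nodes ts"
  have "mset (contours op ts) = mset (ls @ ns) + image_mset op (mset (ls @ ns))"
    unfolding ls_def ns_def by (induction ts) (simp_all add: mset_contour ac_simps)
  then have "mset (contours op ts) = mset ((ls @ ns) @ map op (ls @ ns))" by simp
  then have "distinct ((ls @ ns) @ map op (ls @ ns))" using assms mset_eq_imp_distinct_iff by blast
  then have "distinct ls \<and> distinct ns \<and> set ls \<inter> set ns = {} \<and>
      (set ls \<union> set ns) \<inter> op ` (set ls \<union> set ns) = {}" by auto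
  then show "distinct (map fst (forest_leaves ts))" "distinct (forest_nodes ts)"
    "fst ` set (forest_leaves ts) \<inter> set (forest_nodes ts) = {}"
    "(fst ` set (forest_leaves ts) \<union> set (forest_nodes ts)) \<inter>
       op ` (fst ` set (forest_leaves ts) \<union> set (forest_nodes ts)) = {}"
    unfolding ls_def ns_def set_map by blast+
qed


subsection \<open>Arrangement of the darts around a vertex\<close>

text \<open>
  If \<open>ds\<close> lists the darts around a vertex in the order of examination and \<open>E\<close> contains the darts
  examined before, then a dart of \<open>ds\<close> that does not lead to one of the children \<open>ts\<close> was examined
  earlier, possibly during the exploration of a previous child.
\<close>

fun arranged :: "('d \<Rightarrow> 'd) \<Rightarrow> 'd set \<Rightarrow> 'd dart_tree list \<Rightarrow> 'd list \<Rightarrow> bool" where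
  "arranged op E [] ds \<longleftrightarrow> set ds \<subseteq> E"
| "arranged op E (c # ts) ds \<longleftrightarrow>
     (\<exists>ys zs. ds = ys @ dart c # zs \<and> set ys \<subseteq> E \<and> arranged op (E \<union> set (contour op c)) ts zs)"

lemma arranged_Cons:
  "arranged op (E \<union> set (contour op c)) ts ds \<Longrightarrow> arranged op E (c # ts) (dart c # ds)"
  by (auto intro: exI[of _ "[]"])

lemma arranged_restrict:
  "arranged op E ts ds \<Longrightarrow> E \<inter> set ds \<subseteq> E' \<Longrightarrow> arranged op E' ts ds"
proof (induction ts arbitrary: E E' ds)
  case (Cons c ts)
  then obtain ys zs where ds: "ds = ys @ dart c # zs" "set ys \<subseteq> E"
    "arranged op (E \<union> set (contour op c)) ts zs" by auto
  have "arranged op (E' \<union> set (contour op c)) ts zs"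
    using Cons.IH[OF ds(3), of "E' \<union> set (contour op c)"] Cons.prems(2) ds(1) by auto
  moreover have "set ys \<subseteq> E'" using ds Cons.prems(2) by auto
  ultimately show ?case using ds(1) by auto
qed auto

lemma arranged_skip:
  assumes "arranged op E ts ds" "d \<in> E"
  shows "arranged op E ts (d # ds)"
proof (cases ts)
  case (Cons c us)
  then obtain ys zs where "ds = ys @ dart c # zs" "set ys \<subseteq> E"
    "arranged op (E \<union> set (contour op c)) us zs" using assms(1) by auto
  then have "d # ds = (d # ys) @ dart c # zs" "set (d # ys) \<subseteq> E"
    "arranged op (E \<union> set (contour op c)) us zs" using assms(2) by auto
  then show ?thesis unfolding Cons arranged.simps by blast
qed (use assms in simp)

lemma arranged_subset: "arranged op E ts ds \<Longrightarrow> set ds \<subseteq> E \<union> set (contours op ts)"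
proof (induction ts arbitrary: E ds)
  case (Cons c ts)
  then show ?case using dart_in_contour(1)[of c op] by fastforce
qed auto

lemma arranged_darts: "arranged op E ts ds \<Longrightarrow> dart ` set ts \<subseteq> set ds"
  by (induction ts arbitrary: E ds) fastforce+

lemma arranged_blocks:
  assumes "arranged op E ts ds"
  shows "\<exists>ys yss. length yss = length ts \<and> ds = ys @ concat (map2 (\<lambda>c ys. dart c # ys) ts yss) \<and>
     set ys \<subseteq> E \<and> (\<forall>i<length ts. set (yss ! i) \<subseteq> E \<union> set (contours op (take (Suc i) ts)))"
  using assms
proof (induction ts arbitrary: E ds)
  case (Cons c ts)
  then obtain ys zs where ds: "ds = ys @ dart c # zs" "set ys \<subseteq> E"
    "arranged op (E \<union> set (contour op c)) ts zs" by auto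
  from Cons.IH[OF ds(3)] obtain zs' zss where zss: "length zss = length ts"
    "zs = zs' @ concat (map2 (\<lambda>c ys. dart c # ys) ts zss)" "set zs' \<subseteq> E \<union> set (contour op c)"
    "\<forall>i<length ts. set (zss ! i) \<subseteq> E \<union> set (contour op c) \<union> set (contours op (take (Suc i) ts))"
    by blast
  have "set ((zs' # zss) ! i) \<subseteq> E \<union> set (contours op (take (Suc i) (c # ts)))"
    if "i < length (c # ts)" for i
    using that zss(1,3) spec[OF zss(4), of "i - 1"] by (cases i) auto
  then show ?case using ds zss by (intro exI[of _ ys] exI[of _ "zs' # zss"]) auto
qed auto


section \<open>Leaves and labels\<close>

lemma leaves_Leaf [simp]: "leaves (Leaf q) = [([], q)]"
  by (simp add: leaves_def)

lemma leaves_Node: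
  "leaves (Node ts) = concat (map (\<lambda>i. map (\<lambda>(a, q). (i # a, q)) (leaves (ts ! i))) [0..<length ts])"
proof -
  define leaf_entry :: "nat list \<times> dtree \<Rightarrow> (nat list \<times> int) list" where
    "leaf_entry = (\<lambda>x. case x of (a, Leaf p) \<Rightarrow> [(a, p)] | (a, _) \<Rightarrow> [])"
  have leaves: "leaves t = concat (map leaf_entry (subtrees t))" for t
    by (simp add: leaves_def leaf_entry_def)
  have shift: "concat (map leaf_entry (map (\<lambda>(a, s). (i # a, s)) xs)) =
      map (\<lambda>(a, q). (i # a, q)) (concat (map leaf_entry xs))" for i xs
    by (induction xs) (auto simp: leaf_entry_def split: dtree.splits)
  have "concat (map leaf_entry (concat xss)) = concat (map (\<lambda>xs. concat (map leaf_entry xs)) xss)" for xss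
    by (induction xss) auto
  then have "leaves (Node ts) = concat (map (\<lambda>i. concat (map leaf_entry
      (map (\<lambda>(a, s). (i # a, s)) (subtrees (ts ! i))))) [0..<length ts])"
    by (simp add: leaves comp_def) (simp add: leaf_entry_def)
  then show ?thesis by (simp only: shift leaves)
qed

lemma labels_Leaf [simp]: "labels (Leaf q) = [q]"
  by (simp add: labels_def)

lemma labels_Node: "labels (Node ts) = concat (map labels ts)"
proof -
  have "labels (Node ts) = concat (map (\<lambda>i. labels (ts ! i)) [0..<length ts])"
    by (simp add: labels_def leaves_Node map_concat comp_def case_prod_beta)
  also have "map (\<lambda>i. labels (ts ! i)) [0..<length ts] = map labels ts"
    by (rule nth_equalityI) auto
  finally show ?thesis .
qed

lemma labels_erase: "labels (erase c) = map snd (leaf_list c)"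
proof (induction c)
  case (DNode d ts)
  then show ?case by (simp add: labels_Node map_concat rev_map[symmetric] comp_def cong: map_cong)
qed simp


section \<open>Maps with an exploration tree\<close>

locale combinatorial_map =
  fixes m :: "'d cmap"
  assumes finite_darts: "finite (darts m)"
    and rot_permutes: "rot m permutes darts m"
    and opp_permutes: "opp m permutes darts m"
    and opp_involution: "d \<in> darts m \<Longrightarrow> opp m d \<noteq> d \<and> opp m (opp m d) = d"
    and root_in_darts: "root_dart m \<in> darts m"
begin

lemma opp_in_darts [simp]: "opp m d \<in> darts m \<longleftrightarrow> d \<in> darts m"
  using opp_permutes by (rule permutes_in_image)

lemma rot_in_darts [simp]: "rot m d \<in> darts m \<longleftrightarrow> d \<in> darts m"
  using rot_permutes by (rule permutes_in_image)

lemma opp_eq_iff [simp]: "opp m d = opp m e \<longleftrightarrow> d = e"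
  using opp_permutes by (metis permutes_def)

lemma opp_opp [simp]: "opp m (opp m d) = d"
  using opp_involution opp_permutes by (metis permutes_def)

lemma opp_in_image_iff [simp]: "opp m d \<in> opp m ` A \<longleftrightarrow> d \<in> A"
  by auto

lemma card_opp_image: "card (opp m ` A) = card A"
  by (rule card_image) (auto intro: inj_onI)

lemma rot_permutation: "permutation (rot m)"
  using rot_permutes finite_darts permutation_permutes by blast

lemma is_cycle_support_rot: "is_cycle (rot m) (support (rot m) d)"
  using is_cycle_support(1)[OF rot_permutation] .

lemma support_rot_Cons: "support (rot m) d = d # tl (support (rot m) d)"
  using is_cycle_support(2)[OF rot_permutation] .

lemma distinct_support_rot: "distinct (support (rot m) d)"
  using is_cycle_support_rot is_cycle_def by blast

lemma not_in_tl_support_rot: "d \<notin> set (tl (support (rot m) d))"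
  using distinct_support_rot support_rot_Cons by (metis distinct.simps(2))

lemma vertex_eq_set_support: "vertex m d = set (support (rot m) d)"
  unfolding vertex_def
  using orbit_eq_if_is_cycle[OF is_cycle_support_rot] support_rot_Cons by (metis list.set_intros(1))

lemma vertex_eq_insert_tl: "vertex m d = insert d (set (tl (support (rot m) d)))"
  unfolding vertex_eq_set_support using support_rot_Cons by (metis list.simps(15))

lemma self_in_vertex: "d \<in> vertex m d"
  by (simp add: vertex_eq_insert_tl)

lemma vertex_eqI: "e \<in> vertex m d \<Longrightarrow> vertex m e = vertex m d"
  unfolding vertex_def using orbit_eqI_in_orbit[OF rot_permutation] .

lemma vertex_subset_darts: "d \<in> darts m \<Longrightarrow> vertex m d \<subseteq> darts m"
  unfolding vertex_def using permutes_orbit_subset[OF rot_permutes] .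

lemma tl_support_subset_darts: "d \<in> darts m \<Longrightarrow> set (tl (support (rot m) d)) \<subseteq> darts m"
  using vertex_eq_insert_tl vertex_subset_darts[of d] by simp

lemma vertex_in_vertices: "d \<in> darts m \<Longrightarrow> vertex m d \<in> vertices m"
  by (simp add: vertices_def)

lemma vertices_eq_vertex: "x \<in> vertices m \<Longrightarrow> y \<in> x \<Longrightarrow> x = vertex m y"
  using vertex_eqI by (auto simp: vertices_def)

lemma vertices_subset_Pow: "vertices m \<subseteq> Pow (darts m)"
  using vertex_subset_darts by (auto simp: vertices_def)

lemma edges_subset_Pow: "edges m \<subseteq> Pow (darts m)"
  by (auto simp: edges_def)

lemma faces_subset_Pow: "faces m \<subseteq> Pow (darts m)"
  using permutes_orbit_subset[OF permutes_compose[OF opp_permutes rot_permutes]] by (auto simp: faces_def)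

lemma finite_vertices: "finite (vertices m)"
  using finite_darts by (simp add: vertices_def)

definition dart_step :: "('d \<times> 'd) set" where
  "dart_step = {(x, rot m x) |x. True} \<union> {(x, opp m x) |x. True}"

lemma vertex_reach: "y \<in> vertex m e \<Longrightarrow> (e, y) \<in> dart_step\<^sup>*"
  unfolding vertex_def by (induction rule: orbit.induct) (auto simp: dart_step_def intro: rtrancl_into_rtrancl)

lemma opp_reach: "(d, opp m d) \<in> dart_step\<^sup>*"
  by (auto simp: dart_step_def)

lemma card_faces: "card (faces m) = num_cycles (rot m \<circ> opp m) (darts m)"
  by (simp add: faces_def num_cycles_def)

end

lemma combinatorial_map_if_rooted: "rooted_map m \<Longrightarrow> combinatorial_map m"
  by (auto simp: rooted_map_def combinatorial_map_def)

text \<open>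
  The path lists, for the ancestors of a subtree from \<open>v\<close> downwards, the dart through which each
  of them was entered (the root dart in the case of \<open>v\<close>); hence the index in the path is depth plus one.
\<close>

fun explored :: "'d cmap \<Rightarrow> 'd list \<Rightarrow> 'd dart_tree \<Rightarrow> bool" where
  "explored m path (DLeaf d q) \<longleftrightarrow> (\<exists>i<length path. q = int i - 1 \<and> opp m d \<in> vertex m (path ! i))"
| "explored m path (DNode d ts) \<longleftrightarrow>
     arranged (opp m) {} ts (tl (support (rot m) (opp m d))) \<and>
     (\<forall>c\<in>set ts. explored m (path @ [opp m d]) c)"

locale explored_map = combinatorial_map m for m :: "'d cmap" +
  fixes forest :: "'d dart_tree list"
  assumes distinct_contour: "distinct (contours (opp m) forest)"
    and set_contour: "set (contours (opp m) forest) = darts m"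
    and root_arranged: "arranged (opp m) {} forest (support (rot m) (root_dart m))"
    and root_explored: "c \<in> set forest \<Longrightarrow> explored m [root_dart m] c"
begin

definition leaf_darts :: "'d set" where "leaf_darts = fst ` set (forest_leaves forest)"

definition node_darts :: "'d set" where "node_darts = set (forest_nodes forest)"

definition all_back_ends :: "'d set" where "all_back_ends = opp m ` leaf_darts"

definition entry_darts :: "'d set" where "entry_darts = insert (root_dart m) (opp m ` node_darts)"

lemma darts_eq: "darts m = leaf_darts \<union> node_darts \<union> opp m ` (leaf_darts \<union> node_darts)"
  using set_contour set_contours_eq[of "opp m" forest] by (simp add: leaf_darts_def node_darts_def)

lemma leaf_node_disjoint: "leaf_darts \<inter> node_darts = {}"
  and upper_lower_disjoint: "(leaf_darts \<union> node_darts) \<inter> opp m ` (leaf_darts \<union> node_darts) = {}"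
  using distinct_contours_darts[OF distinct_contour] by (auto simp: leaf_darts_def node_darts_def)

lemma opp_not_upper: "d \<in> leaf_darts \<union> node_darts \<Longrightarrow> opp m d \<notin> leaf_darts \<union> node_darts"
  using upper_lower_disjoint by blast

lemma back_ends_subset_darts: "all_back_ends \<subseteq> darts m"
  using darts_eq by (auto simp: all_back_ends_def)

lemma entry_subset_darts: "entry_darts \<subseteq> darts m"
  using root_in_darts darts_eq by (auto simp: entry_darts_def)

lemma root_first: "\<exists>c ts. forest = c # ts \<and> dart c = root_dart m"
proof (cases forest)
  case Nil
  then show ?thesis using root_arranged support_rot_Cons[of "root_dart m"] by simp
next
  case (Cons c ts)
  with root_arranged obtain ds where "support (rot m) (root_dart m) = dart c # ds" by auto
  then show ?thesis using Cons support_rot_Cons[of "root_dart m"] by (metis list.inject)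
qed

lemma root_upper: "root_dart m \<in> leaf_darts \<union> node_darts"
proof -
  obtain c ts where "forest = c # ts" "dart c = root_dart m" using root_first by blast
  then show ?thesis unfolding leaf_darts_def node_darts_def using dart_leaf_or_node[of c] by auto
qed

lemma entry_not_back_end:
  assumes "e \<in> entry_darts"
  shows "e \<notin> all_back_ends"
proof -
  have "root_dart m \<notin> all_back_ends" using root_upper upper_lower_disjoint unfolding all_back_ends_def by blast
  moreover have "opp m d \<notin> all_back_ends" if "d \<in> node_darts" for d
    using that leaf_node_disjoint by (auto simp: all_back_ends_def)
  ultimately show ?thesis using assms unfolding entry_darts_def by blast
qed

lemma card_leaf_darts: "card leaf_darts = length (forest_leaves forest)"
  unfolding leaf_darts_def using distinct_card[OF distinct_contours_darts(1)[OF distinct_contour]] by simp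

lemma card_node_darts: "card node_darts = length (forest_nodes forest)"
  unfolding node_darts_def using distinct_card[OF distinct_contours_darts(2)[OF distinct_contour]] .

lemma card_edges: "card (edges m) = card (leaf_darts \<union> node_darts)"
proof -
  have "edges m = (\<lambda>d. {d, opp m d}) ` (leaf_darts \<union> node_darts)"
    unfolding edges_def darts_eq by (auto simp: image_Un image_image insert_commute)
  moreover have "inj_on (\<lambda>d. {d, opp m d}) (leaf_darts \<union> node_darts)"
    by (rule inj_onI) (use upper_lower_disjoint in \<open>auto simp: doubleton_eq_iff\<close>)
  ultimately show ?thesis by (simp add: card_image)
qed

lemma card_edges_eq_leaves_nodes: "card (edges m) = card leaf_darts + card node_darts"
  unfolding card_edges
  using leaf_node_disjoint by (intro card_Un_disjoint) (auto simp: leaf_darts_def node_darts_def)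


subsection \<open>Families of siblings\<close>

text \<open>
  \<open>family path P ts Q\<close>: the vertex entered through the last dart of \<open>path\<close> has the list of child
  subtrees \<open>ts\<close>, and \<open>P\<close> and \<open>Q\<close> are the parts of the contour before and after them.
\<close>

inductive family :: "'d list \<Rightarrow> 'd list \<Rightarrow> 'd dart_tree list \<Rightarrow> 'd list \<Rightarrow> bool" where
  family_root: "family [root_dart m] [] forest []"
| family_child: "family path P (us @ DNode d ts # vs) Q \<Longrightarrow>
    family (path @ [opp m d]) (P @ contours (opp m) us @ [d]) ts (opp m d # contours (opp m) vs @ Q)"

text \<open>The root dart is examined at \<open>v\<close>, whereas the entry dart of any other vertex already belongs to the path.\<close>

definition examined :: "'d list \<Rightarrow> 'd list" where
  "examined path = (if length path = 1 then support (rot m) (last path) else tl (support (rot m) (last path)))"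

lemma family_contour: "family path P ts Q \<Longrightarrow> contours (opp m) forest = P @ contours (opp m) ts @ Q"
  by (induction rule: family.induct) auto

lemma family_distinct: "family path P ts Q \<Longrightarrow> distinct (P @ contours (opp m) ts @ Q)"
  using distinct_contour family_contour by metis

lemma family_path: "family path P ts Q \<Longrightarrow> path \<noteq> [] \<and> path ! 0 = root_dart m"
  by (induction rule: family.induct) (auto simp: nth_append)

lemma family_childE:
  assumes "family path P ts Q" "DNode d us \<in> set ts"
  obtains P' Q' where "family (path @ [opp m d]) P' us Q'"
  using assms family_child by (metis split_list)

lemma family_induct [consumes 2, case_names DLeaf DNode]:
  assumes "family path P ts Q" "c \<in> set ts"
    and "\<And>path P ts Q d q. family path P ts Q \<Longrightarrow> DLeaf d q \<in> set ts \<Longrightarrow> \<Phi> path (DLeaf d q)"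
    and "\<And>path P ts Q d us P' Q'. family path P ts Q \<Longrightarrow> DNode d us \<in> set ts \<Longrightarrow>
      family (path @ [opp m d]) P' us Q' \<Longrightarrow> (\<And>c. c \<in> set us \<Longrightarrow> \<Phi> (path @ [opp m d]) c) \<Longrightarrow>
      \<Phi> path (DNode d us)"
  shows "\<Phi> path c"
  using assms(1,2)
proof (induction c arbitrary: path P ts Q)
  case (DLeaf d q)
  then show ?case by (rule assms(3))
next
  case (DNode d us)
  obtain P' Q' where child: "family (path @ [opp m d]) P' us Q'" using family_childE[OF DNode.prems] .
  show ?case by (rule assms(4)[OF DNode.prems child]) (rule DNode.IH[OF _ child])
qed

lemma family_explored: "family path P ts Q \<Longrightarrow> c \<in> set ts \<Longrightarrow> explored m path c"
proof (induction arbitrary: c rule: family.induct)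
  case (family_child path P us d ts vs Q)
  have "explored m path (DNode d ts)" by (rule family_child.IH) simp
  then show ?case using family_child.prems by simp
qed (simp add: root_explored)

lemma family_arranged: "family path P ts Q \<Longrightarrow> arranged (opp m) {} ts (examined path)"
proof (induction rule: family.induct)
  case family_root
  then show ?case using root_arranged by (simp add: examined_def)
next
  case (family_child path P us d ts vs Q)
  then have "explored m path (DNode d ts)" using family_explored by fastforce
  then show ?case using family_path[OF family_child(1)] by (simp add: examined_def)
qed

lemma family_leaves: "family path P ts Q \<Longrightarrow> set (forest_leaves ts) \<subseteq> set (forest_leaves forest)"
  by (induction rule: family.induct) auto

lemma family_nodes: "family path P ts Q \<Longrightarrow> set (forest_nodes ts) \<subseteq> node_darts"
  by (induction rule: family.induct) (auto simp: node_darts_def)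

lemma family_leaf_darts:
  "family path P ts Q \<Longrightarrow> c \<in> set ts \<Longrightarrow> (d, q) \<in> set (leaf_list c) \<Longrightarrow> d \<in> leaf_darts"
  using family_leaves unfolding leaf_darts_def by force

lemma family_back_ends: "family path P ts Q \<Longrightarrow> c \<in> set ts \<Longrightarrow> back_ends (opp m) c \<subseteq> all_back_ends"
  using family_leaf_darts unfolding back_ends_def all_back_ends_def by force

lemma family_dart:
  assumes "family path P ts Q" "c \<in> set ts"
  shows "dart c \<in> leaf_darts \<union> node_darts"
proof -
  have "set (node_list c) \<subseteq> node_darts" using family_nodes[OF assms(1)] assms(2) by auto
  moreover have "fst ` set (leaf_list c) \<subseteq> leaf_darts" using family_leaf_darts[OF assms] by auto
  ultimately show ?thesis using dart_leaf_or_node[of c] by blast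
qed

lemma family_dart_not_back_end: "family path P ts Q \<Longrightarrow> c \<in> set ts \<Longrightarrow> dart c \<notin> all_back_ends"
  using family_dart upper_lower_disjoint unfolding all_back_ends_def by fast

lemma family_path_entry: "family path P ts Q \<Longrightarrow> set path \<subseteq> entry_darts"
proof (induction rule: family.induct)
  case (family_child path P us d ts vs Q)
  have "d \<in> node_darts" using family_nodes[OF family_child.hyps] by simp
  then show ?case using family_child.IH by (simp add: entry_darts_def)
qed (simp add: entry_darts_def)

lemma family_last_entry: "family path P ts Q \<Longrightarrow> last path \<in> entry_darts"
  using family_path_entry family_path by fastforce

lemma family_vertex: "family path P ts Q \<Longrightarrow> vertex m (last path) = insert (last path) (set (examined path))"
  using vertex_eq_insert_tl self_in_vertex vertex_eq_set_support
  by (auto simp: examined_def simp del: set_map)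

lemma distinct_examined: "distinct (examined path)"
  using distinct_support_rot by (auto simp: examined_def simp del: set_map intro: distinct_tl)

lemma dart_in_examined: "family path P ts Q \<Longrightarrow> c \<in> set ts \<Longrightarrow> dart c \<in> set (examined path)"
  using arranged_darts[OF family_arranged] by fast

lemma dart_in_vertex: "family path P ts Q \<Longrightarrow> c \<in> set ts \<Longrightarrow> dart c \<in> vertex m (last path)"
  using dart_in_examined family_vertex by blast

lemma examined_subset_contours: "family path P ts Q \<Longrightarrow> set (examined path) \<subseteq> set (contours (opp m) ts)"
  using arranged_subset[OF family_arranged] by simp

lemma examined_suffix_support:
  assumes "family path P ts Q" "examined path = xs @ ys"
  shows "\<exists>xs'. support (rot m) (last path) = xs' @ ys"
proof (cases "length path = 1")
  case True
  then show ?thesis using assms(2) by (auto simp: examined_def)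
next
  case False
  then have "support (rot m) (last path) = last path # xs @ ys"
    using assms(2) support_rot_Cons[of "last path"] by (simp add: examined_def)
  then show ?thesis by (metis append_Cons)
qed

lemma family_path_distinct: "family path P ts Q \<Longrightarrow> distinct path \<and> set (tl path) \<subseteq> set Q"
proof (induction rule: family.induct)
  case (family_child path P us d ts vs Q)
  have "opp m d \<notin> set Q" using family_distinct[OF family_child.hyps] by auto
  moreover have "d \<in> node_darts" using family_nodes[OF family_child.hyps] by simp
  then have "opp m d \<noteq> root_dart m" using root_upper opp_not_upper[of d] by auto
  moreover have "path = root_dart m # tl path"
    using family_path[OF family_child.hyps] by (metis list.collapse hd_conv_nth)
  ultimately have "opp m d \<notin> set path" using family_child.IH by (metis set_ConsD subsetD)
  then show ?case using family_child.IH family_path[OF family_child.hyps] by auto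
qed simp

lemma family_root_before:
  assumes "family path P ts Q" "length path > 1"
  shows "root_dart m \<in> set P"
proof -
  have "P \<noteq> []" using assms by cases auto
  moreover have "hd (P @ contours (opp m) ts @ Q) = root_dart m"
    using root_first contour_eq_Cons family_contour[OF assms(1)]
    by (metis append_Cons concat.simps(2) list.sel(1) list.simps(9))
  ultimately show ?thesis by (metis hd_append2 hd_in_set)
qed

lemma family_descendant:
  assumes "family path P ts Q" "c \<in> set ts" "s \<in> descendants c"
  shows "\<exists>path' P' ts' Q'. family (path @ path') P' ts' Q' \<and> s \<in> set ts' \<and>
    set path' \<subseteq> opp m ` set (node_list c) \<and> (path' = [] \<longrightarrow> s = c)"
  using assms
proof (induction c arbitrary: path P ts Q)
  case (DLeaf d q)
  then show ?case by (intro exI[of _ "[]"] exI[of _ P] exI[of _ ts] exI[of _ Q]) simp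
next
  case (DNode d us)
  obtain P' Q' where child: "family (path @ [opp m d]) P' us Q'" using family_childE[OF DNode.prems(1,2)] .
  show ?case
  proof (cases "s = DNode d us")
    case True
    then show ?thesis
      using DNode.prems by (intro exI[of _ "[]"] exI[of _ P] exI[of _ ts] exI[of _ Q]) simp
  next
    case False
    then obtain c where c: "c \<in> set us" "s \<in> descendants c" using DNode.prems(3) by auto
    from DNode.IH[OF c(1) child c] obtain path' P' ts' Q' where
      "family ((path @ [opp m d]) @ path') P' ts' Q'" "s \<in> set ts'" "set path' \<subseteq> opp m ` set (node_list c)"
      by blast
    then show ?thesis
      using c(1) by (intro exI[of _ "opp m d # path'"] exI[of _ P'] exI[of _ ts'] exI[of _ Q']) auto
  qed
qed

lemma family_node:
  assumes "family path P ts Q" "c \<in> set ts" "d \<in> set (node_list c)"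
  shows "\<exists>path' P' us Q'. family (path @ path' @ [opp m d]) P' us Q' \<and> DNode d us \<in> descendants c"
proof -
  obtain us where us: "DNode d us \<in> descendants c" using assms(3) set_node_list by metis
  from family_descendant[OF assms(1,2) us] obtain path' P' ts' Q'
    where "family (path @ path') P' ts' Q'" "DNode d us \<in> set ts'" by blast
  then show ?thesis using family_childE us by (metis append.assoc)
qed

lemma entry_family:
  assumes "e \<in> entry_darts"
  shows "\<exists>path P ts Q. family path P ts Q \<and> last path = e"
proof -
  consider (root) "e = root_dart m" | (node) d where "d \<in> node_darts" "e = opp m d"
    using assms unfolding entry_darts_def by blast
  then show ?thesis
  proof cases
    case root
    then show ?thesis using family_root by fastforce
  next
    case node
    then obtain c where "c \<in> set forest" "d \<in> set (node_list c)" by (auto simp: node_darts_def)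
    from family_node[OF family_root this] obtain path P us Q
      where "family ([root_dart m] @ path @ [opp m d]) P us Q" by blast
    moreover have "last ([root_dart m] @ path @ [opp m d]) = e" using node(2) by simp
    ultimately show ?thesis by blast
  qed
qed


subsection \<open>Vertices\<close>

lemma entry_not_examined:
  assumes family: "family path P ts Q" and d: "d \<in> node_darts"
  shows "opp m d \<notin> set (examined path)"
proof
  assume ex: "opp m d \<in> set (examined path)"
  then have "opp m d \<in> set (contours (opp m) ts)" using examined_subset_contours[OF family] by blast
  moreover have "fst ` set (forest_leaves ts) \<subseteq> leaf_darts"
    using family_leaves[OF family] unfolding leaf_darts_def by (rule image_mono)
  ultimately have "d \<in> set (forest_nodes ts)"
    using d family_nodes[OF family] leaf_node_disjoint opp_not_upper[of d]
    unfolding set_contours_eq by (simp del: set_concat set_map) blast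
  then obtain c where c: "c \<in> set ts" "d \<in> set (node_list c)" by auto
  from family_node[OF family c] obtain path' P' us Q'
    where inner: "family (path @ path' @ [opp m d]) P' us Q'" by blast
  have "last path \<in> vertex m (opp m d)" using ex family_vertex[OF family] self_in_vertex vertex_eqI by blast
  also have "\<dots> \<subseteq> insert (opp m d) (set (contours (opp m) us))"
    using family_vertex[OF inner] examined_subset_contours[OF inner] by auto
  finally have last: "last path \<in> insert (opp m d) (set (contours (opp m) us))" .
  show False
  proof (cases "length path = 1")
    case True
    then have "last path = root_dart m" using family_path[OF family] by (auto simp: length_Suc_conv)
    moreover have "root_dart m \<in> set P'" using family_root_before[OF inner] family_path[OF family] by auto
    moreover have "opp m d \<in> set Q'" using family_path_distinct[OF inner] family_path[OF family] by auto
    ultimately show ?thesis using last family_distinct[OF inner] by auto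
  next
    case False
    then have "last path \<in> set (tl path)" "last path \<in> set path"
      using family_path[OF family] by (cases path; auto)+
    then have "last path \<in> set Q'" "last path \<noteq> opp m d"
      using family_path_distinct[OF inner] family_path[OF family] by fastforce+
    then show ?thesis using last family_distinct[OF inner] by auto
  qed
qed

lemma family_vertex_inj:
  assumes "family path P ts Q" "family path' P' ts' Q'" "vertex m (last path) = vertex m (last path')"
  shows "last path = last path'"
proof (rule ccontr)
  assume "last path \<noteq> last path'"
  then have "last path \<in> set (examined path')" "last path' \<in> set (examined path)"
    using assms family_vertex self_in_vertex by (metis insertE)+
  moreover have "last path \<in> opp m ` node_darts \<or> last path' \<in> opp m ` node_darts"
    using \<open>last path \<noteq> last path'\<close> family_last_entry[OF assms(1)] family_last_entry[OF assms(2)]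
    unfolding entry_darts_def by auto
  ultimately show False using entry_not_examined[OF assms(1)] entry_not_examined[OF assms(2)] by auto
qed

lemma inj_on_vertex_entry: "inj_on (vertex m) entry_darts"
  using entry_family family_vertex_inj by (metis inj_onI)

lemma node_vertex_inj:
  "d \<in> node_darts \<Longrightarrow> e \<in> node_darts \<Longrightarrow> vertex m (opp m d) = vertex m (opp m e) \<Longrightarrow> d = e"
  using inj_onD[OF inj_on_vertex_entry, of "opp m d" "opp m e"] by (simp add: entry_darts_def)

lemma node_vertex_neq_root: "d \<in> node_darts \<Longrightarrow> vertex m (opp m d) \<noteq> vertex m (root_dart m)"
  using inj_onD[OF inj_on_vertex_entry, of "opp m d" "root_dart m"] root_upper opp_not_upper[of d]
  by (auto simp: entry_darts_def)

lemma support_rot_disjoint: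
  assumes "e \<in> entry_darts" "e' \<in> entry_darts" "y \<in> set (support (rot m) e)" "y \<in> set (support (rot m) e')"
  shows "e = e'"
  using assms vertex_eqI inj_onD[OF inj_on_vertex_entry] unfolding vertex_eq_set_support[symmetric] by metis

lemma family_path_vertex_inj:
  assumes "family path P ts Q" "i < length path" "j < length path"
    "vertex m (path ! i) = vertex m (path ! j)"
  shows "i = j"
proof -
  have "path ! i = path ! j"
    using inj_onD[OF inj_on_vertex_entry assms(4)] family_path_entry[OF assms(1)] assms(2,3) by force
  then show ?thesis using family_path_distinct[OF assms(1)] assms by (simp add: nth_eq_iff_index_eq)
qed

lemma examined_back_end:
  assumes family: "family path P ts Q" and c: "c \<in> set ts"
    and y: "y \<in> set (contour (opp m) c)" "y \<in> set (examined path)" "y \<noteq> dart c"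
  shows "y \<in> back_ends (opp m) c"
proof -
  have nodes: "set (node_list c) \<subseteq> node_darts" using family_nodes[OF family] c by auto
  have "y \<notin> fst ` set (leaf_list c) \<union> set (node_list c)"
  proof
    assume "y \<in> fst ` set (leaf_list c) \<union> set (node_list c)"
    then obtain s where s: "s \<in> descendants c" "dart s = y" unfolding upper_darts_eq by blast
    from family_descendant[OF family c s(1)] obtain path' P' ts' Q' where
      inner: "family (path @ path') P' ts' Q'" "s \<in> set ts'" "path' = [] \<longrightarrow> s = c" by blast
    have "vertex m (last (path @ path')) = vertex m (last path)"
      using dart_in_vertex[OF inner(1,2)] y(2) family_vertex[OF family] s(2) vertex_eqI by (metis insertI2)
    from family_vertex_inj[OF inner(1) family this] have "path' = []"
      using family_path_distinct[OF inner(1)] family_path[OF family]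
      by (metis IntI distinct_append empty_iff last_appendR last_in_set)
    then show False using inner(3) s(2) y(3) by simp
  qed
  moreover have "y \<notin> opp m ` set (node_list c)" using entry_not_examined[OF family] y(2) nodes by blast
  ultimately show ?thesis using y(1) unfolding set_contour_eq back_ends_def by blast
qed

lemma examined_cases:
  assumes family: "family path P ts Q" and "y \<in> set (examined path)"
  obtains c where "c \<in> set ts" "y = dart c" | c where "c \<in> set ts" "y \<in> back_ends (opp m) c"
proof -
  obtain c where c: "c \<in> set ts" "y \<in> set (contour (opp m) c)"
    using examined_subset_contours[OF family] assms(2) by auto
  then show ?thesis using examined_back_end[OF family c assms(2)] that by blast
qed

lemma in_vertex_of_entry:
  assumes "y \<in> darts m"
  shows "\<exists>e\<in>entry_darts. y \<in> vertex m e"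
proof -
  obtain c where c: "c \<in> set forest" "y \<in> set (contour (opp m) c)" using assms set_contour by auto
  then obtain s where s: "s \<in> descendants c" "y = dart s \<or> y = opp m (dart s)"
    unfolding set_contour_eq upper_darts_eq by blast
  from family_descendant[OF family_root c(1) s(1)] obtain path P ts Q where
    family: "family path P ts Q" "s \<in> set ts" by blast
  show ?thesis
  proof (cases "y = dart s")
    case True
    then show ?thesis using dart_in_vertex[OF family] family_last_entry[OF family(1)] by blast
  next
    case False
    then have y: "y = opp m (dart s)" using s(2) by blast
    show ?thesis
    proof (cases s)
      case (DLeaf d q)
      then obtain i where "i < length path" "y \<in> vertex m (path ! i)"
        using family_explored[OF family] y by auto
      then show ?thesis using family_path_entry[OF family(1)] by (meson nth_mem subsetD)
    next
      case (DNode d us)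
      then have "y \<in> entry_darts" using family_nodes[OF family(1)] family(2) y by (force simp: entry_darts_def)
      then show ?thesis using self_in_vertex by blast
    qed
  qed
qed

lemma vertices_eq: "vertices m = vertex m ` entry_darts"
proof -
  have "\<exists>e\<in>entry_darts. vertex m y = vertex m e" if "y \<in> darts m" for y
    using in_vertex_of_entry[OF that] vertex_eqI by metis
  then show ?thesis using entry_subset_darts unfolding vertices_def by blast
qed

lemma card_vertices: "card (vertices m) = Suc (card node_darts)"
proof -
  have "card (vertices m) = card entry_darts" using inj_on_vertex_entry by (simp add: vertices_eq card_image)
  also have "\<dots> = Suc (card (opp m ` node_darts))"
    unfolding entry_darts_def using root_upper upper_lower_disjoint
    by (subst card_insert_disjoint) (auto simp: node_darts_def)
  finally show ?thesis by (simp add: card_opp_image)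
qed

lemma leaf_label:
  assumes "family path P ts Q" "c \<in> set ts" "(d, q) \<in> set (leaf_list c)"
  shows "-1 \<le> q" and "q < int (length path) - 1 \<Longrightarrow> opp m d \<in> vertex m (path ! nat (q + 1))"
    and "i < length path \<Longrightarrow> opp m d \<in> vertex m (path ! i) \<Longrightarrow> q = int i - 1"
proof -
  have "DLeaf d q \<in> descendants c" using assms(3) set_leaf_list by metis
  from family_descendant[OF assms(1,2) this] obtain path' P' ts' Q' where
    family: "family (path @ path') P' ts' Q'" "DLeaf d q \<in> set ts'" by blast
  then obtain j where j: "j < length (path @ path')" "q = int j - 1"
    "opp m d \<in> vertex m ((path @ path') ! j)" using family_explored[OF family] by auto
  then show "-1 \<le> q" by simp
  show "opp m d \<in> vertex m (path ! nat (q + 1))" if "q < int (length path) - 1"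
    using j that by (simp add: nth_append split: if_splits)
  show "q = int i - 1" if "i < length path" "opp m d \<in> vertex m (path ! i)"
  proof -
    have "vertex m ((path @ path') ! i) = vertex m ((path @ path') ! j)"
      using that j(3) vertex_eqI by (metis nth_append)
    from family_path_vertex_inj[OF family(1) _ j(1) this] that j show ?thesis by simp
  qed
qed

lemma back_end_examined_iff:
  assumes family: "family path P ts Q" "c \<in> set ts" "(d, q) \<in> set (leaf_list c)"
  shows "opp m d \<in> set (examined path) \<longleftrightarrow> q = int (length path) - 2"
proof -
  define n where "n = length path - 1"
  then have n: "length path = Suc n" "path ! n = last path"
    using family_path[OF family(1)] by (auto simp: last_conv_nth)
  have "opp m d \<noteq> last path"
    using entry_not_back_end[OF family_last_entry[OF family(1)]] family_leaf_darts[OF family]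
    unfolding all_back_ends_def by (metis imageI)
  then have "opp m d \<in> set (examined path) \<longleftrightarrow> opp m d \<in> vertex m (path ! n)"
    using family_vertex[OF family(1)] n(2) by simp
  also have "\<dots> \<longleftrightarrow> q = int n - 1"
    using leaf_label(2)[OF family] leaf_label(3)[OF family, of n] n(1) by auto
  finally show ?thesis using n(1) by simp
qed


subsection \<open>Connectedness and planarity\<close>

lemma family_reach:
  "family path P ts Q \<Longrightarrow> (root_dart m, last path) \<in> dart_step\<^sup>* \<and> (last path, root_dart m) \<in> dart_step\<^sup>*"
proof (induction rule: family.induct)
  case (family_child path P us d ts vs Q)
  have "d \<in> vertex m (last path)" using dart_in_vertex[OF family_child.hyps, of "DNode d ts"] by simp
  then have "(last path, d) \<in> dart_step\<^sup>*" "(d, last path) \<in> dart_step\<^sup>*"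
    using vertex_reach vertex_eqI self_in_vertex by metis+
  moreover have "(d, opp m d) \<in> dart_step\<^sup>*" "(opp m d, d) \<in> dart_step\<^sup>*"
    using opp_reach[of d] opp_reach[of "opp m d"] by auto
  ultimately show ?case using family_child.IH by (metis last_snoc rtrancl_trans)
qed simp

lemma root_reach:
  assumes "y \<in> darts m"
  shows "(root_dart m, y) \<in> dart_step\<^sup>* \<and> (y, root_dart m) \<in> dart_step\<^sup>*"
proof -
  obtain e where "e \<in> entry_darts" "y \<in> vertex m e" using in_vertex_of_entry[OF assms] by blast
  then show ?thesis
    using entry_family family_reach vertex_reach vertex_eqI self_in_vertex by (metis rtrancl_trans)
qed

lemma rooted_map: "rooted_map m"
  unfolding rooted_map_def dart_step_def[symmetric]
  using finite_darts rot_permutes opp_permutes opp_involution root_in_darts root_reach by (meson rtrancl_trans)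

lemma planar_map_iff: "planar_map m \<longleftrightarrow> num_cycles (rot m \<circ> opp m) (darts m) = Suc (card leaf_darts)"
  using rooted_map unfolding planar_map_def card_vertices card_edges_eq_leaves_nodes card_faces by auto

end


section \<open>Depth-first exploration\<close>

lemma explore_skip: "set ds \<subseteq> ex \<Longrightarrow> explore k m p (ds @ ds') (dep, ex) = explore k m p ds' (dep, ex)"
  by (induction ds) auto

context combinatorial_map
begin

text \<open>
  The computation of \<open>explore\<close> without the bound on the number of descents, recording the annotated
  trees and the path instead of its length.
\<close>

inductive explores :: "'d list \<Rightarrow> 'd list \<Rightarrow> ('d set \<rightharpoonup> int) \<times> 'd set \<Rightarrow> 'd dart_tree list
    \<Rightarrow> ('d set \<rightharpoonup> int) \<times> 'd set \<Rightarrow> bool" where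
  explores_Nil: "explores path [] st [] st"
| explores_skip: "d \<in> ex \<Longrightarrow> explores path ds (dep, ex) ts st \<Longrightarrow> explores path (d # ds) (dep, ex) ts st"
| explores_back: "d \<notin> ex \<Longrightarrow> dep (vertex m (opp m d)) = Some q \<Longrightarrow>
    explores path ds (dep, ex \<union> {d, opp m d}) ts st \<Longrightarrow>
    explores path (d # ds) (dep, ex) (DLeaf d q # ts) st"
| explores_descend: "d \<notin> ex \<Longrightarrow> dep (vertex m (opp m d)) = None \<Longrightarrow>
    explores (path @ [opp m d]) (tl (support (rot m) (opp m d)))
      (dep(vertex m (opp m d) \<mapsto> int (length path) - 1), ex \<union> {d, opp m d}) us st \<Longrightarrow>
    explores path ds st ts st' \<Longrightarrow>
    explores path (d # ds) (dep, ex) (DNode d us # ts) st'"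

lemma explore_eq_if_explores:
  "explores path ds st ts st' \<Longrightarrow> length (forest_nodes ts) \<le> k \<Longrightarrow>
    explore k m (int (length path) - 2) ds st = (map erase ts, st')"
proof (induction arbitrary: k rule: explores.induct)
  case (explores_descend d ex dep path us st ds ts st')
  then obtain k' where k: "k = Suc k'" by (cases k) auto
  let ?st = "(dep(vertex m (opp m d) \<mapsto> int (length path) - 1), ex \<union> {d, opp m d})"
  have "explore k' m (int (length path) - 1) ([opp m d] @ tl (support (rot m) (opp m d))) ?st =
      (map erase us, st)"
    using explores_descend.IH(1)[of k'] explores_descend.prems k by (subst explore_skip) auto
  then have "explore k' m (int (length path) - 1) (support (rot m) (opp m d)) ?st = (map erase us, st)"
    using support_rot_Cons[of "opp m d"] by (metis append_Cons append_Nil)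
  moreover have "explore k m (int (length path) - 2) ds st = (map erase ts, st')"
    using explores_descend.IH(2) explores_descend.prems by simp
  ultimately show ?case using explores_descend.hyps(1,2) k by (simp add: Let_def rev_map)
qed (simp_all add: Let_def)


subsection \<open>Soundness\<close>

lemma explores_state:
  "explores path ds st ts st' \<Longrightarrow>
    snd st' = snd st \<union> set (contours (opp m) ts) \<and> set ds \<subseteq> snd st' \<and> fst st \<subseteq>\<^sub>m fst st'"
proof (induction rule: explores.induct)
  case (explores_descend d ex dep path us st ds ts st')
  then have "dep \<subseteq>\<^sub>m dep(vertex m (opp m d) \<mapsto> int (length path) - 1)" by (auto simp: map_le_def)
  then have "dep \<subseteq>\<^sub>m fst st'" using explores_descend.IH by (metis fst_conv map_le_trans)
  then show ?case using explores_descend.IH by (auto simp del: fun_upd_apply)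
qed auto

lemma explores_arranged: "explores path ds st ts st' \<Longrightarrow> arranged (opp m) (snd st) ts ds"
proof (induction rule: explores.induct)
  case (explores_skip d ex path ds dep ts st)
  then show ?case by (simp add: arranged_skip)
next
  case (explores_back d ex dep q path ds ts st)
  then show ?case using arranged_Cons[of "opp m" ex "DLeaf d q" ts ds] by (simp del: arranged.simps)
next
  case (explores_descend d ex dep path us st ds ts st')
  have "snd st = ex \<union> set (contour (opp m) (DNode d us))"
    using explores_state[OF explores_descend.hyps(3)] by auto
  then show ?case
    using explores_descend.IH(2) arranged_Cons[of "opp m" ex "DNode d us" ts ds] by (simp del: arranged.simps)
qed simp

lemma explores_distinct:
  "explores path ds st ts st' \<Longrightarrow> set ds \<subseteq> darts m \<Longrightarrow> opp m ` snd st \<subseteq> snd st \<Longrightarrow>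
    distinct (contours (opp m) ts) \<and> set (contours (opp m) ts) \<inter> snd st = {}"
proof (induction rule: explores.induct)
  case (explores_back d ex dep q path ds ts st)
  then have "opp m d \<notin> ex" by (metis image_subset_iff opp_opp snd_conv)
  then show ?case using explores_back opp_involution[of d] by auto
next
  case (explores_descend d ex dep path us st ds ts st')
  have d: "d \<in> darts m" "opp m d \<notin> ex"
    using explores_descend.prems explores_descend.hyps(1) by (auto simp: image_subset_iff)
  then have "set (tl (support (rot m) (opp m d))) \<subseteq> darts m" using tl_support_subset_darts[of "opp m d"] by simp
  then have us: "distinct (contours (opp m) us) \<and> set (contours (opp m) us) \<inter> (ex \<union> {d, opp m d}) = {}"
    using explores_descend.IH(1) explores_descend.prems by auto
  have st: "snd st = ex \<union> set (contour (opp m) (DNode d us))"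
    using explores_state[OF explores_descend.hyps(3)] by auto
  have "opp m ` set (contour (opp m) (DNode d us)) \<subseteq> set (contour (opp m) (DNode d us))"
    using contour_closed[of "opp m" _ "DNode d us", OF opp_opp] by blast
  then have "opp m ` snd st \<subseteq> snd st" unfolding st image_Un using explores_descend.prems by auto
  then have "distinct (contours (opp m) ts) \<and> set (contours (opp m) ts) \<inter> snd st = {}"
    using explores_descend.IH(2) explores_descend.prems by auto
  then show ?case using us d explores_descend.hyps(1) opp_involution[of d] st by auto
qed auto

definition depths_recorded :: "'d list \<Rightarrow> ('d set \<rightharpoonup> int) \<Rightarrow> bool" where
  "depths_recorded path dep \<longleftrightarrow> (\<forall>i<length path. dep (vertex m (path ! i)) = Some (int i - 1))"

definition finished_off_path :: "'d list \<Rightarrow> ('d set \<rightharpoonup> int) \<Rightarrow> 'd set \<Rightarrow> bool" where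
  "finished_off_path path dep ex \<longleftrightarrow> (\<forall>y\<in>darts m. \<forall>q. dep (vertex m y) = Some q \<longrightarrow>
     vertex m y \<subseteq> ex \<or> (\<exists>i<length path. vertex m y = vertex m (path ! i) \<and> q = int i - 1))"

definition exploration_inv :: "'d list \<Rightarrow> ('d set \<rightharpoonup> int) \<times> 'd set \<Rightarrow> bool" where
  "exploration_inv path st \<longleftrightarrow>
     path \<noteq> [] \<and> set path \<subseteq> darts m \<and> depths_recorded path (fst st) \<and> finished_off_path path (fst st) (snd st) \<and>
     (\<forall>y\<in>snd st. fst st (vertex m y) \<noteq> None) \<and> snd st \<subseteq> darts m \<and> opp m ` snd st \<subseteq> snd st"

lemma finished_off_pathD:
  assumes "finished_off_path path dep ex" "y \<in> darts m" "dep (vertex m y) = Some q"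
  shows "vertex m y \<subseteq> ex \<or> (\<exists>i<length path. vertex m y = vertex m (path ! i) \<and> q = int i - 1)"
  using assms unfolding finished_off_path_def by blast

lemma exploration_invD:
  assumes "exploration_inv path (dep, ex)"
  shows "path \<noteq> []" "set path \<subseteq> darts m" "depths_recorded path dep" "finished_off_path path dep ex"
    "y \<in> ex \<Longrightarrow> dep (vertex m y) \<noteq> None" "ex \<subseteq> darts m" "opp m ` ex \<subseteq> ex"
  using assms unfolding exploration_inv_def by auto

lemma exploration_inv_last:
  assumes "exploration_inv path (dep, ex)" "d \<in> vertex m (last path)"
  shows "dep (vertex m d) \<noteq> None" "d \<in> darts m"
proof -
  note inv = exploration_invD[OF assms(1)]
  have "vertex m d = vertex m (path ! (length path - 1))"
    using vertex_eqI[OF assms(2)] inv(1) by (simp add: last_conv_nth)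
  then show "dep (vertex m d) \<noteq> None" using inv(1,3) by (simp add: depths_recorded_def)
  have "last path \<in> darts m" using inv(1,2) by auto
  then show "d \<in> darts m" using assms(2) vertex_subset_darts by blast
qed

lemma exploration_inv_back:
  assumes "exploration_inv path (dep, ex)" "d \<in> vertex m (last path)" "dep (vertex m (opp m d)) \<noteq> None"
  shows "exploration_inv path (dep, ex \<union> {d, opp m d})"
proof -
  note inv = exploration_invD[OF assms(1)] and d = exploration_inv_last[OF assms(1,2)]
  have "finished_off_path path dep (ex \<union> {d, opp m d})"
    using inv(4) unfolding finished_off_path_def by (meson le_supI1)
  then show ?thesis using inv d assms(3) by (auto simp: exploration_inv_def)
qed

lemma depths_recorded_snoc:
  assumes "depths_recorded path dep" "dep (vertex m e) = None"
  shows "depths_recorded (path @ [e]) (dep(vertex m e \<mapsto> int (length path) - 1))"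
  using assms unfolding depths_recorded_def by (auto simp: nth_append less_Suc_eq)

lemma exploration_inv_descend:
  assumes "exploration_inv path (dep, ex)" "d \<in> vertex m (last path)" "dep (vertex m (opp m d)) = None"
  shows "exploration_inv (path @ [opp m d])
    (dep(vertex m (opp m d) \<mapsto> int (length path) - 1), ex \<union> {d, opp m d})"
proof -
  let ?x = "vertex m (opp m d)" and ?path = "path @ [opp m d]" and ?ex = "ex \<union> {d, opp m d}"
  let ?dep = "dep(?x \<mapsto> int (length path) - 1)"
  note inv = exploration_invD[OF assms(1)] and d = exploration_inv_last[OF assms(1,2)]
  have "finished_off_path ?path ?dep ?ex"
    unfolding finished_off_path_def
  proof (intro ballI allI impI)
    fix y q assume y: "y \<in> darts m" "?dep (vertex m y) = Some q"
    show "vertex m y \<subseteq> ?ex \<or> (\<exists>i<length ?path. vertex m y = vertex m (?path ! i) \<and> q = int i - 1)"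
    proof (cases "vertex m y = ?x")
      case True
      then show ?thesis using y(2) by (intro disjI2 exI[of _ "length path"]) simp
    next
      case False
      then have "dep (vertex m y) = Some q" using y(2) by simp
      from finished_off_pathD[OF inv(4) y(1) this] show ?thesis
      proof (elim disjE exE conjE)
        fix i assume "i < length path" "vertex m y = vertex m (path ! i)" "q = int i - 1"
        then show ?thesis by (intro disjI2 exI[of _ i]) (simp add: nth_append)
      qed blast
    qed
  qed
  moreover have "?dep (vertex m y) \<noteq> None" if "y \<in> ?ex" for y using that inv(5) d by auto
  moreover have "?ex \<subseteq> darts m" "opp m ` ?ex \<subseteq> ?ex" "set ?path \<subseteq> darts m" using inv(2,6,7) d by auto
  ultimately show ?thesis
    using depths_recorded_snoc[OF inv(3) assms(3)] unfolding exploration_inv_def by simp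
qed

lemma exploration_inv_return:
  assumes "exploration_inv (path @ [e]) (dep, ex)" "path \<noteq> []" "vertex m e \<subseteq> ex"
  shows "exploration_inv path (dep, ex)"
proof -
  note inv = exploration_invD[OF assms(1)]
  have "depths_recorded path dep"
    using inv(3) unfolding depths_recorded_def by (metis length_append_singleton less_SucI nth_append)
  moreover have "finished_off_path path dep ex"
    unfolding finished_off_path_def
  proof (intro ballI allI impI)
    fix y q assume y: "y \<in> darts m" "dep (vertex m y) = Some q"
    from finished_off_pathD[OF inv(4) y]
    show "vertex m y \<subseteq> ex \<or> (\<exists>i<length path. vertex m y = vertex m (path ! i) \<and> q = int i - 1)"
      using assms(3) by (auto simp: nth_append less_Suc_eq)
  qed
  ultimately show ?thesis using inv(2,5-7) assms(2) by (simp add: exploration_inv_def)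
qed

lemma explores_descend_explored:
  assumes "exploration_inv path (dep, ex)" "d \<in> vertex m (last path)" "dep (vertex m (opp m d)) = None"
    and us: "explores (path @ [opp m d]) (tl (support (rot m) (opp m d))) (dep', ex \<union> {d, opp m d}) us st"
      "\<forall>c\<in>set us. explored m (path @ [opp m d]) c"
  shows "explored m path (DNode d us)"
proof -
  let ?ds = "tl (support (rot m) (opp m d))"
  note inv = exploration_invD[OF assms(1)]
  have "y \<notin> ex \<union> {d, opp m d}" if y: "y \<in> set ?ds" for y
  proof -
    have "vertex m y = vertex m (opp m d)" using vertex_eqI y vertex_eq_insert_tl by blast
    then have "dep (vertex m y) = None" using assms(3) by simp
    then show ?thesis using inv(5) exploration_inv_last(1)[OF assms(1,2)] not_in_tl_support_rot y by blast
  qed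
  then have "(ex \<union> {d, opp m d}) \<inter> set ?ds \<subseteq> {}" by blast
  then have "arranged (opp m) {} us ?ds" using arranged_restrict[OF explores_arranged[OF us(1)]] by simp
  then show ?thesis using us(2) by simp
qed

lemma explores_sound:
  "explores path ds st ts st' \<Longrightarrow> exploration_inv path st \<Longrightarrow> set ds \<subseteq> vertex m (last path) \<Longrightarrow>
    exploration_inv path st' \<and> (\<forall>c\<in>set ts. explored m path c)"
proof (induction rule: explores.induct)
  case (explores_back d ex dep q path ds ts st)
  note inv = exploration_invD[OF explores_back.prems(1)]
  have d: "d \<in> vertex m (last path)" using explores_back.prems(2) by simp
  have "\<not> vertex m (opp m d) \<subseteq> ex"
    using inv(7) explores_back.hyps(1) self_in_vertex by (metis image_subset_iff opp_opp subsetD)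
  moreover have "opp m d \<in> darts m" using exploration_inv_last(2)[OF explores_back.prems(1) d] by simp
  ultimately have "\<exists>i<length path. vertex m (opp m d) = vertex m (path ! i) \<and> q = int i - 1"
    using finished_off_pathD[OF inv(4) _ explores_back.hyps(2)] by blast
  then have "explored m path (DLeaf d q)" using self_in_vertex[of "opp m d"] by auto
  moreover have "exploration_inv path (dep, ex \<union> {d, opp m d})"
    using exploration_inv_back[OF explores_back.prems(1) d] explores_back.hyps(2) by simp
  ultimately show ?case using explores_back.IH explores_back.prems(2) by simp
next
  case (explores_descend d ex dep path us st ds ts st')
  let ?x = "vertex m (opp m d)" and ?ds = "tl (support (rot m) (opp m d))"
  note inv = exploration_invD[OF explores_descend.prems(1)]
  have d: "d \<in> vertex m (last path)" using explores_descend.prems(2) by simp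
  have x: "?x = insert (opp m d) (set ?ds)" by (rule vertex_eq_insert_tl)
  have us: "exploration_inv (path @ [opp m d]) st" "\<forall>c\<in>set us. explored m (path @ [opp m d]) c"
    using exploration_inv_descend[OF explores_descend.prems(1) d explores_descend.hyps(2)]
      explores_descend.IH(1) x
    by auto
  then have node: "explored m path (DNode d us)"
    using explores_descend_explored[OF explores_descend.prems(1) d explores_descend.hyps(2,3)] by simp
  have "?x \<subseteq> snd st" using explores_state[OF explores_descend.hyps(3)] x by auto
  then have "exploration_inv path st"
    using exploration_inv_return[of path "opp m d" "fst st" "snd st"] us(1) inv(1) by simp
  then show ?case using explores_descend.IH(2) explores_descend.prems(2) node by simp
qed simp_all


subsection \<open>Existence\<close>

definition unvisited :: "('d set \<rightharpoonup> int) \<Rightarrow> nat" where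
  "unvisited dep = card {x \<in> vertices m. dep x = None}"

lemma unvisited_upd_less:
  assumes "x \<in> vertices m" "dep x = None"
  shows "unvisited (dep(x \<mapsto> p)) < unvisited dep"
proof -
  have "{y \<in> vertices m. (dep(x \<mapsto> p)) y = None} \<subset> {y \<in> vertices m. dep y = None}" using assms by auto
  then show ?thesis unfolding unvisited_def using finite_vertices by (intro psubset_card_mono) simp_all
qed

lemma unvisited_antimono:
  assumes "dep \<subseteq>\<^sub>m dep'"
  shows "unvisited dep' \<le> unvisited dep"
proof -
  have "{x \<in> vertices m. dep' x = None} \<subseteq> {x \<in> vertices m. dep x = None}"
    using map_le_implies_dom_le[OF assms] by auto
  then show ?thesis unfolding unvisited_def using finite_vertices by (intro card_mono) simp_all
qed

lemma explores_exists:
  assumes "set ds \<subseteq> darts m" "unvisited (fst st) \<le> k"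
  shows "\<exists>ts st'. explores path ds st ts st'"
  using assms
proof (induction k arbitrary: path ds st rule: less_induct)
  case (less k)
  note fewer_unvisited = less.IH
  from less.prems show ?case
  proof (induction ds arbitrary: st)
    case (Cons d ds)
    obtain dep ex where st: "st = (dep, ex)" by (cases st)
    have ds: "set ds \<subseteq> darts m" and x: "vertex m (opp m d) \<in> vertices m"
      using Cons.prems(1) vertex_in_vertices by auto
    consider (examined) "d \<in> ex" | (visited) q where "d \<notin> ex" "dep (vertex m (opp m d)) = Some q"
      | (descend) "d \<notin> ex" "dep (vertex m (opp m d)) = None" by blast
    then show ?case
    proof cases
      case examined
      then show ?thesis using Cons.IH[OF ds Cons.prems(2)] explores_skip st by blast
    next
      case visited
      then show ?thesis
        using Cons.IH[OF ds, of "(dep, ex \<union> {d, opp m d})"] Cons.prems(2) explores_back st by fastforce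
    next
      case descend
      let ?st = "(dep(vertex m (opp m d) \<mapsto> int (length path) - 1), ex \<union> {d, opp m d})"
      have fewer: "unvisited (fst ?st) < k"
        using unvisited_upd_less[of _ dep "int (length path) - 1", OF x descend(2)] Cons.prems(2) st by simp
      moreover have "set (tl (support (rot m) (opp m d))) \<subseteq> darts m"
        using tl_support_subset_darts Cons.prems(1) by simp
      ultimately obtain us st1
        where us: "explores (path @ [opp m d]) (tl (support (rot m) (opp m d))) ?st us st1"
        using fewer_unvisited[OF _ _ order_refl] by blast
      have "unvisited (fst st1) \<le> unvisited (fst ?st)" using explores_state[OF us] unvisited_antimono by blast
      then have "unvisited (fst st1) \<le> k" using fewer by simp
      then show ?thesis using Cons.IH[OF ds, of st1] explores_descend[OF descend us] st by blast
    qed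
  qed (use explores_Nil in blast)
qed

lemma exploration_complete:
  assumes "rooted_map m" "exploration_inv [root_dart m] (dep, ex)" "vertex m (root_dart m) \<subseteq> ex"
  shows "ex = darts m"
proof
  note inv = exploration_invD[OF assms(2)]
  show "ex \<subseteq> darts m" by (rule inv(6))
  have rot: "rot m y \<in> ex" if "y \<in> ex" for y
  proof -
    have "y \<in> darts m" "dep (vertex m y) \<noteq> None" using that inv(5,6) by auto
    then have "vertex m y \<subseteq> ex \<or> vertex m y = vertex m (root_dart m)"
      using finished_off_pathD[OF inv(4)] by fastforce
    moreover have "rot m y \<in> vertex m y" unfolding vertex_def by (rule orbit.base)
    ultimately show ?thesis using assms(3) by blast
  qed
  have "y \<in> ex" if "(root_dart m, y) \<in> dart_step\<^sup>*" for y
    using that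
  proof induction
    case base
    then show ?case using assms(3) self_in_vertex by blast
  next
    case (step y z)
    then show ?case using rot inv(7) unfolding dart_step_def by blast
  qed
  then show "darts m \<subseteq> ex" using assms(1) root_in_darts unfolding rooted_map_def dart_step_def by blast
qed

end

lemma explored_map_exists:
  assumes "rooted_map m"
  shows "\<exists>forest. explored_map m forest"
proof -
  interpret combinatorial_map m using combinatorial_map_if_rooted[OF assms] .
  let ?r = "root_dart m"
  let ?st = "([vertex m ?r \<mapsto> -1], {}) :: ('a set \<rightharpoonup> int) \<times> 'a set"
  have support: "set (support (rot m) ?r) = vertex m ?r" using vertex_eq_set_support by blast
  then have support_darts: "set (support (rot m) ?r) \<subseteq> darts m"
    using vertex_subset_darts[OF root_in_darts] by blast
  from explores_exists[OF this order_refl] obtain ts st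
    where "explores [?r] (support (rot m) ?r) ?st ts st" by blast
  then obtain dep ex where ts: "explores [?r] (support (rot m) ?r) ?st ts (dep, ex)" by (cases st) blast
  have "exploration_inv [?r] ?st"
    using root_in_darts
    by (auto simp: exploration_inv_def depths_recorded_def finished_off_path_def split: if_splits)
  from explores_sound[OF ts this] have inv: "exploration_inv [?r] (dep, ex)"
    and explored: "\<forall>c\<in>set ts. explored m [?r] c" using support by auto
  have "ex = set (contours (opp m) ts)" "vertex m ?r \<subseteq> ex"
    using explores_state[OF ts] support by auto
  then have "set (contours (opp m) ts) = darts m" using exploration_complete[OF assms inv] by simp
  then have "explored_map m ts"
    using explores_distinct[OF ts support_darts] explores_arranged[OF ts] explored by unfold_locales auto
  then show ?thesis by blast
qed


subsection \<open>Completeness\<close>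

context explored_map
begin

definition node_vertices :: "'d dart_tree list \<Rightarrow> 'd set set" where
  "node_vertices ts = (\<lambda>d. vertex m (opp m d)) ` set (forest_nodes ts)"

lemma node_vertices_simps [simp]:
  "node_vertices (DLeaf d q # us) = node_vertices us"
  "node_vertices (DNode d vs # us) = insert (vertex m (opp m d)) (node_vertices vs \<union> node_vertices us)"
  by (simp_all add: node_vertices_def image_Un)

definition unexplored :: "'d dart_tree list \<Rightarrow> ('d set \<rightharpoonup> int) \<times> 'd set \<Rightarrow> bool" where
  "unexplored ts st \<longleftrightarrow>
     set (contours (opp m) ts) \<inter> snd st = {} \<and> (\<forall>x\<in>node_vertices ts. fst st x = None)"

lemma explores_skip_list:
  "set ys \<subseteq> ex \<Longrightarrow> explores path ds (dep, ex) ts st \<Longrightarrow> explores path (ys @ ds) (dep, ex) ts st"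
  by (induction ys) (auto intro: explores_skip)

lemma node_vertices_disjoint:
  assumes "family path P (ws @ DNode d vs # us) Q"
  shows "vertex m (opp m d) \<notin> node_vertices vs" "vertex m (opp m d) \<notin> node_vertices us"
    "node_vertices vs \<inter> node_vertices us = {}"
proof -
  have "distinct (contours (opp m) (DNode d vs # us))" using family_distinct[OF assms] by auto
  from distinct_contours_darts(2)[OF this]
  have "d \<notin> set (forest_nodes vs)" "d \<notin> set (forest_nodes us)"
    "set (forest_nodes vs) \<inter> set (forest_nodes us) = {}" by auto
  moreover have "d \<in> node_darts" "set (forest_nodes vs) \<subseteq> node_darts" "set (forest_nodes us) \<subseteq> node_darts"
    using family_nodes[OF assms] by auto
  ultimately show "vertex m (opp m d) \<notin> node_vertices vs" "vertex m (opp m d) \<notin> node_vertices us"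
    "node_vertices vs \<inter> node_vertices us = {}"
    using node_vertex_inj unfolding node_vertices_def by blast+
qed

lemma unexplored_descend:
  assumes family: "family path P (ws @ DNode d vs # us) Q" and "unexplored (DNode d vs # us) (dep, ex)"
  shows "unexplored vs (dep(vertex m (opp m d) \<mapsto> q), ex \<union> {d, opp m d})"
    and "\<forall>x. x \<notin> node_vertices vs \<longrightarrow> dep' x = (dep(vertex m (opp m d) \<mapsto> q)) x \<Longrightarrow>
      unexplored us (dep', ex \<union> set (contour (opp m) (DNode d vs)))"
proof -
  have distinct: "distinct (contours (opp m) (DNode d vs # us))" using family_distinct[OF family] by auto
  note nodes = node_vertices_disjoint[OF family]
  have "(dep(vertex m (opp m d) \<mapsto> q)) x = None" if x: "x \<in> node_vertices vs" for x
  proof -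
    have "x \<noteq> vertex m (opp m d)" using x nodes(1) by blast
    moreover have "dep x = None" using x assms(2) unfolding unexplored_def by auto
    ultimately show ?thesis by simp
  qed
  moreover have "set (contours (opp m) vs) \<inter> (ex \<union> {d, opp m d}) = {}"
    using assms(2) distinct unfolding unexplored_def by auto
  ultimately show "unexplored vs (dep(vertex m (opp m d) \<mapsto> q), ex \<union> {d, opp m d})"
    unfolding unexplored_def by simp
  assume dep': "\<forall>x. x \<notin> node_vertices vs \<longrightarrow> dep' x = (dep(vertex m (opp m d) \<mapsto> q)) x"
  have "dep' x = None" if x: "x \<in> node_vertices us" for x
  proof -
    have "x \<notin> node_vertices vs" "x \<noteq> vertex m (opp m d)" using x nodes(2,3) by blast+
    then have "dep' x = dep x" using dep' by simp
    also have "\<dots> = None" using x assms(2) unfolding unexplored_def by auto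
    finally show ?thesis .
  qed
  moreover have "set (contours (opp m) us) \<inter> (ex \<union> set (contour (opp m) (DNode d vs))) = {}"
    using assms(2) distinct unfolding unexplored_def by auto
  ultimately show "unexplored us (dep', ex \<union> set (contour (opp m) (DNode d vs)))"
    unfolding unexplored_def by simp
qed

definition explores_exactly :: "'d list \<Rightarrow> 'd list \<Rightarrow> ('d set \<rightharpoonup> int) \<times> 'd set \<Rightarrow> 'd dart_tree list \<Rightarrow> bool" where
  "explores_exactly path ds st ts \<longleftrightarrow>
     (\<exists>dep. explores path ds st ts (dep, snd st \<union> set (contours (opp m) ts)) \<and>
        (\<forall>x. x \<notin> node_vertices ts \<longrightarrow> dep x = fst st x))"

lemma explores_exactly_Nil:
  assumes "set ds \<subseteq> snd st"
  shows "explores_exactly path ds st []"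
proof -
  have "explores path (ds @ []) st [] st"
    using assms explores_skip_list[of ds "snd st" path "[]" "fst st" "[]" st] explores_Nil by simp
  then show ?thesis unfolding explores_exactly_def by (intro exI[of _ "fst st"]) simp
qed

lemma explores_exactly_skip:
  assumes "explores_exactly path ds st ts" "set ys \<subseteq> snd st"
  shows "explores_exactly path (ys @ ds) st ts"
proof -
  have "explores path (ys @ ds) st ts st'" if "explores path ds st ts st'" for st'
    using explores_skip_list[of ys "snd st" path ds "fst st"] assms(2) that by simp
  then show ?thesis using assms(1) unfolding explores_exactly_def by blast
qed

lemma explores_exactly_leaf:
  assumes family: "family path P (ws @ DLeaf d q # us) Q" and "unexplored (DLeaf d q # us) (dep, ex)"
    and "depths_recorded path dep"
    and rest: "unexplored us (dep, ex \<union> {d, opp m d}) \<Longrightarrow> explores_exactly path ds (dep, ex \<union> {d, opp m d}) us"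
  shows "explores_exactly path (d # ds) (dep, ex) (DLeaf d q # us)"
proof -
  obtain i where "i < length path" "q = int i - 1" "opp m d \<in> vertex m (path ! i)"
    using family_explored[OF family, of "DLeaf d q"] by auto
  then have dep: "dep (vertex m (opp m d)) = Some q"
    using assms(3) vertex_eqI unfolding depths_recorded_def by metis
  have d: "d \<notin> ex" using assms(2) by (simp add: unexplored_def)
  have "unexplored us (dep, ex \<union> {d, opp m d})"
    using assms(2) family_distinct[OF family] by (auto simp: unexplored_def)
  from rest[OF this] obtain dep' where dep':
    "explores path ds (dep, ex \<union> {d, opp m d}) us (dep', ex \<union> set (contours (opp m) (DLeaf d q # us)))"
    "\<forall>x. x \<notin> node_vertices us \<longrightarrow> dep' x = dep x"
    unfolding explores_exactly_def by (auto simp: insert_commute)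
  show ?thesis
    unfolding explores_exactly_def fst_conv snd_conv
    using explores_back[of d ex dep q path, OF d dep] dep' by (intro exI[of _ dep'] conjI) simp_all
qed

lemma explores_exactly_node:
  assumes family: "family path P (ws @ DNode d vs # us) Q"
    and unexplored: "unexplored (DNode d vs # us) (dep, ex)"
    and path: "depths_recorded path dep"
    and descend: "\<And>dep' ex'. unexplored vs (dep', ex') \<Longrightarrow> depths_recorded (path @ [opp m d]) dep' \<Longrightarrow>
      explores_exactly (path @ [opp m d]) (tl (support (rot m) (opp m d))) (dep', ex') vs"
    and rest: "\<And>dep'. unexplored us (dep', ex \<union> set (contour (opp m) (DNode d vs))) \<Longrightarrow>
      depths_recorded path dep' \<Longrightarrow>
      explores_exactly path ds (dep', ex \<union> set (contour (opp m) (DNode d vs))) us"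
  shows "explores_exactly path (d # ds) (dep, ex) (DNode d vs # us)"
proof -
  let ?dep = "dep(vertex m (opp m d) \<mapsto> int (length path) - 1)"
  have dep: "dep (vertex m (opp m d)) = None" and d: "d \<notin> ex" using unexplored by (auto simp: unexplored_def)
  have "ex \<union> {d, opp m d} \<union> set (contours (opp m) vs) = ex \<union> set (contour (opp m) (DNode d vs))" by auto
  with descend[OF unexplored_descend(1)[OF family unexplored]] depths_recorded_snoc[OF path dep]
  obtain dep1
    where dep1: "explores (path @ [opp m d]) (tl (support (rot m) (opp m d))) (?dep, ex \<union> {d, opp m d})
      vs (dep1, ex \<union> set (contour (opp m) (DNode d vs)))"
    "\<forall>x. x \<notin> node_vertices vs \<longrightarrow> dep1 x = ?dep x"
    unfolding explores_exactly_def by (metis fst_conv snd_conv)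
  have "dep1 (vertex m (path ! i)) = Some (int i - 1)" if "i < length path" for i
  proof -
    have "dep (vertex m (path ! i)) = Some (int i - 1)"
      using path that by (simp add: depths_recorded_def)
    moreover have "x \<notin> node_vertices vs \<and> x \<noteq> vertex m (opp m d)" if "dep x \<noteq> None" for x
      using that unexplored unfolding unexplored_def by auto
    ultimately show ?thesis using dep1(2) by (metis fun_upd_other option.distinct(1))
  qed
  then have "depths_recorded path dep1" by (simp add: depths_recorded_def)
  from rest[OF unexplored_descend(2)[OF family unexplored dep1(2)] this]
  obtain dep2 where dep2: "explores path ds (dep1, ex \<union> set (contour (opp m) (DNode d vs))) us
      (dep2, ex \<union> set (contours (opp m) (DNode d vs # us)))"
    "\<forall>x. x \<notin> node_vertices us \<longrightarrow> dep2 x = dep1 x"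
    unfolding explores_exactly_def by (auto simp: Un_assoc)
  show ?thesis
    unfolding explores_exactly_def fst_conv snd_conv
    using explores_descend[of d ex dep path, OF d dep dep1(1) dep2(1)] dep1(2) dep2(2)
    by (intro exI[of _ dep2] conjI) simp_all
qed

lemma explores_family:
  assumes "family path P (ws @ ts) Q" "arranged (opp m) E ts ds" "E \<subseteq> ex" "unexplored ts (dep, ex)"
    "depths_recorded path dep"
  shows "explores_exactly path ds (dep, ex) ts"
  using assms
proof (induction "length (contours (opp m) ts)" arbitrary: path P ws ts Q E ds ex dep rule: less_induct)
  case less
  show ?case
  proof (cases ts)
    case (Cons c us)
    obtain ys zs where ds: "ds = ys @ dart c # zs" "set ys \<subseteq> ex"
      and us: "arranged (opp m) (E \<union> set (contour (opp m) c)) us zs" using less.prems(2,3) Cons by auto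
    have family: "family path P (ws @ c # us) Q" "family path P ((ws @ [c]) @ us) Q"
      using less.prems(1) Cons by auto
    have unexplored: "unexplored (c # us) (dep, ex)" using less.prems(4) Cons by simp
    have shorter: "length (contours (opp m) us) < length (contours (opp m) ts)"
      using Cons by (cases c) simp_all
    have "E \<union> set (contour (opp m) c) \<subseteq> ex \<union> set (contour (opp m) c)" using less.prems(3) by blast
    note rest = less.hyps[OF shorter family(2) us this]
    have "explores_exactly path (dart c # zs) (dep, ex) (c # us)"
    proof (cases c)
      case (DLeaf d q)
      then show ?thesis
        using explores_exactly_leaf[of path P ws d q us Q dep ex zs] family(1) unexplored less.prems(5) rest
        by simp
    next
      case (DNode d vs)
      have shorter': "length (contours (opp m) vs) < length (contours (opp m) ts)" using Cons DNode by simp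
      obtain P' Q' where child: "family (path @ [opp m d]) P' ([] @ vs) Q'"
        using family_childE[OF family(1), of d vs] DNode by auto
      have "arranged (opp m) {} vs (tl (support (rot m) (opp m d)))"
        using family_explored[OF family(1), of c] DNode by simp
      note descend = less.hyps[OF shorter' child this empty_subsetI]
      show ?thesis
        using explores_exactly_node[of path P ws d vs us Q dep ex zs] family(1) unexplored less.prems(5)
          rest descend DNode
        by (simp del: contour.simps)
    qed
    then show ?thesis unfolding ds(1) Cons using ds(2) by (intro explores_exactly_skip) simp_all
  qed (use explores_exactly_Nil[of ds "(dep, ex)" path] less.prems(2,3) in auto)
qed

lemma dfs_tree_eq: "dfs_tree m = erase (hd forest)"
proof -
  let ?dep = "[vertex m (root_dart m) \<mapsto> -1] :: 'd set \<rightharpoonup> int"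
  have "set (forest_nodes forest) = node_darts" by (simp add: node_darts_def)
  then have unexplored: "unexplored forest (?dep, {})"
    using node_vertex_neq_root unfolding unexplored_def node_vertices_def by auto
  have "depths_recorded [root_dart m] ?dep" by (simp add: depths_recorded_def)
  with explores_family[of "[root_dart m]" "[]" "[]" forest "[]", OF _ root_arranged order_refl unexplored]
    family_root
  obtain st where "explores [root_dart m] (support (rot m) (root_dart m)) (?dep, {}) forest st"
    unfolding explores_exactly_def by auto
  moreover have "length (forest_nodes forest) \<le> card (darts m)"
    unfolding card_node_darts[symmetric] using darts_eq finite_darts by (intro card_mono) auto
  ultimately have "explore (card (darts m)) m (int (length [root_dart m]) - 2)
      (support (rot m) (root_dart m)) (?dep, {}) = (map erase forest, st)" by (rule explore_eq_if_explores)
  then have "dfs_tree m = hd (map erase forest)" by (simp add: dfs_tree_def)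
  then show ?thesis using root_first by (auto simp: hd_map)
qed

end


section \<open>The contour of a plane tree\<close>

text \<open>\<open>r\<close> acts around the vertices of the tree in clockwise order, with each leaf as a vertex of its own.\<close>

fun tree_rotation :: "('d \<Rightarrow> 'd) \<Rightarrow> ('d \<Rightarrow> 'd) \<Rightarrow> 'd dart_tree \<Rightarrow> bool" where
  "tree_rotation op r (DLeaf d q) \<longleftrightarrow> r (op d) = op d"
| "tree_rotation op r (DNode d ts) \<longleftrightarrow> map r (op d # map dart ts) = map dart ts @ [op d] \<and>
     (\<forall>c\<in>set ts. tree_rotation op r c)"

lemma contours_eq_Cons: "contours op (c # ts) = dart c # tl (contours op (c # ts))"
  by (cases c) simp_all

lemma map_contours:
  assumes "\<And>c. c \<in> set ts \<Longrightarrow> map f (contour op c) = tl (contour op c) @ [r (dart c)]"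
    and "map r (map dart ts) = tl (map dart ts) @ [y]"
  shows "map f (contours op ts) = tl (contours op ts) @ [y]"
  using map_concat_chain[of ts f dart "\<lambda>c. tl (contour op c)" "\<lambda>c. r (dart c)" y] assms
  unfolding contour_eq_Cons[symmetric] by (simp add: comp_def)

lemma map_contour:
  assumes "\<And>d. op (op d) = d" "tree_rotation op r c"
  shows "map (r \<circ> op) (contour op c) = tl (contour op c) @ [r (dart c)]"
  using assms(2)
proof (induction c)
  case (DNode d ts)
  show ?case
  proof (cases ts)
    case Nil
    then show ?thesis using DNode assms(1) by simp
  next
    case (Cons c us)
    have "map (r \<circ> op) (contours op ts) = tl (contours op ts) @ [op d]"
    proof (rule map_contours[where r = r])
      show "map (r \<circ> op) (contour op c) = tl (contour op c) @ [r (dart c)]" if "c \<in> set ts" for c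
        using DNode.IH[OF that] DNode.prems that by (simp add: comp_def)
    qed (use DNode.prems Cons in simp)
    moreover have "r (op d) = dart c" using DNode.prems Cons by simp
    moreover obtain w where "contours op ts = dart c # w" unfolding Cons using contours_eq_Cons by blast
    ultimately show ?thesis using assms(1) by (simp add: comp_def)
  qed
qed (use assms(1) in auto)

lemma is_cycle_contours:
  assumes "\<And>d. op (op d) = d" "\<And>c. c \<in> set ts \<Longrightarrow> tree_rotation op r c" "is_cycle r (map dart ts)"
    and "distinct (contours op ts)"
  shows "is_cycle (r \<circ> op) (contours op ts)"
proof (cases ts)
  case Nil
  then show ?thesis by (simp add: is_cycle_def)
next
  case (Cons c us)
  have "map (r \<circ> op) (contours op ts) = tl (contours op ts) @ [dart c]"
    by (rule map_contours[where r = r])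
      (use map_contour[OF assms(1,2)] assms(3) Cons in \<open>auto simp: is_cycle_def\<close>)
  moreover have "contours op ts = dart c # tl (contours op ts)" unfolding Cons by (rule contours_eq_Cons)
  ultimately show ?thesis using assms(4) by (metis is_cycle_def rotate1.simps(2))
qed

lemma arranged_filter:
  assumes "arranged op E ts ds" and "set ds \<subseteq> B \<union> dart ` set ts" "\<And>c. c \<in> set ts \<Longrightarrow> dart c \<notin> B" "distinct ds"
  shows "filter (\<lambda>y. y \<notin> B) ds = map dart ts"
  using assms
proof (induction ts arbitrary: E ds)
  case Nil
  then show ?case by (auto simp: filter_empty_conv)
next
  case (Cons c ts)
  then obtain ys zs where ds: "ds = ys @ dart c # zs" "arranged op (E \<union> set (contour op c)) ts zs" by auto
  have "dart c \<notin> set ys" "dart c \<notin> set zs" "set ys \<inter> dart ` set ts = {}"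
    using Cons.prems(4) arranged_darts[OF ds(2)] unfolding ds(1) by auto
  then have "set ys \<subseteq> B" "set zs \<subseteq> B \<union> dart ` set ts" using Cons.prems(2) unfolding ds(1) by auto
  then have "filter (\<lambda>y. y \<notin> B) zs = map dart ts" "filter (\<lambda>y. y \<notin> B) ys = []"
    using Cons.IH[OF ds(2)] Cons.prems ds(1) by (auto simp: filter_empty_conv)
  then show ?case using ds(1) Cons.prems(3)[of c] by simp
qed


section \<open>Cutting back edges\<close>

context explored_map
begin

text \<open>
  In \<open>r\<close> the back edges whose upper ends lie in \<open>Z\<close> have been cut: each of these ends has become a
  vertex of its own.
\<close>

definition cut_rotation :: "'d set \<Rightarrow> ('d \<Rightarrow> 'd) \<Rightarrow> bool" where
  "cut_rotation Z r \<longleftrightarrow> r permutes darts m \<and>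
     (\<forall>e\<in>entry_darts. is_cycle r (filter (\<lambda>y. y \<notin> Z) (support (rot m) e))) \<and> (\<forall>z\<in>Z. r z = z)"

lemma cut_rotation_empty: "cut_rotation {} (rot m)"
  using rot_permutes is_cycle_support_rot by (simp add: cut_rotation_def del: filter_map)

lemma comp_transpose_opp: "(r \<circ> transpose x y) \<circ> opp m = (r \<circ> opp m) \<circ> transpose (opp m x) (opp m y)"
  using transpose_comp_involution[of "opp m" x y, OF opp_opp] by (simp add: comp_assoc)

lemma cut_rotation_insert:
  assumes r: "cut_rotation Z r" and x: "x \<in> all_back_ends" and e0: "e0 \<in> entry_darts"
    and split: "filter (\<lambda>y. y \<notin> Z) (support (rot m) e0) = us @ e # x # vs"
  shows "cut_rotation (insert x Z) (r \<circ> transpose e x)" "e \<in> darts m"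
proof -
  let ?r = "r \<circ> transpose e x"
  have cycle: "is_cycle r (us @ e # [] @ x # vs)"
    using r e0 split unfolding cut_rotation_def by (metis append_Nil)
  have e: "e \<in> set (support (rot m) e0)" "e \<notin> Z" and x0: "x \<in> set (support (rot m) e0)"
    using arg_cong[OF split, of set] by (auto simp del: set_map)
  show "e \<in> darts m" using e(1) vertex_subset_darts entry_subset_darts e0 vertex_eq_set_support by blast
  note split_cycle = is_cycle_comp_transpose_split[OF cycle]
  have "is_cycle ?r (filter (\<lambda>y. y \<notin> insert x Z) (support (rot m) e'))" if e': "e' \<in> entry_darts" for e'
  proof (cases "e' = e0")
    case True
    have "filter (\<lambda>y. y \<noteq> x) (us @ e # x # vs) = us @ e # vs"
      using filter_neq_middle[of "us @ [e]" x vs] cycle by (simp add: is_cycle_def)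
    then show ?thesis using True split_cycle(1) filter_notin_insert split by metis
  next
    case False
    then have other: "e \<notin> set (support (rot m) e')" "x \<notin> set (support (rot m) e')"
      using support_rot_disjoint e' e0 e(1) x0 by blast+
    have "filter (\<lambda>y. y \<notin> insert x Z) (support (rot m) e') = filter (\<lambda>y. y \<notin> Z) (support (rot m) e')"
      using other(2) by (intro filter_cong) auto
    moreover have "is_cycle r (filter (\<lambda>y. y \<notin> Z) (support (rot m) e'))"
      using r e' by (auto simp: cut_rotation_def)
    ultimately show ?thesis using other by (metis is_cycle_comp_transpose_other filter_is_subset subsetD)
  qed
  moreover have "?r permutes darts m"
    using permutes_comp_transpose[OF _ \<open>e \<in> darts m\<close>] r x back_ends_subset_darts
    by (auto simp: cut_rotation_def)
  moreover have "?r z = z" if "z \<in> insert x Z" for z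
    using that e(2) r split_cycle(2) by (cases "z = x") (auto simp: is_cycle_def cut_rotation_def transpose_def)
  ultimately show "cut_rotation (insert x Z) ?r" by (simp add: cut_rotation_def)
qed

lemma num_cycles_cut_le:
  assumes "cut_rotation Z r" "e \<in> darts m" "x \<in> darts m"
  shows "num_cycles (r \<circ> transpose e x \<circ> opp m) (darts m) \<le> Suc (num_cycles (r \<circ> opp m) (darts m))"
  unfolding comp_transpose_opp
  by (rule num_cycles_comp_transpose_le)
    (use assms opp_permutes permutes_compose finite_darts in \<open>auto simp: cut_rotation_def\<close>)

lemma cut_rotation_exists:
  assumes "finite Z" "Z \<subseteq> all_back_ends"
  shows "\<exists>r. cut_rotation Z r \<and>
    num_cycles (rot m \<circ> opp m) (darts m) \<le> num_cycles (r \<circ> opp m) (darts m) + card Z"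
  using assms
proof (induction Z)
  case empty
  then show ?case using cut_rotation_empty by auto
next
  case (insert x Z)
  then obtain r where r: "cut_rotation Z r"
    "num_cycles (rot m \<circ> opp m) (darts m) \<le> num_cycles (r \<circ> opp m) (darts m) + card Z" by (metis insert_subset)
  have x: "x \<in> all_back_ends" "x \<in> darts m" using insert.prems back_ends_subset_darts by auto
  then obtain e0 where e0: "e0 \<in> entry_darts" "x \<in> set (support (rot m) e0)"
    using in_vertex_of_entry vertex_eq_set_support by blast
  let ?l = "filter (\<lambda>y. y \<notin> Z) (support (rot m) e0)"
  have "e0 \<notin> Z" using insert.prems entry_not_back_end e0 by auto
  then have "hd ?l = e0" by (subst support_rot_Cons) simp
  moreover have "e0 \<noteq> x" using entry_not_back_end[OF e0(1)] x(1) by auto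
  moreover have "x \<in> set ?l" using e0 insert.hyps by (simp del: set_map)
  ultimately obtain us e vs where l: "?l = us @ e # x # vs" using in_set_predecessor[of x ?l] by auto
  note cut = cut_rotation_insert[OF r(1) x(1) e0(1) l]
  have "r \<circ> transpose e x \<circ> transpose e x = r" by (simp add: comp_assoc)
  then have "num_cycles (r \<circ> opp m) (darts m) \<le> Suc (num_cycles (r \<circ> transpose e x \<circ> opp m) (darts m))"
    using num_cycles_cut_le[OF cut(1) cut(2) x(2)] by simp
  then have "num_cycles (rot m \<circ> opp m) (darts m) \<le>
      num_cycles (r \<circ> transpose e x \<circ> opp m) (darts m) + card (insert x Z)"
    using r(2) insert.hyps by simp
  then show ?case using cut(1) by blast
qed

lemma filter_examined:
  assumes "family path P ts Q"
  shows "filter (\<lambda>y. y \<notin> all_back_ends) (examined path) = map dart ts"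
proof (rule arranged_filter[OF family_arranged[OF assms]])
  show "set (examined path) \<subseteq> all_back_ends \<union> dart ` set ts"
    using examined_cases[OF assms] family_back_ends[OF assms] by blast
qed (use family_dart_not_back_end[OF assms] distinct_examined in auto)

lemma cut_all_tree_rotation:
  assumes r: "cut_rotation all_back_ends r" and "family path P ts Q" "c \<in> set ts"
  shows "tree_rotation (opp m) r c"
  using assms(2,3)
proof (induction rule: family_induct)
  case (DLeaf path P ts Q d q)
  then have "opp m d \<in> all_back_ends" using family_leaf_darts by (fastforce simp: all_back_ends_def)
  then show ?case using r by (simp add: cut_rotation_def)
next
  case (DNode path P ts Q d us P' Q')
  have e: "opp m d \<in> entry_darts" using family_last_entry[OF DNode(3)] by simp
  have "examined (path @ [opp m d]) = tl (support (rot m) (opp m d))"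
    using family_path[OF DNode(1)] by (simp add: examined_def)
  then have "filter (\<lambda>y. y \<notin> all_back_ends) (tl (support (rot m) (opp m d))) = map dart us"
    using filter_examined[OF DNode(3)] by simp
  then have "filter (\<lambda>y. y \<notin> all_back_ends) (support (rot m) (opp m d)) = opp m d # map dart us"
    using entry_not_back_end[OF e] by (subst support_rot_Cons) simp
  then have "is_cycle r (opp m d # map dart us)" using r e by (metis cut_rotation_def)
  then show ?case using DNode(4) by (auto simp: is_cycle_Cons_iff)
qed

lemma cut_all_contour:
  assumes r: "cut_rotation all_back_ends r"
  shows "is_cycle (r \<circ> opp m) (contours (opp m) forest)"
proof -
  have "examined [root_dart m] = support (rot m) (root_dart m)" by (simp add: examined_def)
  then have "filter (\<lambda>y. y \<notin> all_back_ends) (support (rot m) (root_dart m)) = map dart forest"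
    using filter_examined[OF family_root] by simp
  then have "is_cycle r (map dart forest)" using r by (metis cut_rotation_def entry_darts_def insertI1)
  then show ?thesis
    using is_cycle_contours[OF opp_opp cut_all_tree_rotation[OF r family_root]] distinct_contour by blast
qed


subsection \<open>Chords\<close>

text \<open>
  \<open>attached a ys x\<close>: clockwise around their vertex, the tree dart \<open>a\<close> and the back end \<open>x\<close> are only
  separated by the back ends \<open>ys\<close>.
\<close>

definition attached :: "'d \<Rightarrow> 'd list \<Rightarrow> 'd \<Rightarrow> bool" where
  "attached a ys x \<longleftrightarrow> a \<notin> all_back_ends \<and> set ys \<subseteq> all_back_ends \<and> x \<in> all_back_ends \<and>
     (\<exists>e\<in>entry_darts. \<exists>us vs. support (rot m) e = us @ a # ys @ x # vs)"

lemma attached_if_examined: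
  assumes "family path P ts Q" "examined path = us @ a # ys @ x # vs"
    "a \<notin> all_back_ends" "set ys \<subseteq> all_back_ends" "x \<in> all_back_ends"
  shows "attached a ys x"
  using examined_suffix_support[OF assms(1,2)] family_last_entry[OF assms(1)] assms(3-5)
  unfolding attached_def by blast

lemma attached_not_between:
  assumes "attached a ys x"
  shows "x \<notin> set ys"
proof -
  obtain e us vs where "support (rot m) e = us @ a # ys @ x # vs" using assms unfolding attached_def by blast
  then have "distinct (us @ a # ys @ x # vs)" using distinct_support_rot by metis
  then show ?thesis by simp
qed

lemma cut_rotation_attached:
  assumes "cut_rotation Z r" "Z \<subseteq> all_back_ends" "attached a ys x" "x \<notin> Z" "set ys \<subseteq> Z"
  shows "cut_rotation (insert x Z) (r \<circ> transpose a x)" "a \<in> darts m"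
proof -
  obtain e us vs where e: "e \<in> entry_darts" "support (rot m) e = us @ a # ys @ x # vs"
    and a: "a \<notin> Z" and x: "x \<in> all_back_ends" using assms(2,3) unfolding attached_def by blast
  have "filter (\<lambda>y. y \<notin> Z) ys = []" using assms(5) by (auto simp: filter_empty_conv)
  then have "filter (\<lambda>y. y \<notin> Z) (support (rot m) e) =
      filter (\<lambda>y. y \<notin> Z) us @ a # x # filter (\<lambda>y. y \<notin> Z) vs"
    unfolding e(2) using a assms(4) by simp
  from cut_rotation_insert[OF assms(1) x e(1) this]
  show "cut_rotation (insert x Z) (r \<circ> transpose a x)" "a \<in> darts m" by blast+
qed

text \<open>
  In a planar map cutting a back edge always merges two faces. Cutting all of them but two leaves
  two chords on the contour of the tree, and these cannot cross.
\<close>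

lemma chords_noncrossing:
  assumes "planar_map m" and chord1: "attached a1 ys1 x1" and chord2: "attached a2 ys2 x2"
    and x: "x1 \<noteq> x2" "x1 \<notin> set ys2"
    and contour: "contours (opp m) forest = us @ opp m x1 # vs @ opp m a1 # ws"
  shows "opp m x2 \<in> set (vs @ [opp m a1]) \<longleftrightarrow> opp m a2 \<in> set (vs @ [opp m a1])"
proof -
  define Z where "Z = all_back_ends - {x1, x2}"
  have B: "x1 \<in> all_back_ends" "x2 \<in> all_back_ends" using chord1 chord2 by (auto simp: attached_def)
  have fin: "finite all_back_ends" using back_ends_subset_darts finite_darts finite_subset by blast
  have "card {x1, x2} \<le> card all_back_ends" using B fin by (intro card_mono) auto
  then have card: "card leaf_darts = card Z + 2"
    using B x(1) fin card_opp_image[of leaf_darts] unfolding Z_def all_back_ends_def[symmetric]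
    by (subst card_Diff_subset) auto
  obtain r2 where r2: "cut_rotation Z r2"
    "num_cycles (rot m \<circ> opp m) (darts m) \<le> num_cycles (r2 \<circ> opp m) (darts m) + card Z"
    using cut_rotation_exists[of Z] fin by (auto simp: Z_def)
  define r1 where "r1 = r2 \<circ> transpose a2 x2"
  define r0 where "r0 = r1 \<circ> transpose a1 x1"
  have "set ys2 \<subseteq> Z" using chord2 attached_not_between[OF chord2] x(2) by (auto simp: Z_def attached_def)
  then have r1: "cut_rotation (insert x2 Z) r1" and a2: "a2 \<in> darts m"
    using cut_rotation_attached[OF r2(1) _ chord2] unfolding r1_def by (auto simp: Z_def)
  have "set ys1 \<subseteq> insert x2 Z" using chord1 attached_not_between[OF chord1] by (auto simp: Z_def attached_def)
  then have "cut_rotation (insert x1 (insert x2 Z)) r0" and a1: "a1 \<in> darts m"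
    using cut_rotation_attached[OF r1 _ chord1] B x(1) unfolding r0_def by (auto simp: Z_def)
  moreover have "insert x1 (insert x2 Z) = all_back_ends" using B by (auto simp: Z_def)
  ultimately have r0: "cut_rotation all_back_ends r0" by simp
  have "r2 = r0 \<circ> transpose a1 x1 \<circ> transpose a2 x2" by (simp add: r0_def r1_def comp_assoc)
  then have "r2 \<circ> opp m = r0 \<circ> opp m \<circ> transpose (opp m x1) (opp m a1) \<circ> transpose (opp m x2) (opp m a2)"
    using comp_transpose_opp transpose_commute by metis
  moreover have "num_cycles (r2 \<circ> opp m) (darts m) \<ge> 3" using r2(2) card \<open>planar_map m\<close> planar_map_iff by simp
  moreover have "(r0 \<circ> opp m) permutes darts m"
    using r0 opp_permutes permutes_compose by (auto simp: cut_rotation_def)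
  ultimately show ?thesis
    using transpositions_noncrossing[of "r0 \<circ> opp m" "darts m" us "opp m x1" vs "opp m a1" ws
        "opp m x2" "opp m a2"]
      cut_all_contour[OF r0] set_contour finite_darts B(2) back_ends_subset_darts a2 unfolding contour by auto
qed

end


section \<open>Separability\<close>

definition bichromatic :: "('d \<Rightarrow> bool) \<Rightarrow> 'd set \<Rightarrow> bool" where
  "bichromatic col v \<longleftrightarrow> (\<exists>d\<in>v. col d) \<and> (\<exists>d\<in>v. \<not> col d)"

definition cut_colouring :: "'d cmap \<Rightarrow> ('d \<Rightarrow> bool) \<Rightarrow> bool" where
  "cut_colouring m col \<longleftrightarrow> (\<forall>d\<in>darts m. col (opp m d) \<longleftrightarrow> col d) \<and> bichromatic col (darts m) \<and>
     (\<exists>!v. v \<in> vertices m \<and> bichromatic col v)"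

context combinatorial_map
begin

lemma incident_iff:
  assumes "E \<subseteq> edges m"
  shows "incident v E \<longleftrightarrow> (\<exists>d\<in>v. {d, opp m d} \<in> E)"
proof
  assume "incident v E"
  then obtain e d where "e \<in> E" "d \<in> v" "d \<in> e" unfolding incident_def by blast
  moreover from this have "e = {d, opp m d}" using assms by (auto simp: edges_def)
  ultimately show "\<exists>d\<in>v. {d, opp m d} \<in> E" by blast
next
  assume "\<exists>d\<in>v. {d, opp m d} \<in> E"
  then obtain d where "{d, opp m d} \<in> E" "d \<in> v \<inter> {d, opp m d}" by blast
  then show "incident v E" unfolding incident_def by blast
qed

lemma edge_partition_nonempty_iff:
  assumes "E1 \<inter> E2 = {}" "E1 \<union> E2 = edges m"
  shows "E1 \<noteq> {} \<and> E2 \<noteq> {} \<longleftrightarrow> bichromatic (\<lambda>d. {d, opp m d} \<in> E1) (darts m)"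
proof -
  have "E \<noteq> {} \<longleftrightarrow> (\<exists>d\<in>darts m. {d, opp m d} \<in> E)" if "E \<subseteq> edges m" for E
    using that by (auto simp: edges_def)
  moreover have "{d, opp m d} \<in> E2 \<longleftrightarrow> {d, opp m d} \<notin> E1" if "d \<in> darts m" for d
    using assms that by (auto simp: edges_def)
  ultimately show ?thesis using assms(2) unfolding bichromatic_def by (metis sup_ge1 sup_ge2)
qed

lemma edge_partition_incident_iff:
  assumes "E1 \<inter> E2 = {}" "E1 \<union> E2 = edges m" "v \<in> vertices m"
  shows "incident v E1 \<and> incident v E2 \<longleftrightarrow> bichromatic (\<lambda>d. {d, opp m d} \<in> E1) v"
proof -
  have "{d, opp m d} \<in> E2 \<longleftrightarrow> {d, opp m d} \<notin> E1" if "d \<in> v" for d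
  proof -
    have "d \<in> darts m" using vertices_subset_Pow assms(3) that by blast
    then show ?thesis using assms(1,2) by (auto simp: edges_def)
  qed
  then show ?thesis
    using incident_iff[of E1 v] incident_iff[of E2 v] assms(2) unfolding bichromatic_def by blast
qed

lemma separable_iff_cut_colouring: "separable m \<longleftrightarrow> (\<exists>col. cut_colouring m col)"
proof
  assume "separable m"
  then obtain E1 E2 where nonempty: "E1 \<noteq> {}" "E2 \<noteq> {}" and E: "E1 \<inter> E2 = {}" "E1 \<union> E2 = edges m"
    and cut: "\<exists>!v. v \<in> vertices m \<and> incident v E1 \<and> incident v E2"
    unfolding separable_def by (elim exE conjE)
  have "v \<in> vertices m \<and> incident v E1 \<and> incident v E2 \<longleftrightarrow>
      v \<in> vertices m \<and> bichromatic (\<lambda>d. {d, opp m d} \<in> E1) v" for v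
    using edge_partition_incident_iff[OF E] by blast
  with cut have "\<exists>!v. v \<in> vertices m \<and> bichromatic (\<lambda>d. {d, opp m d} \<in> E1) v" by (simp only:)
  then have "cut_colouring m (\<lambda>d. {d, opp m d} \<in> E1)"
    using nonempty edge_partition_nonempty_iff[OF E] by (simp add: cut_colouring_def insert_commute)
  then show "\<exists>col. cut_colouring m col" by blast
next
  assume "\<exists>col. cut_colouring m col"
  then obtain col where opp: "\<forall>d\<in>darts m. col (opp m d) \<longleftrightarrow> col d" and both: "bichromatic col (darts m)"
    and cut: "\<exists>!v. v \<in> vertices m \<and> bichromatic col v" unfolding cut_colouring_def by (elim exE conjE)
  define E1 where "E1 = {e \<in> edges m. \<forall>d\<in>e. col d}"
  define E2 where "E2 = edges m - E1"
  have E: "E1 \<inter> E2 = {}" "E1 \<union> E2 = edges m" by (auto simp: E1_def E2_def)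
  have col: "{d, opp m d} \<in> E1 \<longleftrightarrow> col d" if "d \<in> darts m" for d
    using that opp by (auto simp: E1_def edges_def)
  have colour_eq: "bichromatic (\<lambda>d. {d, opp m d} \<in> E1) v \<longleftrightarrow> bichromatic col v" if "v \<subseteq> darts m" for v
    using col that unfolding bichromatic_def by blast
  have "v \<in> vertices m \<and> incident v E1 \<and> incident v E2 \<longleftrightarrow> v \<in> vertices m \<and> bichromatic col v" for v
    using edge_partition_incident_iff[OF E] colour_eq[of v] vertices_subset_Pow by blast
  with cut have "\<exists>!v. v \<in> vertices m \<and> incident v E1 \<and> incident v E2" by (simp only:)
  moreover have "E1 \<noteq> {}" "E2 \<noteq> {}" using edge_partition_nonempty_iff[OF E] colour_eq both by blast+
  ultimately show "separable m" using E unfolding separable_def by (intro exI conjI)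
qed

end

context explored_map
begin

lemma node_vertex_subset_contour:
  assumes family: "family path P ts Q" and c: "c \<in> set ts" "d \<in> set (node_list c)"
  shows "vertex m (opp m d) \<subseteq> set (contour (opp m) c)"
proof -
  from family_node[OF family c] obtain path' P' us Q'
    where inner: "family (path @ path' @ [opp m d]) P' us Q'" and d: "DNode d us \<in> descendants c" by blast
  have "vertex m (opp m d) \<subseteq> set (contour (opp m) (DNode d us))"
    using family_vertex[OF inner] examined_subset_contours[OF inner] by auto
  then show ?thesis using descendants_contour[OF d] by blast
qed

lemma inner_vertex_subset_contour:
  assumes "family path P ts Q" "c \<in> set ts" "d \<in> set (node_list c)" "y \<in> vertex m (opp m d)"
  shows "vertex m y \<subseteq> set (contour (opp m) c)"
  using node_vertex_subset_contour[OF assms(1-3)] vertex_eqI[OF assms(4)] by simp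

lemma descendant_vertex_subset_contour:
  assumes family: "family path P ts Q" and c: "c \<in> set ts" and s: "s \<in> descendants c" "s \<noteq> c"
  shows "vertex m (dart s) \<subseteq> set (contour (opp m) c)"
proof -
  obtain d us where d: "DNode d us \<in> descendants c" "s \<in> set us" using descendants_parent[OF s(1)] s(2) by blast
  from family_descendant[OF family c d(1)] obtain path' P' ts' Q'
    where "family (path @ path') P' ts' Q'" "DNode d us \<in> set ts'" by blast
  from family_childE[OF this] obtain P'' Q'' where "family ((path @ path') @ [opp m d]) P'' us Q''" .
  then have "dart s \<in> vertex m (opp m d)" using dart_in_vertex d(2) by fastforce
  moreover have "d \<in> set (node_list c)" using d(1) set_node_list by metis
  ultimately show ?thesis using inner_vertex_subset_contour[OF family c] by blast
qed

lemma back_end_vertex_subset_contour: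
  assumes family: "family path P ts Q" and c: "c \<in> set ts"
    and d: "(d, q) \<in> set (leaf_list c)" "int (length path) - 1 \<le> q"
  shows "vertex m (opp m d) \<subseteq> set (contour (opp m) c)"
proof -
  have "DLeaf d q \<in> descendants c" using d(1) set_leaf_list by metis
  from family_descendant[OF family c this] obtain path' P' ts' Q' where
    inner: "family (path @ path') P' ts' Q'" "DLeaf d q \<in> set ts'" "set path' \<subseteq> opp m ` set (node_list c)"
      by blast
  then obtain i where i: "i < length (path @ path')" "q = int i - 1" "opp m d \<in> vertex m ((path @ path') ! i)"
    using family_explored[OF inner(1,2)] by auto
  then have "(path @ path') ! i \<in> set path'" using d(2) by (auto simp: nth_append)
  then obtain e where "e \<in> set (node_list c)" "(path @ path') ! i = opp m e" using inner(3) by blast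
  then show ?thesis using inner_vertex_subset_contour[OF family c] i(3) by metis
qed

lemma contour_vertex_cases:
  assumes family: "family path P ts Q" and c: "c \<in> set ts" and y: "y \<in> set (contour (opp m) c)"
  obtains (child) "y = dart c" | (inside) "vertex m y \<subseteq> set (contour (opp m) c)"
    | (back_end) d q where "y = opp m d" "(d, q) \<in> set (leaf_list c)" "q < int (length path) - 1"
proof -
  have "y \<in> dart ` descendants c \<union> opp m ` (fst ` set (leaf_list c) \<union> set (node_list c))"
    using y set_contour_eq[of "opp m" c] upper_darts_eq[of c] by simp
  then consider (upper) s where "s \<in> descendants c" "y = dart s"
    | (node) d where "d \<in> set (node_list c)" "y = opp m d"
    | (leaf) d q where "(d, q) \<in> set (leaf_list c)" "y = opp m d" by fastforce
  then show ?thesis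
  proof cases
    case upper
    then show ?thesis using descendant_vertex_subset_contour[OF family c] child inside by metis
  next
    case node
    then show ?thesis using inside inner_vertex_subset_contour[OF family c] self_in_vertex by blast
  next
    case (leaf d q)
    then show ?thesis using back_end_vertex_subset_contour[OF family c] back_end inside linorder_not_le by metis
  qed
qed

lemma contour_avoids_vertex:
  assumes family: "family path P (us @ c # vs) Q" and other: "length path > 1 \<or> us \<noteq> [] \<or> vs \<noteq> []"
  shows "\<exists>y\<in>vertex m (last path). y \<notin> set (contour (opp m) c)"
proof -
  have distinct: "distinct (P @ contours (opp m) us @ contour (opp m) c @ contours (opp m) vs @ Q)"
    using family_distinct[OF family] by simp
  show ?thesis
  proof (cases "length path > 1")
    case True
    then have "last path \<in> set (tl path)" by (cases path) auto
    then have "last path \<in> set Q" using family_path_distinct[OF family] by auto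
    then have "last path \<notin> set (contour (opp m) c)" using distinct by auto
    then show ?thesis using self_in_vertex by blast
  next
    case False
    then obtain c' where c': "c' \<in> set (us @ vs)" using other by (cases us; cases vs) auto
    then have "dart c' \<in> set (contours (opp m) us) \<union> set (contours (opp m) vs)"
      using dart_in_contour(1)[of c' "opp m"] by auto
    then have "dart c' \<notin> set (contour (opp m) c)" using distinct by (auto simp del: set_concat)
    moreover have "dart c' \<in> vertex m (last path)" using dart_in_vertex[OF family, of c'] c' by auto
    ultimately show ?thesis by blast
  qed
qed

lemma vertex_meeting_contour:
  assumes family: "family path P ts Q" and c: "c \<in> set ts"
    and high: "\<And>d q. (d, q) \<in> set (leaf_list c) \<Longrightarrow> int (length path) - 2 \<le> q"
    and y: "y \<in> set (contour (opp m) c)" "\<not> vertex m y \<subseteq> set (contour (opp m) c)"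
  shows "vertex m y = vertex m (last path)"
  using family c y(1)
proof (cases rule: contour_vertex_cases)
  case child
  then show ?thesis using dart_in_vertex[OF family c] vertex_eqI by simp
next
  case (back_end d q)
  have "nat (q + 1) = length path - 1" using high[OF back_end(2)] back_end(3) by simp
  then have "y \<in> vertex m (last path)"
    using leaf_label(2)[OF family c back_end(2,3)] back_end(1) family_path[OF family]
    by (simp add: last_conv_nth)
  then show ?thesis by (rule vertex_eqI)
qed (use y(2) in blast)

lemma separable_if_no_low_leaf:
  assumes family: "family path P (us @ c # vs) Q"
    and high: "\<And>d q. (d, q) \<in> set (leaf_list c) \<Longrightarrow> int (length path) - 2 \<le> q"
    and other: "length path > 1 \<or> us \<noteq> [] \<or> vs \<noteq> []"
  shows "separable m"
proof -
  let ?S = "set (contour (opp m) c)" and ?v = "vertex m (last path)"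
  have c: "c \<in> set (us @ c # vs)" by simp
  have inside: "dart c \<in> ?v" "dart c \<in> ?S" using dart_in_vertex[OF family c] dart_in_contour(1) by blast+
  obtain y where y: "y \<in> ?v" "y \<notin> ?S" using contour_avoids_vertex[OF family other] by blast
  have v: "?v \<subseteq> darts m" "?v \<in> vertices m"
    using vertex_subset_darts vertex_in_vertices family_last_entry[OF family] entry_subset_darts by blast+
  have "x = ?v" if x: "x \<in> vertices m" "bichromatic (\<lambda>d. d \<in> ?S) x" for x
  proof -
    obtain z where z: "z \<in> x" "z \<in> ?S" "\<not> x \<subseteq> ?S" using x(2) unfolding bichromatic_def by blast
    then show ?thesis
      using vertex_meeting_contour[OF family c high z(2)] vertices_eq_vertex[OF x(1) z(1)] by simp
  qed
  moreover have "bichromatic (\<lambda>d. d \<in> ?S) ?v" using inside y unfolding bichromatic_def by blast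
  moreover have "bichromatic (\<lambda>d. d \<in> ?S) (darts m)" using inside y v(1) unfolding bichromatic_def by blast
  ultimately have "cut_colouring m (\<lambda>d. d \<in> ?S)"
    using contour_closed[OF opp_opp] v(2) unfolding cut_colouring_def by blast
  then show ?thesis using separable_iff_cut_colouring by blast
qed

text \<open>The depth of the vertex entered through the last dart of a path is the length of the path minus two.\<close>

definition low_leaves :: bool where
  "low_leaves \<longleftrightarrow> (\<forall>path P ts Q c. family path P ts Q \<and> length path > 1 \<and> c \<in> set ts \<longrightarrow>
     (\<exists>d q. (d, q) \<in> set (leaf_list c) \<and> q < int (length path) - 2))"

lemma low_leavesE:
  assumes low_leaves "family path P ts Q" "length path > 1" "c \<in> set ts"
  obtains d q where "(d, q) \<in> set (leaf_list c)" "q < int (length path) - 2"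
  using assms unfolding low_leaves_def by blast

lemma low_leaves_if_not_separable:
  assumes "\<not> separable m"
  shows low_leaves
  unfolding low_leaves_def
proof (intro allI impI, elim conjE)
  fix path P ts Q c assume family: "family path P ts Q" "length path > 1" "c \<in> set ts"
  then obtain us vs where "family path P (us @ c # vs) Q" by (metis split_list)
  then show "\<exists>d q. (d, q) \<in> set (leaf_list c) \<and> q < int (length path) - 2"
    using separable_if_no_low_leaf family(2) assms linorder_not_le by metis
qed

lemma forest_single_if_not_separable:
  assumes "\<not> separable m"
  obtains \<tau> where "forest = [\<tau>]" "dart \<tau> = root_dart m"
proof -
  obtain \<tau> ts where \<tau>: "forest = \<tau> # ts" "dart \<tau> = root_dart m" using root_first by blast
  have family: "family [root_dart m] [] ([] @ \<tau> # ts) []" using family_root \<tau>(1) by simp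
  have "ts = []"
  proof (rule ccontr)
    assume "ts \<noteq> []"
    then have "separable m" using separable_if_no_low_leaf[OF family] leaf_label(1)[OF family, of \<tau>] by simp
    then show False using assms by blast
  qed
  then show ?thesis using that \<tau> by blast
qed


subsection \<open>Low leaves prevent separability\<close>

lemma contour_monochromatic:
  assumes opp: "\<And>d. col (opp m d) \<longleftrightarrow> col d" and "family path P ts Q" "c \<in> set ts"
  shows "(\<forall>d\<in>set (node_list c). \<not> bichromatic col (vertex m (opp m d))) \<longrightarrow>
    (\<forall>y\<in>set (contour (opp m) c). col y \<longleftrightarrow> col (dart c))"
  using assms(2,3)
proof (induction rule: family_induct)
  case (DLeaf path P ts Q d q)
  then show ?case using opp by auto
next
  case (DNode path P ts Q d us P' Q')
  have "col y \<longleftrightarrow> col d"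
    if mono: "\<forall>e\<in>set (node_list (DNode d us)). \<not> bichromatic col (vertex m (opp m e))"
      and c: "c \<in> set us" "y \<in> set (contour (opp m) c)" for c y
  proof -
    have "col y \<longleftrightarrow> col (dart c)" using DNode(4)[OF c(1)] mono c by auto
    also have "\<dots> \<longleftrightarrow> col (opp m d)"
      using mono dart_in_vertex[OF DNode(3) c(1)] self_in_vertex[of "opp m d"] by (auto simp: bichromatic_def)
    finally show ?thesis using opp by simp
  qed
  then show ?case using opp by auto
qed

lemma cut_colouring_entry_unique:
  assumes "cut_colouring m col" "e \<in> entry_darts" "e' \<in> entry_darts"
    and "bichromatic col (vertex m e)" "bichromatic col (vertex m e')"
  shows "e = e'"
  using assms inj_onD[OF inj_on_vertex_entry] vertex_in_vertices entry_subset_darts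
  unfolding cut_colouring_def by (metis subsetD)

lemma contour_colour:
  assumes col: "cut_colouring m col" and opp: "\<And>d. col (opp m d) \<longleftrightarrow> col d"
    and family: "family path P ts Q" and c: "c \<in> set ts" and last: "bichromatic col (vertex m (last path))"
    and y: "y \<in> set (contour (opp m) c)"
  shows "col y \<longleftrightarrow> col (dart c)"
proof -
  have "\<not> bichromatic col (vertex m (opp m d))" if d: "d \<in> set (node_list c)" for d
  proof
    assume bichromatic: "bichromatic col (vertex m (opp m d))"
    from family_node[OF family c d] obtain path' P' us Q'
      where inner: "family (path @ path' @ [opp m d]) P' us Q'" by blast
    then have "opp m d = last path"
      using cut_colouring_entry_unique[OF col _ family_last_entry[OF family] bichromatic last]
        family_last_entry[OF inner] by simp
    then show False using family_path_distinct[OF inner] family_path[OF family] by auto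
  qed
  then show ?thesis using contour_monochromatic[of col, OF opp family c] y by blast
qed

lemma child_colour:
  assumes col: "cut_colouring m col" and opp: "\<And>d. col (opp m d) \<longleftrightarrow> col d"
    and single: "forest = [\<tau>]" and low: low_leaves
    and family: "family path P ts Q" and c: "c \<in> set ts"
      and path: "\<And>e. e \<in> set path \<Longrightarrow> col e \<longleftrightarrow> col (root_dart m)"
  shows "col (dart c) \<longleftrightarrow> col (root_dart m)"
proof (rule ccontr)
  assume neq: "\<not> ?thesis"
  have "last path \<in> set path" using family_path[OF family] by simp
  then have last: "bichromatic col (vertex m (last path))"
    using dart_in_vertex[OF family c] self_in_vertex[of "last path"] path neq unfolding bichromatic_def by blast
  have len: "length path > 1"
  proof (rule ccontr)
    assume "\<not> length path > 1"
    with family have "ts = forest" by cases (use family_path in fastforce)+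
    then show False using neq c root_first single by auto
  qed
  obtain d q
    where d: "(d, q) \<in> set (leaf_list c)" "q < int (length path) - 2" using low_leavesE[OF low family len c] .
  define i where "i = nat (q + 1)"
  have i: "i < length path" "i \<noteq> length path - 1" "opp m d \<in> vertex m (path ! i)"
    using leaf_label(1,2)[OF family c d(1)] d(2) by (auto simp: i_def)
  have "opp m d \<in> set (contour (opp m) c)" using d(1) by (force simp: set_contour_eq)
  then have "bichromatic col (vertex m (path ! i))"
    using contour_colour[OF col opp family c last] path[of "path ! i"] i(1,3) neq self_in_vertex[of "path ! i"]
    unfolding bichromatic_def by auto
  moreover have "path ! i \<in> entry_darts" using family_path_entry[OF family] i(1) by (meson nth_mem subsetD)
  ultimately have "path ! i = last path"
    using cut_colouring_entry_unique[OF col _ family_last_entry[OF family] _ last] by blast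
  then show False
    using i(1,2) family_path_distinct[OF family] family_path[OF family]
    by (metis diff_less last_conv_nth length_greater_0_conv less_numeral_extra(1) nth_eq_iff_index_eq)
qed

lemma not_separable_if_low_leaves:
  assumes single: "forest = [\<tau>]" and low: low_leaves
  shows "\<not> separable m"
proof
  assume "separable m"
  then obtain col where col: "cut_colouring m col" using separable_iff_cut_colouring by blast
  have "opp m d = d" if "d \<notin> darts m" for d using that opp_permutes by (simp add: permutes_not_in)
  then have opp: "col (opp m d) \<longleftrightarrow> col d" for d using col unfolding cut_colouring_def by metis
  have path: "family path P ts Q \<Longrightarrow> e \<in> set path \<Longrightarrow> col e \<longleftrightarrow> col (root_dart m)" for path P ts Q e
  proof (induction arbitrary: e rule: family.induct)
    case (family_child path P us d ts vs Q)
    have "col d \<longleftrightarrow> col (root_dart m)"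
      using child_colour[OF col opp single low family_child.hyps, of "DNode d ts"] family_child.IH by simp
    then show ?case using family_child opp by auto
  qed simp
  have "col y \<longleftrightarrow> col (root_dart m)" if y: "y \<in> darts m" for y
  proof -
    obtain c where c: "c \<in> set forest" "y \<in> set (contour (opp m) c)" using y set_contour by auto
    then obtain s where s: "s \<in> descendants c" "y = dart s \<or> y = opp m (dart s)"
      unfolding set_contour_eq upper_darts_eq by blast
    from family_descendant[OF family_root c(1) s(1)] obtain path P ts Q where
      family: "family path P ts Q" "s \<in> set ts" by blast
    have "col (dart s) \<longleftrightarrow> col (root_dart m)"
      using child_colour[OF col opp single low family] path[OF family(1)] by blast
    then show ?thesis using s(2) opp by auto
  qed
  then have "\<not> bichromatic col (darts m)" unfolding bichromatic_def by blast
  then show False using col unfolding cut_colouring_def by (elim conjE notE)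
qed

end


section \<open>Back edges of a planar map\<close>

lemma in_set_contours_take:
  assumes "x \<in> set (contours op (take (Suc i) ts))"
  obtains j where "j \<le> i" "j < length ts" "x \<in> set (contour op (ts ! j))"
proof -
  obtain c where c: "c \<in> set (take (Suc i) ts)" "x \<in> set (contour op c)" using assms by auto
  then obtain j where "j < length (take (Suc i) ts)" "c = take (Suc i) ts ! j" by (metis in_set_conv_nth)
  then show ?thesis using that[of j] c(2) by simp
qed

context explored_map
begin

lemma contours_nth_unique:
  assumes "family path P ts Q" "i < length ts" "j < length ts"
    "x \<in> set (contour (opp m) (ts ! i))" "x \<in> set (contour (opp m) (ts ! j))"
  shows "i = j"
  by (rule distinct_concat_nth_unique[of "map (contour (opp m)) ts"])
    (use family_distinct[OF assms(1)] assms in auto)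

text \<open>The darts examined after each child, up to the next one.\<close>

definition blocks :: "'d list \<Rightarrow> 'd dart_tree list \<Rightarrow> 'd list list \<Rightarrow> bool" where
  "blocks path ts yss \<longleftrightarrow> length yss = length ts \<and>
     examined path = concat (map2 (\<lambda>c ys. dart c # ys) ts yss) \<and>
     (\<forall>i<length ts. set (yss ! i) \<subseteq> all_back_ends \<inter> set (contours (opp m) (take (Suc i) ts)))"

lemma blocks_exist:
  assumes family: "family path P ts Q"
  obtains yss where "blocks path ts yss"
proof -
  obtain yss where yss: "length yss = length ts" "examined path = concat (map2 (\<lambda>c ys. dart c # ys) ts yss)"
    "\<forall>i<length ts. set (yss ! i) \<subseteq> set (contours (opp m) (take (Suc i) ts))"
    using arranged_blocks[OF family_arranged[OF family]] by auto
  have "filter (\<lambda>y. y \<notin> all_back_ends) (concat (map2 (\<lambda>c ys. dart c # ys) ts yss)) =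
      concat (map2 (\<lambda>c ys. dart c # ys) ts (map (filter (\<lambda>y. y \<notin> all_back_ends)) yss))"
    using yss(1) family_dart_not_back_end[OF family] by (induction yss ts rule: list_induct2) auto
  then have "\<forall>ys\<in>set (map (filter (\<lambda>y. y \<notin> all_back_ends)) yss). ys = []"
    using filter_examined[OF family] yss(1,2) by (intro concat_map2_Cons_eq_map[of _ ts dart]) simp_all
  then have "set (yss ! i) \<subseteq> all_back_ends" if "i < length ts" for i
    using that yss(1) by (auto simp: filter_empty_conv)
  then show ?thesis using that yss unfolding blocks_def by blast
qed

lemma block_examined:
  assumes "blocks path ts yss" "i < length ts"
  obtains us vs where "examined path = us @ dart (ts ! i) # yss ! i @ vs"
  using concat_map2_nth[OF assms(2), of yss "\<lambda>c ys. dart c # ys"] assms(1) unfolding blocks_def by auto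

lemma block_attached:
  assumes family: "family path P ts Q" and b: "blocks path ts yss"
    and i: "i < length ts" and ys: "yss ! i = us @ x # vs"
  shows "attached (dart (ts ! i)) us x"
proof -
  obtain ws zs where "examined path = ws @ dart (ts ! i) # yss ! i @ zs" using block_examined[OF b i] .
  then have "examined path = ws @ dart (ts ! i) # us @ x # (vs @ zs)" using ys by simp
  moreover have "set (yss ! i) \<subseteq> all_back_ends" using b i unfolding blocks_def by blast
  then have "set us \<subseteq> all_back_ends" "x \<in> all_back_ends" using ys by auto
  ultimately show ?thesis
    using attached_if_examined[OF family] family_dart_not_back_end[OF family, of "ts ! i"] i by simp
qed

lemma block_distinct:
  assumes "blocks path ts yss" "i < length ts"
  shows "distinct (yss ! i)"
proof -
  obtain us vs where "examined path = us @ dart (ts ! i) # yss ! i @ vs" using block_examined[OF assms] .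
  then have "distinct (us @ dart (ts ! i) # yss ! i @ vs)" using distinct_examined by metis
  then show ?thesis by simp
qed

lemma block_leaf:
  assumes family: "family path P ts Q" and b: "blocks path ts yss" and i: "i < length ts"
    and x: "x \<in> set (yss ! i)"
  obtains j d where "j \<le> i" "x = opp m d" "(d, int (length path) - 2) \<in> set (leaf_list (ts ! j))"
proof -
  have "x \<in> set (contours (opp m) (take (Suc i) ts))" using b i x unfolding blocks_def by blast
  then obtain j where j: "j \<le> i" "x \<in> set (contour (opp m) (ts ! j))" "ts ! j \<in> set ts"
    using in_set_contours_take by (metis nth_mem)
  have "x \<in> all_back_ends" using b i x unfolding blocks_def by blast
  then have "x \<noteq> dart (ts ! j)" using family_dart_not_back_end[OF family j(3)] by blast
  moreover obtain us vs where "examined path = us @ dart (ts ! i) # yss ! i @ vs" using block_examined[OF b i] .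
  then have examined: "x \<in> set (examined path)" using x by simp
  ultimately have "x \<in> back_ends (opp m) (ts ! j)" using examined_back_end[OF family j(3,2)] by blast
  then obtain d q where d: "x = opp m d" "(d, q) \<in> set (leaf_list (ts ! j))" unfolding back_ends_def by force
  then have "q = int (length path) - 2" using back_end_examined_iff[OF family j(3) d(2)] examined by simp
  then show ?thesis using that j(1) d by blast
qed

lemma leaf_block:
  assumes family: "family path P ts Q" and b: "blocks path ts yss" and i: "i < length ts"
    and d: "(d, int (length path) - 2) \<in> set (leaf_list (ts ! i))"
  obtains k where "i \<le> k" "k < length ts" "opp m d \<in> set (yss ! k)"
proof -
  have c: "ts ! i \<in> set ts" using i by simp
  have "opp m d \<in> set (examined path)" using back_end_examined_iff[OF family c d] by simp
  moreover have "opp m d \<in> all_back_ends"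
    using family_leaf_darts[OF family c d] by (simp add: all_back_ends_def)
  then have "opp m d \<notin> dart ` set ts" using family_dart_not_back_end[OF family] by (metis imageE)
  ultimately obtain k where k: "k < length ts" "opp m d \<in> set (yss ! k)"
    using b unfolding blocks_def by (fastforce simp: set_zip)
  then have "opp m d \<in> set (contours (opp m) (take (Suc k) ts))" using b unfolding blocks_def by blast
  then obtain j where j: "j \<le> k" "opp m d \<in> set (contour (opp m) (ts ! j))" using in_set_contours_take by metis
  have "opp m d \<in> set (contour (opp m) (ts ! i))" using d by (force simp: set_contour_eq)
  then have "j = i" using contours_nth_unique[OF family _ i j(2)] j(1) k(1) by simp
  then show ?thesis using that j(1) k by blast
qed

lemma leaf_attached:
  assumes family: "family path P ts Q" and i: "i < length ts"
    and d: "(d, int (length path) - 2) \<in> set (leaf_list (ts ! i))"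
  obtains k ys where "i \<le> k" "k < length ts" "attached (dart (ts ! k)) ys (opp m d)"
proof -
  obtain yss where b: "blocks path ts yss" using blocks_exist[OF family] .
  from leaf_block[OF family b i d] obtain k where k: "i \<le> k" "k < length ts" "opp m d \<in> set (yss ! k)" .
  then obtain us vs where "yss ! k = us @ opp m d # vs" by (meson split_list)
  from block_attached[OF family b k(2) this] show ?thesis using that k by blast
qed

lemma low_leaf_attached:
  assumes "family path P ts Q" "c \<in> set ts" "(d, q) \<in> set (leaf_list c)" "q < int (length path) - 2"
  shows "\<exists>a ys. attached a ys (opp m d) \<and> opp m a \<in> set Q"
  using assms
proof (induction arbitrary: c rule: family.induct)
  case family_root
  then show ?case using leaf_label(1)[OF family.family_root family_root(1,2)] by simp
next
  case (family_child path P us e ts vs Q)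
  let ?ts = "us @ DNode e ts # vs"
  have leaf: "(d, q) \<in> set (leaf_list (?ts ! length us))" using family_child.prems by auto
  show ?case
  proof (cases "q < int (length path) - 2")
    case True
    then show ?thesis using family_child.IH[of "DNode e ts"] leaf by auto
  next
    case False
    then have "q = int (length path) - 2" using family_child.prems by simp
    then obtain k ys where k: "length us \<le> k" "k < length ?ts" "attached (dart (?ts ! k)) ys (opp m d)"
      using leaf_attached[OF family_child.hyps, of "length us" d] leaf by auto
    then have "?ts ! k \<in> set (DNode e ts # vs)"
      using nth_mem[of "k - length us" "DNode e ts # vs"] by (simp add: nth_append)
    then have "opp m (dart (?ts ! k)) \<in> set (opp m e # contours (opp m) vs @ Q)"
      using dart_in_contour(2)[of "opp m" "?ts ! k"] by auto
    then show ?thesis using k(3) by blast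
  qed
qed

lemma attached_unique:
  assumes "attached a ys x" "attached a' ys' x'" "x \<in> set ys'"
  shows "a = a'"
proof -
  obtain e us vs where e: "e \<in> entry_darts" "support (rot m) e = us @ a # ys @ x # vs"
    using assms(1) unfolding attached_def by blast
  obtain e' us' vs' where e': "e' \<in> entry_darts" "support (rot m) e' = us' @ a' # ys' @ x' # vs'"
    using assms(2) unfolding attached_def by blast
  have "e = e'" by (rule support_rot_disjoint[OF e(1) e'(1), of x]) (use e(2) e'(2) assms(3) in simp_all)
  moreover obtain ys1 ys2 where ys': "ys' = ys1 @ x # ys2" using assms(3) by (meson split_list)
  ultimately have eq: "(us @ a # ys) @ x # vs = (us' @ a' # ys1) @ x # (ys2 @ x' # vs')"
    using e(2) e'(2) by simp
  have "distinct ((us @ a # ys) @ x # vs)" using e(2) distinct_support_rot by (metis append.assoc append_Cons)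
  then have "x \<notin> set (us @ a # ys)" "x \<notin> set vs" by auto
  from append_Cons_eq_iff[OF this] eq have "us @ a # ys = us' @ a' # ys1" by blast
  then have "filter (\<lambda>y. y \<notin> all_back_ends) (us @ a # ys) = filter (\<lambda>y. y \<notin> all_back_ends) (us' @ a' # ys1)"
    by simp
  moreover have "filter (\<lambda>y. y \<notin> all_back_ends) ys = []" "filter (\<lambda>y. y \<notin> all_back_ends) ys1 = []"
    "a \<notin> all_back_ends" "a' \<notin> all_back_ends"
    using assms(1,2) ys' by (auto simp: attached_def filter_empty_conv)
  ultimately show ?thesis by simp
qed

lemma family_noncrossing:
  assumes planar: "planar_map m" and family: "family path P ts Q"
    and a: "attached a ys (opp m d1)"
    and order: "precedes (contours (opp m) ts) d1 d2" "precedes (contours (opp m) ts) d2 (opp m a)"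
    and c: "c \<in> set ts" "(d2, q) \<in> set (leaf_list c)"
  shows "int (length path) - 2 \<le> q"
proof (rule ccontr)
  assume "\<not> ?thesis"
  then obtain a2 ys2 where a2: "attached a2 ys2 (opp m d2)" "opp m a2 \<in> set Q"
    using low_leaf_attached[OF family c] by auto
  note distinct = family_distinct[OF family]
  then obtain us vs ws where w: "contours (opp m) ts = us @ d1 # vs @ opp m a # ws" "d2 \<in> set vs"
    using precedes_between[OF _ order] by auto
  have "opp m d1 \<notin> set ys2"
  proof
    assume "opp m d1 \<in> set ys2"
    then have "a = a2" using attached_unique[OF a a2(1)] by blast
    then show False using a2(2) w(1) distinct by auto
  qed
  moreover have "d1 \<noteq> d2" using w distinct by auto
  moreover have "contours (opp m) forest = (P @ us) @ opp m (opp m d1) # vs @ opp m a # (ws @ Q)"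
    using family_contour[OF family] w(1) by simp
  ultimately have "d2 \<in> set (vs @ [opp m a]) \<longleftrightarrow> opp m a2 \<in> set (vs @ [opp m a])"
    using chords_noncrossing[OF planar a a2(1), of "P @ us" vs "ws @ Q"] by simp
  then show False using w a2(2) distinct by auto
qed

lemma attached_prefix: "attached a (ys @ x # ys') x' \<Longrightarrow> attached a ys x"
  unfolding attached_def by fastforce

lemma corner_noncrossing:
  assumes planar: "planar_map m" and family: "family path P ts Q"
    and a: "attached a (ys @ opp m d2 # ys') (opp m d1)"
    and order: "precedes (contours (opp m) ts) d1 (opp m a)"
  shows "\<not> precedes (contours (opp m) ts) d2 d1"
proof
  assume d2: "precedes (contours (opp m) ts) d2 d1"
  note distinct = family_distinct[OF family]
  then have "distinct (contours (opp m) ts)" by simp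
  from precedes_between[OF this d2 order] obtain us vs ws
    where "contours (opp m) ts = us @ d2 # vs @ opp m a # ws" "d1 \<in> set vs" .
  then obtain vs1 vs2 where w: "contours (opp m) ts = us @ d2 # vs1 @ d1 # vs2 @ opp m a # ws"
    by (metis append.assoc append_Cons split_list)
  have "contours (opp m) forest = (P @ us @ d2 # vs1) @ opp m (opp m d1) # vs2 @ opp m a # (ws @ Q)"
    using family_contour[OF family] w by simp
  moreover have "d1 \<noteq> d2" "opp m d1 \<notin> set ys" using w distinct attached_not_between[OF a] by auto
  ultimately have "d2 \<in> set (vs2 @ [opp m a]) \<longleftrightarrow> opp m a \<in> set (vs2 @ [opp m a])"
    using chords_noncrossing[OF planar a attached_prefix[OF a], of "P @ us @ d2 # vs1" vs2 "ws @ Q"] by simp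
  then show False using w distinct by auto
qed

lemma leaf_precedes_contour_end:
  assumes family: "family path P ts Q" and "i \<le> k" "k < length ts" "(d, q) \<in> set (leaf_list (ts ! i))"
  shows "precedes (contours (opp m) ts) d (opp m (dart (ts ! k)))"
proof (cases "i = k")
  case True
  have "d \<in> leaf_darts" "dart (ts ! k) \<in> leaf_darts \<union> node_darts"
    using family_leaf_darts[OF family, of "ts ! i"] family_dart[OF family, of "ts ! k"] assms(2-4) by auto
  then have "d \<noteq> opp m (dart (ts ! k))" using upper_lower_disjoint by blast
  then have "precedes (contour (opp m) (ts ! k)) d (opp m (dart (ts ! k)))"
    using precedes_contour_last leaf_in_contour assms(4) True by metis
  then show ?thesis using assms(3) by (intro precedes_concat) auto
next
  case False
  then show ?thesis
    using precedes_concat_nth[of i k "map (contour (opp m)) ts"] assms leaf_in_contour[OF assms(4)]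
      dart_in_contour(2)[of "opp m" "ts ! k"] by simp
qed

text \<open>Condition (3) in the definition of a decorated tree.\<close>

lemma leaf_label_before:
  assumes planar: "planar_map m" and family: "family path P ts Q" and c: "c \<in> set ts"
    and order: "precedes (leaf_list c) (d2, q) (d1, int (length path) - 2)"
  shows "int (length path) - 2 \<le> q"
proof -
  obtain i where i: "i < length ts" "c = ts ! i" using c by (metis in_set_conv_nth)
  have leaves: "(d2, q) \<in> set (leaf_list c)" "(d1, int (length path) - 2) \<in> set (leaf_list c)"
    using precedes_in_set[OF order] by auto
  from leaf_attached[OF family i(1)] leaves(2) i(2) obtain k ys
    where k: "i \<le> k" "k < length ts" "attached (dart (ts ! k)) ys (opp m d1)" by metis
  have "precedes (contour (opp m) c) d1 d2" using leaf_list_precedes_contour[OF order] .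
  then have "precedes (contours (opp m) ts) d1 d2" using c by (intro precedes_concat) auto
  moreover have "precedes (contours (opp m) ts) d2 (opp m (dart (ts ! k)))"
    using leaf_precedes_contour_end[OF family k(1,2)] leaves(1) i(2) by simp
  ultimately show ?thesis using family_noncrossing[OF planar family k(3)] c leaves(1) by blast
qed


subsection \<open>Tightness\<close>

lemma block_subset:
  assumes planar: "planar_map m" and single: "forest = [\<tau>]" and low: low_leaves
    and family: "family path P ts Q" and b: "blocks path ts yss" and i: "i < length ts"
  shows "set (yss ! i) \<subseteq> set (back_ends_at (opp m) (int (length path) - 2) (ts ! i))"
proof
  fix x assume "x \<in> set (yss ! i)"
  then obtain us vs where ys: "yss ! i = us @ x # vs" by (meson split_list)
  from block_leaf[OF family b i \<open>x \<in> set (yss ! i)\<close>] obtain j d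
    where d: "j \<le> i" "x = opp m d" "(d, int (length path) - 2) \<in> set (leaf_list (ts ! j))" .
  have "j = i"
  proof (rule ccontr)
    assume "j \<noteq> i"
    then have ji: "j < i" using d(1) by simp
    have "length path > 1"
    proof (rule ccontr)
      assume "\<not> length path > 1"
      with family have "ts = forest" by cases (use family_path in fastforce)+
      then show False using single ji i by simp
    qed
    then obtain e q where e: "(e, q) \<in> set (leaf_list (ts ! i))" "q < int (length path) - 2"
      using low_leavesE[OF low family _ nth_mem[OF i]] by blast
    have "precedes (contours (opp m) ts) d e"
      using precedes_concat_nth[of j i "map (contour (opp m)) ts" d e] ji i
        leaf_in_contour[OF d(3)] leaf_in_contour[OF e(1)] by simp
    moreover have "precedes (contours (opp m) ts) e (opp m (dart (ts ! i)))"
      using leaf_precedes_contour_end[OF family order_refl i e(1)] .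
    ultimately show False
      using block_attached[OF family b i ys, unfolded d(2)]
        family_noncrossing[OF planar family _ _ _ nth_mem[OF i] e(1)] e(2)
      by simp
  qed
  then show "x \<in> set (back_ends_at (opp m) (int (length path) - 2) (ts ! i))"
    using d(2,3) unfolding set_back_ends_at by blast
qed

lemma set_block_eq:
  assumes planar: "planar_map m" and single: "forest = [\<tau>]" and low: low_leaves
    and family: "family path P ts Q" and b: "blocks path ts yss" and i: "i < length ts"
  shows "set (yss ! i) = set (back_ends_at (opp m) (int (length path) - 2) (ts ! i))"
proof
  note subset = block_subset[OF planar single low family b]
  show "set (yss ! i) \<subseteq> set (back_ends_at (opp m) (int (length path) - 2) (ts ! i))" using subset[OF i] .
  have in_contour: "set (back_ends_at (opp m) p c) \<subseteq> set (contour (opp m) c)" for p c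
    by (rule subset_trans[OF back_ends_at_subset back_ends_subset_contour])
  show "set (back_ends_at (opp m) (int (length path) - 2) (ts ! i)) \<subseteq> set (yss ! i)"
  proof
    fix x assume x: "x \<in> set (back_ends_at (opp m) (int (length path) - 2) (ts ! i))"
    then obtain d where d: "x = opp m d" "(d, int (length path) - 2) \<in> set (leaf_list (ts ! i))"
      unfolding set_back_ends_at by blast
    from leaf_block[OF family b i d(2)] obtain k where k: "k < length ts" "x \<in> set (yss ! k)" unfolding d(1) .
    then have "k = i" using contours_nth_unique[OF family k(1) i] subset[OF k(1)] in_contour x by blast
    then show "x \<in> set (yss ! i)" using k by simp
  qed
qed

lemma block_eq:
  assumes planar: "planar_map m" and single: "forest = [\<tau>]" and low: low_leaves
    and family: "family path P ts Q" and b: "blocks path ts yss" and i: "i < length ts"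
  shows "yss ! i = back_ends_at (opp m) (int (length path) - 2) (ts ! i)"
proof (rule sorted_wrt_asym_set_unique)
  let ?c = "ts ! i" and ?p = "int (length path) - 2"
  let ?R = "\<lambda>x y. precedes (contour (opp m) ?c) (opp m y) (opp m x)"
  have c: "?c \<in> set ts" using i by simp
  have subset: "set (yss ! i) \<subseteq> set (back_ends_at (opp m) ?p ?c)"
    using set_block_eq[OF planar single low family b i] by simp
  have "?R x y" if xy: "precedes (yss ! i) x y" for x y
  proof (rule ccontr)
    assume "\<not> ?R x y"
    from xy obtain us vs ws where ys: "yss ! i = (us @ x # vs) @ y # ws"
      unfolding precedes_iff_append by auto
    obtain d e
      where d: "x = opp m d" "(d, ?p) \<in> set (leaf_list ?c)" and e: "y = opp m e" "(e, ?p) \<in> set (leaf_list ?c)"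
      using subset precedes_in_set[OF xy] unfolding set_back_ends_at by blast
    have "x \<noteq> y" using block_distinct[OF b i] unfolding ys by auto
    then have "precedes (contour (opp m) ?c) d e"
      using \<open>\<not> ?R x y\<close> precedes_total[of d _ e] leaf_in_contour[OF d(2)] leaf_in_contour[OF e(2)] d(1) e(1)
      by auto
    then have "precedes (contours (opp m) ts) d e" using c by (intro precedes_concat) auto
    moreover have "precedes (contours (opp m) ts) e (opp m (dart ?c))"
      using leaf_precedes_contour_end[OF family order_refl i e(2)] .
    ultimately show False
      using corner_noncrossing[OF planar family block_attached[OF family b i ys, unfolded d(1) e(1)]] by blast
  qed
  then show "sorted_wrt ?R (yss ! i)"
    using sorted_wrt_mono_rel[of "yss ! i" "precedes (yss ! i)" ?R] sorted_wrt_precedes by blast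
  show "sorted_wrt ?R (back_ends_at (opp m) ?p ?c)"
    using sorted_wrt_mono_rel[of _ "precedes (back_ends_at (opp m) ?p ?c)" ?R] sorted_wrt_precedes
      back_ends_at_precedes_contour[of "opp m"] by auto
  show "set (yss ! i) = set (back_ends_at (opp m) ?p ?c)" using set_block_eq[OF planar single low family b i] .
  have "distinct (contours (opp m) ts)" using family_distinct[OF family] by simp
  then have "distinct (contour (opp m) ?c)" using c by (metis distinct_concat_iff image_eqI list.set_map)
  then show "\<not> ?R y x" if "?R x y" for x y using precedes_asym that by metis
qed

lemma examined_tight:
  assumes "planar_map m" "forest = [\<tau>]" low_leaves and family: "family path P ts Q"
  shows "examined path = concat (map (\<lambda>c. dart c # back_ends_at (opp m) (int (length path) - 2) c) ts)"
proof -
  obtain yss where b: "blocks path ts yss" using blocks_exist[OF family] .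
  have "map2 (\<lambda>c ys. dart c # ys) ts yss = map (\<lambda>c. dart c # back_ends_at (opp m) (int (length path) - 2) c) ts"
    using b block_eq[OF assms(1-3) family b] by (intro nth_equalityI) (auto simp: blocks_def)
  then show ?thesis using b by (simp add: blocks_def)
qed

end


section \<open>Addresses\<close>

fun subtree_at :: "dtree \<Rightarrow> nat list \<Rightarrow> dtree option" where
  "subtree_at t [] = Some t"
| "subtree_at (Leaf q) (i # a) = None"
| "subtree_at (Node ts) (i # a) = (if i < length ts then subtree_at (ts ! i) a else None)"

lemma in_subtrees_iff: "(a, s) \<in> set (subtrees t) \<longleftrightarrow> subtree_at t a = Some s"
proof (induction t arbitrary: a s)
  case (Leaf q)
  then show ?case by (cases a) auto
next
  case (Node ts)
  have "(a, s) \<in> set (subtrees (Node ts)) \<longleftrightarrow> a = [] \<and> s = Node ts \<or>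
      (\<exists>i b. a = i # b \<and> i < length ts \<and> (b, s) \<in> set (subtrees (ts ! i)))" by auto
  then show ?case using Node by (cases a) auto
qed

lemma tree_vertices_iff: "a \<in> tree_vertices t \<longleftrightarrow> subtree_at t a \<noteq> None"
proof -
  have "a \<in> tree_vertices t \<longleftrightarrow> (\<exists>s. (a, s) \<in> set (subtrees t))" unfolding tree_vertices_def by force
  then show ?thesis by (simp add: in_subtrees_iff)
qed

lemma finite_tree_vertices: "finite (tree_vertices t)"
  by (simp add: tree_vertices_def)

lemma Nil_in_tree_vertices [simp]: "[] \<in> tree_vertices t"
  by (simp add: tree_vertices_iff)

lemma tree_vertices_Leaf: "tree_vertices (Leaf q) = {[]}"
  by (simp add: tree_vertices_def)

lemma tree_vertices_Node:
  "tree_vertices (Node ts) = insert [] (\<Union>i<length ts. (#) i ` tree_vertices (ts ! i))"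
proof (rule set_eqI)
  fix a show "a \<in> tree_vertices (Node ts) \<longleftrightarrow> a \<in> insert [] (\<Union>i<length ts. (#) i ` tree_vertices (ts ! i))"
    by (cases a) (auto simp: tree_vertices_iff image_iff split: if_splits)
qed

lemma all_subtrees_Node:
  "(\<forall>a s. subtree_at (Node ts) a = Some s \<longrightarrow> \<Phi> a s) \<longleftrightarrow>
     \<Phi> [] (Node ts) \<and> (\<forall>i<length ts. \<forall>a s. subtree_at (ts ! i) a = Some s \<longrightarrow> \<Phi> (i # a) s)"
proof (intro iffI conjI allI impI)
  fix a s assume all: "\<Phi> [] (Node ts) \<and> (\<forall>i<length ts. \<forall>a s. subtree_at (ts ! i) a = Some s \<longrightarrow> \<Phi> (i # a) s)"
    and "subtree_at (Node ts) a = Some s"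
  then show "\<Phi> a s" by (cases a) (auto split: if_splits)
qed auto

lemma subtree_at_append:
  "subtree_at t (a @ b) = (case subtree_at t a of None \<Rightarrow> None | Some s \<Rightarrow> subtree_at s b)"
  by (induction t a rule: subtree_at.induct) auto

lemma subtree_at_snoc:
  "subtree_at t a = Some (Node ts) \<Longrightarrow> subtree_at t (a @ [i]) = (if i < length ts then Some (ts ! i) else None)"
  "subtree_at t a = Some (Leaf q) \<Longrightarrow> subtree_at t (a @ [i]) = None"
  by (simp_all add: subtree_at_append)

lemma subtree_at_prefixE:
  assumes "a @ i # b \<in> tree_vertices t"
  obtains ts where "subtree_at t a = Some (Node ts)" "i < length ts"
proof -
  from assms obtain s where s: "subtree_at t a = Some s" "subtree_at s (i # b) \<noteq> None"
    by (cases "subtree_at t a") (auto simp: subtree_at_append tree_vertices_iff)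
  then show ?thesis using that by (cases s) (auto split: if_splits)
qed

lemma arity_Node: "subtree_at t a = Some (Node ts) \<Longrightarrow> arity t a = length ts"
  by (simp add: arity_def tree_vertices_iff subtree_at_snoc)

lemma arity_Leaf: "subtree_at t a = Some (Leaf q) \<Longrightarrow> arity t a = 0"
  by (simp add: arity_def tree_vertices_iff subtree_at_snoc)

lemma in_leaves_iff: "(a, q) \<in> set (leaves t) \<longleftrightarrow> subtree_at t a = Some (Leaf q)"
  unfolding in_subtrees_iff[symmetric] by (force simp: leaves_def split: dtree.splits)

lemma in_labels_iff: "q \<in> set (labels t) \<longleftrightarrow> (\<exists>a. subtree_at t a = Some (Leaf q))"
  by (force simp: labels_def in_leaves_iff[symmetric])

lemma leaves_sorted: "sorted_wrt (\<lambda>x y. (fst x, fst y) \<in> lexord less_than) (leaves t)"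
proof (induction t)
  case (Node ts)
  show ?case unfolding leaves_Node
  proof (rule sorted_wrt_concat_upt)
    fix i assume "i < length ts"
    then have "sorted_wrt (\<lambda>x y. (fst x, fst y) \<in> lexord less_than) (leaves (ts ! i))" using Node by simp
    then show "sorted_wrt (\<lambda>x y. (fst x, fst y) \<in> lexord less_than)
        (map (\<lambda>(a, q). (i # a, q)) (leaves (ts ! i)))"
      unfolding sorted_wrt_map by (rule sorted_wrt_mono_rel[rotated]) auto
  qed auto
qed simp

lemma distinct_leaves: "distinct (map fst (leaves t))"
proof -
  have "distinct xs" if "sorted_wrt (\<lambda>a b. (a, b) \<in> lexord less_than) xs" for xs :: "nat list list"
    using that lexord_irreflexive[of less_than] by (induction xs) auto
  then show ?thesis using leaves_sorted[of t] by (simp add: sorted_wrt_map)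
qed

lemma filter_leaves_prefix:
  assumes "subtree_at t c = Some s"
  shows "filter (\<lambda>(a, q). prefix c a) (leaves t) = map (\<lambda>(b, q). (c @ b, q)) (leaves s)"
  using assms
proof (induction t c rule: subtree_at.induct[case_names Nil Leaf Node])
  case (Nil t)
  then show ?case by (simp add: case_prod_unfold)
next
  case (Node ts i a)
  then have i: "i < length ts" "subtree_at (ts ! i) a = Some s" by (auto split: if_splits)
  let ?f = "\<lambda>j. filter (\<lambda>(b, q). prefix (i # a) b) (map (\<lambda>(b, q). (j # b, q)) (leaves (ts ! j)))"
  have "filter (\<lambda>(b, q). prefix (i # a) b) (leaves (Node ts)) = concat (map ?f [0..<length ts])"
    unfolding leaves_Node filter_concat by (simp add: comp_def)
  also have "\<dots> = ?f i"
    by (rule concat_map_upt_single[OF i(1)]) (auto simp: filter_empty_conv)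
  also have "\<dots> = map (\<lambda>(b, q). (i # b, q)) (filter (\<lambda>(b, q). prefix a b) (leaves (ts ! i)))"
    by (simp add: filter_map comp_def case_prod_unfold)
  also have "\<dots> = map (\<lambda>(b, q). ((i # a) @ b, q)) (leaves s)"
    using Node(1)[OF i] by (simp add: case_prod_unfold comp_def)
  finally show ?case .
qed simp


section \<open>Decorated trees, recursively\<close>

definition no_smaller_before :: "'a::linorder \<Rightarrow> 'a list \<Rightarrow> bool" where
  "no_smaller_before p xs \<longleftrightarrow> (\<forall>q. precedes xs q p \<longrightarrow> p \<le> q)"

lemma no_smaller_before_iff_nth:
  "no_smaller_before p xs \<longleftrightarrow> (\<forall>j k. k < j \<and> j < length xs \<and> xs ! j = p \<longrightarrow> p \<le> xs ! k)"
  unfolding no_smaller_before_def precedes_iff_nth by blast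

text \<open>Below, \<open>p\<close> is the depth of the parent of the subtree.\<close>

fun locally_decorated :: "int \<Rightarrow> dtree \<Rightarrow> bool" where
  "locally_decorated p (Leaf q) \<longleftrightarrow> -1 \<le> q \<and> q < p"
| "locally_decorated p (Node ts) \<longleftrightarrow>
     (\<exists>q\<in>set (labels (Node ts)). q < p) \<and> no_smaller_before p (labels (Node ts))"

fun decorated_below :: "int \<Rightarrow> dtree \<Rightarrow> bool" where
  "decorated_below p (Leaf q) \<longleftrightarrow> locally_decorated p (Leaf q)"
| "decorated_below p (Node ts) \<longleftrightarrow> locally_decorated p (Node ts) \<and> (\<forall>c\<in>set ts. decorated_below (p + 1) c)"

lemma decorated_below_iff:
  "decorated_below p t \<longleftrightarrow> (\<forall>a s. subtree_at t a = Some s \<longrightarrow> locally_decorated (p + int (length a)) s)"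
proof (induction t arbitrary: p)
  case (Leaf q)
  have "subtree_at (Leaf q) a = Some s \<longleftrightarrow> a = [] \<and> s = Leaf q" for a s by (cases a) auto
  then show ?case by simp
next
  case (Node ts)
  then show ?case
    unfolding all_subtrees_Node by (simp add: all_set_conv_all_nth add.assoc)
qed

lemma decorated_below_low: "decorated_below p s \<Longrightarrow> \<exists>q\<in>set (labels s). q < p"
  by (cases s) auto

definition locally_decorated_children :: "dtree \<Rightarrow> bool" where
  "locally_decorated_children t \<longleftrightarrow>
     (\<forall>a s. subtree_at t a = Some s \<longrightarrow> a \<noteq> [] \<longrightarrow> locally_decorated (int (length a) - 1) s)"

lemma locally_decorated_children_Node:
  "locally_decorated_children (Node ts) \<longleftrightarrow> (\<forall>c\<in>set ts. decorated_below 0 c)"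
  unfolding locally_decorated_children_def all_subtrees_Node decorated_below_iff
  by (simp add: all_set_conv_all_nth)

lemma locally_decorated_children_if_decorated:
  assumes "decorated t"
  shows "locally_decorated_children t"
  unfolding locally_decorated_children_def
proof (intro allI impI)
  fix a s assume s: "subtree_at t a = Some s" "a \<noteq> []"
  then obtain b i where a: "a = b @ [i]" by (metis rev_exhaust)
  have mem: "(b @ [i], s) \<in> set (subtrees t)" using s(1) a in_subtrees_iff by simp
  show "locally_decorated (int (length a) - 1) s"
  proof (cases s)
    case (Leaf q)
    then have "q \<in> set (labels t)" using s(1) in_labels_iff by blast
    then show ?thesis using assms mem Leaf a unfolding decorated_def by simp
  next
    case (Node ts)
    have "no_smaller_before (int (length b)) (labels s)"
      using assms mem unfolding decorated_def no_smaller_before_iff_nth by blast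
    moreover have "\<exists>p\<in>set (labels (Node ts)). p \<le> int (length a) - 2"
      using assms mem Node a unfolding decorated_def by blast
    ultimately show ?thesis using Node a by fastforce
  qed
qed

lemma decorated_if_locally_decorated_children:
  assumes t: "t = Node ts" and local: "locally_decorated_children t"
  shows "decorated t"
  unfolding decorated_def plane_tree_def
proof (intro conjI allI ballI impI; (elim conjE)?)
  have local: "locally_decorated (int (length a) - 1) s" if "(a, s) \<in> set (subtrees t)" "a \<noteq> []" for a s
    using local that unfolding locally_decorated_children_def in_subtrees_iff by blast
  show "\<exists>ts. t = Node ts" using t by blast
  show "a = []" if "(a, Node []) \<in> set (subtrees t)" for a
    using local[OF that] by (auto simp: labels_Node)
  show "-1 \<le> p" if p: "p \<in> set (labels t)" for p
  proof -
    obtain a where "(a, Leaf p) \<in> set (subtrees t)" using p unfolding in_labels_iff in_subtrees_iff by blast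
    moreover from this have "a \<noteq> []" using t by auto
    ultimately show ?thesis using local by fastforce
  qed
  show "p < int (length a)" if "(a @ [i], Leaf p) \<in> set (subtrees t)" for a i p
    using local[OF that] by simp
  show "\<exists>p\<in>set (labels (Node us)). p \<le> int (length a) - 2"
    if us: "(a, Node us) \<in> set (subtrees t)" "0 < length a" for a us
  proof -
    have "a \<noteq> []" using us(2) by auto
    from local[OF us(1) this] obtain q where "q \<in> set (labels (Node us))" "q < int (length a) - 1" by auto
    then show ?thesis by (intro bexI[of _ q]) auto
  qed
  show "int (length a) \<le> labels s ! k"
    if s: "(a @ [i], s) \<in> set (subtrees t)"
      and k: "k < j" "j < length (labels s)" "labels s ! j = int (length a)"
    for a i s j k
  proof (cases s)
    case (Node us)
    then have "no_smaller_before (int (length a)) (labels s)" using local[OF s] by simp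
    then show ?thesis using k unfolding no_smaller_before_iff_nth by blast
  qed (use k in simp)
qed

lemma decorated_iff: "decorated t \<longleftrightarrow> (\<exists>ts. t = Node ts \<and> (\<forall>c\<in>set ts. decorated_below 0 c))"
proof -
  have "\<exists>ts. t = Node ts" if "decorated t" using that unfolding decorated_def plane_tree_def by (elim conjE)
  then have "decorated t \<longleftrightarrow> (\<exists>ts. t = Node ts) \<and> locally_decorated_children t"
    using locally_decorated_children_if_decorated decorated_if_locally_decorated_children by blast
  then show ?thesis using locally_decorated_children_Node by blast
qed


section \<open>Exploration trees of non-separable planar maps\<close>

text \<open>
  \<open>tight m p c\<close>: at every vertex in the subtree \<open>c\<close>, whose root has depth \<open>p\<close>, each child edge is
  immediately followed by the back edges from its subtree, in the order produced by the map \<open>S\<close>.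
\<close>

fun tight :: "'d cmap \<Rightarrow> int \<Rightarrow> 'd dart_tree \<Rightarrow> bool" where
  "tight m p (DLeaf d q) \<longleftrightarrow> True"
| "tight m p (DNode d ts) \<longleftrightarrow>
     tl (support (rot m) (opp m d)) = concat (map (\<lambda>c. dart c # back_ends_at (opp m) p c) ts) \<and>
     (\<forall>c\<in>set ts. tight m (p + 1) c)"

context explored_map
begin

lemma planar_decorated_below:
  assumes planar: "planar_map m" and low: low_leaves and "family path P ts Q" "c \<in> set ts"
  shows "length path > 1 \<longrightarrow> decorated_below (int (length path) - 2) (erase c)"
  using assms(3,4)
proof (induction rule: family_induct)
  case (DLeaf path P ts Q d q)
  have "q < int (length path) - 2" if "length path > 1"
    using low_leavesE[OF low DLeaf(1) that DLeaf(2)] by auto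
  then show ?case using leaf_label(1)[OF DLeaf, of d q] by simp
next
  case (DNode path P ts Q d us P' Q')
  let ?p = "int (length path) - 2" and ?c = "DNode d us"
  have labels: "labels (erase ?c) = map snd (leaf_list ?c)" by (rule labels_erase)
  have "?p \<le> q" if order: "precedes (map snd (leaf_list ?c)) q ?p" for q
  proof -
    obtain x y where "precedes (leaf_list ?c) x y" "snd x = q" "snd y = ?p" using order by (rule precedes_mapE)
    then show ?thesis using leaf_label_before[OF planar DNode(1,2)] by (metis prod.collapse)
  qed
  then have "no_smaller_before ?p (labels (erase ?c))" unfolding labels no_smaller_before_def by blast
  moreover have "\<exists>q\<in>set (labels (erase ?c)). q < ?p" if len: "length path > 1"
  proof -
    obtain e q where q: "(e, q) \<in> set (leaf_list ?c)" "q < ?p" using low_leavesE[OF low DNode(1) len DNode(2)] .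
    then have "q \<in> set (labels (erase ?c))" unfolding labels by (force simp del: leaf_list.simps)
    then show ?thesis using q(2) by blast
  qed
  moreover have "decorated_below (?p + 1) (erase c)" if "c \<in> set us" for c
    using DNode(4)[OF that] family_path[OF DNode(1)] by (simp add: algebra_simps)
  ultimately show ?case by simp
qed

lemma planar_tight:
  assumes "planar_map m" "forest = [\<tau>]" low_leaves "family path P ts Q" "c \<in> set ts"
  shows "tight m (int (length path) - 1) c"
  using assms(4,5)
proof (induction rule: family_induct)
  case (DNode path P ts Q d us P' Q')
  have "examined (path @ [opp m d]) = tl (support (rot m) (opp m d))"
    using family_path[OF DNode(1)] by (simp add: examined_def)
  then show ?case using examined_tight[OF assms(1-3) DNode(3)] DNode(4) by (simp add: algebra_simps)
qed simp

lemma exploration_tree_nonseparable: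
  assumes "planar_map m" "\<not> separable m" "card (edges m) \<ge> 2"
  obtains \<tau> where "forest = [\<tau>]" "decorated (erase \<tau>)" "tight m 0 \<tau>"
    "support (rot m) (root_dart m) = root_dart m # back_ends_at (opp m) (-1) \<tau>"
proof -
  obtain \<tau> where single: "forest = [\<tau>]" and root: "dart \<tau> = root_dart m"
    using forest_single_if_not_separable[OF assms(2)] .
  note low = low_leaves_if_not_separable[OF assms(2)]
  obtain d us where \<tau>: "\<tau> = DNode d us"
  proof (cases \<tau>)
    case (DLeaf d q)
    then have "card (edges m) = 1"
      using card_edges_eq_leaves_nodes card_leaf_darts card_node_darts single by simp
    then show ?thesis using assms(3) by simp
  qed blast
  obtain P Q where "family ([root_dart m] @ [opp m d]) P us Q"
    using family_childE[OF family_root, of d us] single \<tau> by auto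
  from planar_decorated_below[OF assms(1) low this] have "decorated (erase \<tau>)"
    unfolding decorated_iff \<tau> by simp
  moreover have "tight m 0 \<tau>" using planar_tight[OF assms(1) single low family_root, of \<tau>] single by simp
  moreover have "support (rot m) (root_dart m) = root_dart m # back_ends_at (opp m) (-1) \<tau>"
    using examined_tight[OF assms(1) single low family_root] single root by (simp add: examined_def)
  ultimately show ?thesis by (rule that[OF single])
qed

lemma low_leaves_if_decorated:
  assumes single: "forest = [\<tau>]" and "decorated (erase \<tau>)"
  shows low_leaves
proof -
  have below: "if length path = 1 then ts = forest
      else \<forall>c\<in>set ts. decorated_below (int (length path) - 2) (erase c)"
    if "family path P ts Q" for path P ts Q
    using that
  proof (induction rule: family.induct)
    case (family_child path P us d ts vs Q)
    show ?case
    proof (cases "length path = 1")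
      case True
      then have "\<tau> = DNode d ts" using family_child.IH single by (simp add: append_eq_Cons_conv)
      then have "\<forall>c\<in>set ts. decorated_below 0 (erase c)" using assms(2) by (auto simp: decorated_iff)
      then show ?thesis using True by simp
    next
      case False
      then have "decorated_below (int (length path) - 2) (erase (DNode d ts))" using family_child.IH by simp
      then have "\<forall>c\<in>set ts. decorated_below (int (length path) - 2 + 1) (erase c)" by simp
      then show ?thesis using family_path[OF family_child.hyps] by (simp add: algebra_simps)
    qed
  qed simp
  show ?thesis
    unfolding low_leaves_def
  proof (intro allI impI, elim conjE)
    fix path P ts Q c assume f: "family path P ts Q" "length path > 1" "c \<in> set ts"
    then have "decorated_below (int (length path) - 2) (erase c)" using below[OF f(1)] by simp
    from decorated_below_low[OF this] obtain x where "x \<in> set (leaf_list c)" "snd x < int (length path) - 2"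
      unfolding labels_erase by auto
    then show "\<exists>d q. (d, q) \<in> set (leaf_list c) \<and> q < int (length path) - 2" by (metis prod.collapse)
  qed
qed

end


section \<open>The closure of a tree\<close>

fun annotate :: "nat list \<Rightarrow> dtree \<Rightarrow> (nat list \<times> bool) dart_tree" where
  "annotate a (Leaf q) = DLeaf (a, True) q"
| "annotate a (Node ts) = DNode (a, True) (rev (map (\<lambda>i. annotate (a @ [i]) (ts ! i)) [0..<length ts]))"

lemma dart_annotate [simp]: "dart (annotate a s) = (a, True)"
  by (cases s) auto

lemma erase_annotate [simp]: "erase (annotate a s) = s"
proof (induction s arbitrary: a)
  case (Node ts)
  have "map (\<lambda>i. erase (annotate (a @ [i]) (ts ! i))) [0..<length ts] = ts"
    using Node by (intro nth_equalityI) auto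
  then show ?case by (simp add: rev_map comp_def)
qed simp

lemma leaf_list_annotate: "leaf_list (annotate a s) = map (\<lambda>(b, q). ((a @ b, True), q)) (leaves s)"
proof (induction s arbitrary: a)
  case (Node ts)
  have "map (\<lambda>i. leaf_list (annotate (a @ [i]) (ts ! i))) [0..<length ts] =
      map (\<lambda>i. map (\<lambda>(b, q). ((a @ b, True), q)) (map (\<lambda>(b, q). (i # b, q)) (leaves (ts ! i)))) [0..<length ts]"
    using Node by (intro nth_equalityI) (auto simp: case_prod_unfold)
  then have "concat (map (\<lambda>i. leaf_list (annotate (a @ [i]) (ts ! i))) [0..<length ts]) =
      map (\<lambda>(b, q). ((a @ b, True), q)) (leaves (Node ts))"
    unfolding leaves_Node map_concat map_map comp_def by (rule arg_cong)
  then show ?case by (simp add: comp_def)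
qed simp

lemma upper_darts_annotate: "dart ` descendants (annotate a s) = (\<lambda>b. (a @ b, True)) ` tree_vertices s"
proof (induction s arbitrary: a)
  case (Node ts)
  have "dart ` descendants (annotate a (Node ts)) =
      insert (a, True) (\<Union>i<length ts. dart ` descendants (annotate (a @ [i]) (ts ! i)))"
    by (auto simp: image_UN atLeast0LessThan)
  also have "\<dots> = insert (a, True) (\<Union>i<length ts. (\<lambda>b. ((a @ [i]) @ b, True)) ` tree_vertices (ts ! i))"
    using Node by simp
  also have "\<dots> = (\<lambda>b. (a @ b, True)) ` tree_vertices (Node ts)"
    by (simp add: tree_vertices_Node image_UN image_image)
  finally show ?case .
qed (simp add: tree_vertices_Leaf)

lemma set_contour_annotate:
  assumes "\<And>b. b \<in> tree_vertices s \<Longrightarrow> op (a @ b, True) = (a @ b, False)"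
  shows "set (contour op (annotate a s)) = (\<lambda>(b, x). (a @ b, x)) ` (tree_vertices s \<times> UNIV)"
proof -
  have "op ` (\<lambda>b. (a @ b, True)) ` tree_vertices s = (\<lambda>b. (a @ b, False)) ` tree_vertices s"
    unfolding image_image by (rule image_cong) (simp_all add: assms)
  then have "set (contour op (annotate a s)) =
      (\<lambda>b. (a @ b, True)) ` tree_vertices s \<union> (\<lambda>b. (a @ b, False)) ` tree_vertices s"
    unfolding set_contour_eq upper_darts_eq upper_darts_annotate by simp
  then show ?thesis by (auto simp: UNIV_bool)
qed

lemma distinct_contour_annotate:
  assumes "\<And>b. b \<in> tree_vertices s \<Longrightarrow> op (a @ b, True) = (a @ b, False)"
  shows "distinct (contour op (annotate a s))"
  using assms
proof (induction s arbitrary: a)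
  case (Leaf q)
  then show ?case using Leaf[of "[]"] by simp
next
  case (Node ts)
  let ?f = "\<lambda>i. contour op (annotate (a @ [i]) (ts ! i))"
  have op: "op ((a @ [i]) @ b, True) = ((a @ [i]) @ b, False)" if "i < length ts" "b \<in> tree_vertices (ts ! i)"
    for i b
    using Node.prems[of "i # b"] that by (auto simp: tree_vertices_Node)
  have f: "set (?f i) = (\<lambda>(b, x). ((a @ [i]) @ b, x)) ` (tree_vertices (ts ! i) \<times> UNIV)" if "i < length ts"
    for i
    using set_contour_annotate[of "ts ! i" op "a @ [i]"] op[OF that] by simp
  have "distinct (concat (map ?f (rev [0..<length ts])))"
  proof (rule distinct_concat_map)
    fix i assume "i \<in> set (rev [0..<length ts])"
    then have i: "i < length ts" by simp
    then show "distinct (?f i)" using Node.IH[of "ts ! i" "a @ [i]"] op[OF i] by simp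
  next
    fix i j assume "i \<in> set (rev [0..<length ts])" "j \<in> set (rev [0..<length ts])" "i \<noteq> j"
    then show "set (?f i) \<inter> set (?f j) = {}" by (auto simp: f)
  qed simp
  moreover have "(a, x) \<notin> set (concat (map ?f (rev [0..<length ts])))" for x by (auto simp: f)
  moreover have "op (a, True) = (a, False)" using Node.prems[of "[]"] by simp
  moreover have "contours op (rev (map (\<lambda>i. annotate (a @ [i]) (ts ! i)) [0..<length ts])) =
      concat (map ?f (rev [0..<length ts]))" by (simp add: rev_map comp_def)
  ultimately show ?case by simp
qed

lemma arranged_tight: "arranged op E ts (concat (map (\<lambda>c. dart c # back_ends_at op p c) ts))"
proof -
  have "arranged op E ts (ys @ concat (map (\<lambda>c. dart c # back_ends_at op p c) ts))" if "set ys \<subseteq> E" for ys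
    using that
  proof (induction ts arbitrary: E ys)
    case (Cons c ts)
    have "set (back_ends_at op p c) \<subseteq> E \<union> set (contour op c)"
      using back_ends_at_subset[of op p c] back_ends_subset_contour[of op c] by blast
    from Cons.IH[OF this] show ?case using Cons.prems by auto
  qed simp
  from this[of "[]"] show ?thesis by simp
qed

definition close_leaves :: "dtree \<Rightarrow> (nat list \<times> int) list \<Rightarrow> nat list \<times> bool \<Rightarrow> nat list \<times> bool" where
  "close_leaves t S = foldr close_leaf S (tree_rot t)"

text \<open>The darts inserted after \<open>(c, True)\<close> when the leaves in \<open>S\<close> are closed.\<close>

definition inserted :: "(nat list \<times> int) list \<Rightarrow> nat list \<Rightarrow> (nat list \<times> bool) list" where
  "inserted S c = map (\<lambda>(a, q). (a, False)) (filter (\<lambda>(a, q). take (nat (q + 1)) a = c) S)"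

lemma close_leaves_Nil [simp]: "close_leaves t [] = tree_rot t"
  by (simp add: close_leaves_def)

lemma close_leaves_Cons:
  "close_leaves t ((a, q) # S) =
     (close_leaves t S)((take (nat (q + 1)) a, True) := (a, False),
       (a, False) := close_leaves t S (take (nat (q + 1)) a, True))"
  by (simp add: close_leaves_def Let_def)

lemma inserted_Nil [simp]: "inserted [] c = []"
  by (simp add: inserted_def)

lemma inserted_Cons:
  "inserted ((a, q) # S) c = (if take (nat (q + 1)) a = c then (a, False) # inserted S c else inserted S c)"
  by (simp add: inserted_def)

lemma set_inserted:
  "x \<in> set (inserted S c) \<longleftrightarrow> (\<exists>a q. x = (a, False) \<and> (a, q) \<in> set S \<and> take (nat (q + 1)) a = c)"
  by (force simp: inserted_def)

lemma distinct_inserted: "distinct (map fst S) \<Longrightarrow> distinct (inserted S c)"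
  by (induction S) (force simp: inserted_Cons set_inserted)+

lemma close_leaves_other: "a \<notin> fst ` set S \<Longrightarrow> close_leaves t S (a, False) = tree_rot t (a, False)"
  by (induction S) (auto simp: close_leaves_Cons)

lemma close_leaves_chain:
  "distinct (map fst S) \<Longrightarrow>
    map (close_leaves t S) ((c, True) # inserted S c) = inserted S c @ [tree_rot t (c, True)]"
proof (induction S)
  case (Cons x S)
  obtain a q where x: "x = (a, q)" by (cases x)
  let ?e = "(take (nat (q + 1)) a, True)"
  have "(a, False) \<notin> set (inserted S c)" "?e \<notin> set (inserted S c)"
    using Cons.prems x by (force simp: set_inserted)+
  then have other: "map (close_leaves t (x # S)) (inserted S c) = map (close_leaves t S) (inserted S c)"
    by (simp add: x close_leaves_Cons)
  have IH: "map (close_leaves t S) ((c, True) # inserted S c) = inserted S c @ [tree_rot t (c, True)]"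
    using Cons by simp
  show ?case
  proof (cases "take (nat (q + 1)) a = c")
    case True
    then have "close_leaves t (x # S) (c, True) = (a, False)"
      "close_leaves t (x # S) (a, False) = close_leaves t S (c, True)"
      by (simp_all add: x close_leaves_Cons)
    then show ?thesis using IH other[unfolded x] True by (simp add: x inserted_Cons del: map_eq_conv)
  next
    case False
    then have "close_leaves t (x # S) (c, True) = close_leaves t S (c, True)"
      by (simp add: x close_leaves_Cons)
    then show ?thesis using IH other[unfolded x] False by (simp add: x inserted_Cons del: map_eq_conv)
  qed
qed simp

text \<open>The darts around the vertex \<open>a\<close> of arity \<open>n\<close> after \<open>(a, False)\<close>.\<close>

definition closed_rotation :: "(nat list \<times> int) list \<Rightarrow> nat list \<Rightarrow> nat \<Rightarrow> (nat list \<times> bool) list" where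
  "closed_rotation S a n = concat (map (\<lambda>i. (a @ [i], True) # inserted S (a @ [i])) (rev [0..<n]))"

lemma tree_rot_siblings:
  "n > 0 \<Longrightarrow> map (\<lambda>i. tree_rot t (a @ [i], True)) (rev [0..<n]) =
     tl (map (\<lambda>i. (a @ [i], True)) (rev [0..<n])) @ [(a, False)]"
proof (induction n)
  case (Suc n)
  then show ?case by (cases n) auto
qed simp

lemma close_leaves_node:
  assumes S: "distinct (map fst S)" "a \<notin> fst ` set S" and a: "subtree_at t a = Some (Node ts)"
  shows "map (close_leaves t S) ((a, False) # closed_rotation S a (length ts)) =
    closed_rotation S a (length ts) @ [(a, False)]"
proof (cases "length ts")
  case 0
  then show ?thesis using close_leaves_other[OF S(2)] arity_Node[OF a] by (simp add: closed_rotation_def)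
next
  case (Suc n)
  have "map (close_leaves t S) (closed_rotation S a (length ts)) =
      tl (closed_rotation S a (length ts)) @ [(a, False)]"
    unfolding closed_rotation_def
    by (rule map_concat_chain[where nx = "\<lambda>i. tree_rot t (a @ [i], True)"])
      (use close_leaves_chain[OF S(1)] tree_rot_siblings[of "length ts" t a] Suc in auto)
  moreover have "close_leaves t S (a, False) = (a @ [n], True)"
    using close_leaves_other[OF S(2)] arity_Node[OF a] Suc by simp
  moreover obtain xs where "closed_rotation S a (length ts) = (a @ [n], True) # xs"
    using Suc by (simp add: closed_rotation_def)
  ultimately show ?thesis by simp
qed

locale labelled_tree =
  fixes t :: dtree
  assumes node: "\<exists>ts. t = Node ts"
    and label: "subtree_at t a = Some (Leaf q) \<Longrightarrow> -1 \<le> q \<and> q < int (length a) - 1"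
begin

abbreviation m :: "(nat list \<times> bool) cmap" where "m \<equiv> closure_map t"

abbreviation D :: "(nat list \<times> bool) set" where "D \<equiv> tree_vertices t \<times> UNIV"

abbreviation rotation :: "nat list \<times> bool \<Rightarrow> nat list \<times> bool" where "rotation \<equiv> close_leaves t (leaves t)"

lemma closure_map_simps:
  "darts m = D" "rot m = perm_restrict rotation D" "opp m = perm_restrict (\<lambda>(a, b). (a, \<not> b)) D"
  "root_dart m = ([], True)"
  by (simp_all add: closure_map_def close_leaves_def foldr_conv_fold Let_def)

lemma opp_closure: "a \<in> tree_vertices t \<Longrightarrow> opp m (a, x) = (a, \<not> x)"
  by (simp add: closure_map_simps perm_restrict_def)

lemma opp_opp_closure: "opp m (opp m d) = d"
  by (cases d) (auto simp: closure_map_simps perm_restrict_def)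

lemma leaf_vertex: "(a, q) \<in> set (leaves t) \<Longrightarrow> a \<in> tree_vertices t"
  by (simp add: in_leaves_iff tree_vertices_iff)

lemma inserted_subset_darts: "set (inserted (leaves t) c) \<subseteq> D"
  using leaf_vertex by (auto simp: set_inserted)

lemma inserted_eq_back_ends:
  assumes "subtree_at t c = Some s"
  shows "inserted (leaves t) c = back_ends_at (opp m) (int (length c) - 1) (annotate c s)"
proof -
  let ?at_c = "\<lambda>(a, q). q = int (length c) - 1"
  have "take (nat (q + 1)) a = c \<longleftrightarrow> ?at_c (a, q) \<and> prefix c a" if "(a, q) \<in> set (leaves t)" for a q
  proof -
    have q: "-1 \<le> q" "q < int (length a) - 1" using label[of a q] that in_leaves_iff by auto
    then have "take (nat (q + 1)) a = c \<Longrightarrow> nat (q + 1) = length c" by auto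
    then show ?thesis using q by (auto simp: take_is_prefix) (metis append_eq_conv_conj prefixE)
  qed
  then have "filter (\<lambda>(a, q). take (nat (q + 1)) a = c) (leaves t) =
      filter ?at_c (filter (\<lambda>(a, q). prefix c a) (leaves t))"
    unfolding filter_filter by (intro filter_cong) auto
  then have "inserted (leaves t) c = map (\<lambda>(b, q). (c @ b, False)) (filter ?at_c (leaves s))"
    unfolding inserted_def filter_leaves_prefix[OF assms] by (simp add: filter_map comp_def case_prod_unfold)
  also have "\<dots> = map (\<lambda>(b, q). opp m (c @ b, True)) (filter ?at_c (leaves s))"
  proof (rule map_cong[OF refl], clarsimp)
    fix b assume "(b, int (length c) - 1) \<in> set (leaves s)"
    then have "c @ b \<in> tree_vertices t"
      using assms by (simp add: tree_vertices_iff subtree_at_append in_leaves_iff)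
    then show "(c @ b, False) = opp m (c @ b, True)" using opp_closure by simp
  qed
  also have "\<dots> = back_ends_at (opp m) (int (length c) - 1) (annotate c s)"
    unfolding back_ends_at_def leaf_list_annotate by (simp add: filter_map comp_def case_prod_unfold)
  finally show ?thesis .
qed

lemma is_cycle_root: "is_cycle rotation (([], True) # inserted (leaves t) [])"
  unfolding is_cycle_Cons_iff using close_leaves_chain[OF distinct_leaves] distinct_inserted[OF distinct_leaves]
  by (auto simp: set_inserted)

lemma is_cycle_node:
  assumes a: "subtree_at t a = Some (Node ts)"
  shows "is_cycle rotation ((a, False) # closed_rotation (leaves t) a (length ts))"
proof -
  have "distinct (closed_rotation (leaves t) a (length ts))"
    unfolding closed_rotation_def
    by (rule distinct_concat_map)
      (auto simp: set_inserted in_leaves_iff distinct_inserted[OF distinct_leaves])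
  moreover have not_leaf: "a \<notin> fst ` set (leaves t)" using a by (auto simp: in_leaves_iff)
  then have "(a, False) \<notin> set (closed_rotation (leaves t) a (length ts))"
    by (force simp: closed_rotation_def set_inserted)
  ultimately show ?thesis
    using close_leaves_node[OF distinct_leaves not_leaf a] by (simp add: is_cycle_Cons_iff)
qed

lemma closed_rotation_subset_darts:
  assumes "subtree_at t a = Some (Node ts)"
  shows "set ((a, False) # closed_rotation (leaves t) a (length ts)) \<subseteq> D"
  using inserted_subset_darts assms subtree_at_snoc(1)[OF assms]
  by (auto simp: closed_rotation_def tree_vertices_iff)

lemma upper_dart_in_cycle:
  assumes "c \<in> tree_vertices t"
  obtains xs where "is_cycle rotation xs" "set xs \<subseteq> D" "set ((c, True) # inserted (leaves t) c) \<subseteq> set xs"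
proof (cases c rule: rev_cases)
  case Nil
  then show ?thesis using that[OF is_cycle_root] inserted_subset_darts[of "[]"] by simp
next
  case (snoc b i)
  then obtain ts where ts: "subtree_at t b = Some (Node ts)" "i < length ts"
    using subtree_at_prefixE[of b i "[]"] assms by auto
  have "set ((c, True) # inserted (leaves t) c) \<subseteq> set ((b, False) # closed_rotation (leaves t) b (length ts))"
    using snoc ts(2) by (auto simp: closed_rotation_def)
  then show ?thesis using that[OF is_cycle_node[OF ts(1)] closed_rotation_subset_darts[OF ts(1)]] by blast
qed

lemma leaf_inserted:
  assumes "subtree_at t a = Some (Leaf q)"
  shows "(a, False) \<in> set (inserted (leaves t) (take (nat (q + 1)) a))"
  using assms by (auto simp: set_inserted in_leaves_iff)

lemma take_in_tree_vertices: "a \<in> tree_vertices t \<Longrightarrow> take k a \<in> tree_vertices t"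
  using subtree_at_append[of t "take k a" "drop k a"] by (auto simp: tree_vertices_iff split: option.splits)

lemma in_cycle:
  assumes "x \<in> D"
  shows "\<exists>xs. is_cycle rotation xs \<and> x \<in> set xs \<and> set xs \<subseteq> D"
proof -
  obtain a b where x: "x = (a, b)" and a: "a \<in> tree_vertices t" using assms by auto
  obtain s where s: "subtree_at t a = Some s" using a by (auto simp: tree_vertices_iff)
  show ?thesis
  proof (cases b)
    case True
    obtain xs where "is_cycle rotation xs" "set xs \<subseteq> D" "set ((a, True) # inserted (leaves t) a) \<subseteq> set xs"
      by (rule upper_dart_in_cycle[OF a])
    then show ?thesis using x True by auto
  next
    case False
    show ?thesis
    proof (cases s)
      case (Node ts)
      then show ?thesis
        using is_cycle_node[of a ts] closed_rotation_subset_darts[of a ts] s x False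
        by (intro exI[of _ "(a, False) # closed_rotation (leaves t) a (length ts)"]) simp
    next
      case (Leaf q)
      let ?c = "take (nat (q + 1)) a"
      obtain xs where "is_cycle rotation xs" "set xs \<subseteq> D" "set ((?c, True) # inserted (leaves t) ?c) \<subseteq> set xs"
        by (rule upper_dart_in_cycle[OF take_in_tree_vertices[OF a]])
      then show ?thesis using leaf_inserted[of a q] s Leaf x False by auto
    qed
  qed
qed

sublocale combinatorial_map m
proof
  show "finite (darts m)" using finite_tree_vertices by (simp add: closure_map_simps)
  show "rot m permutes darts m"
    unfolding closure_map_simps
    by (rule perm_restrict_permutes[OF in_cycle]) (simp_all add: finite_tree_vertices)
  show "opp m permutes darts m"
    unfolding permutes_def using opp_opp_closure by (metis closure_map_simps(1,3) perm_restrict_simps(2))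
  show "opp m d \<noteq> d \<and> opp m (opp m d) = d" if "d \<in> darts m" for d
    using that opp_opp_closure[of d] opp_closure by (cases d) (auto simp: closure_map_simps(1))
  show "root_dart m \<in> darts m" by (simp add: closure_map_simps)
qed

lemma is_cycle_rot_closure: "is_cycle rotation xs \<Longrightarrow> set xs \<subseteq> D \<Longrightarrow> is_cycle (rot m) xs"
  unfolding is_cycle_def closure_map_simps
  by (metis (no_types, lifting) map_eq_conv perm_restrict_simps(1) subsetD)

lemma support_root: "support (rot m) ([], True) = ([], True) # inserted (leaves t) []"
  by (rule support_eq_if_is_cycle[OF is_cycle_rot_closure[OF is_cycle_root]])
    (use inserted_subset_darts[of "[]"] in simp)

lemma support_node:
  "subtree_at t a = Some (Node ts) \<Longrightarrow>
    support (rot m) (a, False) = (a, False) # closed_rotation (leaves t) a (length ts)"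
  by (rule support_eq_if_is_cycle[OF is_cycle_rot_closure[OF is_cycle_node closed_rotation_subset_darts]])

definition entry_path :: "nat list \<Rightarrow> (nat list \<times> bool) list" where
  "entry_path a = ([], True) # map (\<lambda>k. (take k a, False)) [0..<length a]"

lemma entry_path_snoc: "entry_path (a @ [i]) = entry_path a @ [(a, False)]"
  by (simp add: entry_path_def)

lemma leaf_in_ancestor:
  assumes "subtree_at t a = Some (Leaf q)"
  shows "(a, False) \<in> vertex m (entry_path a ! nat (q + 1))"
proof (cases "nat (q + 1)")
  case 0
  then show ?thesis
    using leaf_inserted[OF assms] unfolding vertex_eq_set_support by (simp add: entry_path_def support_root)
next
  case (Suc k)
  have k: "k < length a" using label[OF assms] Suc by linarith
  then have split: "take (Suc k) a = take k a @ [a ! k]" by (simp add: take_Suc_conv_app_nth)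
  then have "take k a @ a ! k # [] \<in> tree_vertices t"
    using take_in_tree_vertices[of a "Suc k"] assms by (simp add: tree_vertices_iff)
  then obtain ts where ts: "subtree_at t (take k a) = Some (Node ts)" "a ! k < length ts"
    using subtree_at_prefixE by blast
  have "(a, False) \<in> set (inserted (leaves t) (take k a @ [a ! k]))"
    using leaf_inserted[OF assms] Suc split by simp
  then have "(a, False) \<in> set (closed_rotation (leaves t) (take k a) (length ts))"
    using ts(2) by (auto simp: closed_rotation_def)
  then have "(a, False) \<in> vertex m (take k a, False)"
    unfolding vertex_eq_set_support support_node[OF ts(1)] by simp
  then show ?thesis using Suc k by (simp add: entry_path_def)
qed

lemma closed_rotation_children:
  assumes a: "subtree_at t a = Some (Node ts)"
  shows "closed_rotation (leaves t) a (length ts) =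
    concat (map (\<lambda>c. dart c # back_ends_at (opp m) (int (length a)) c)
    (rev (map (\<lambda>i. annotate (a @ [i]) (ts ! i)) [0..<length ts])))"
proof -
  have "(a @ [i], True) # inserted (leaves t) (a @ [i]) = dart (annotate (a @ [i]) (ts ! i)) #
      back_ends_at (opp m) (int (length a)) (annotate (a @ [i]) (ts ! i))" if "i < length ts" for i
    using inserted_eq_back_ends[of "a @ [i]" "ts ! i"] subtree_at_snoc(1)[OF a] that by simp
  then show ?thesis unfolding closed_rotation_def rev_map map_map comp_def
    by (intro arg_cong[of _ _ concat] map_cong refl) simp
qed

lemma annotate_explored_tight:
  "subtree_at t a = Some s \<Longrightarrow>
    explored m (entry_path a) (annotate a s) \<and> tight m (int (length a)) (annotate a s)"
proof (induction s arbitrary: a)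
  case (Leaf q)
  have "opp m (a, True) = (a, False)" using opp_closure Leaf by (simp add: tree_vertices_iff)
  moreover have "nat (q + 1) < length (entry_path a)" "q = int (nat (q + 1)) - 1"
    using label[OF Leaf] by (auto simp: entry_path_def)
  ultimately show ?case using leaf_in_ancestor[OF Leaf] by auto
next
  case (Node ts)
  let ?cs = "rev (map (\<lambda>i. annotate (a @ [i]) (ts ! i)) [0..<length ts])"
  have opp: "opp m (a, True) = (a, False)" using opp_closure Node.prems by (simp add: tree_vertices_iff)
  have rotation: "tl (support (rot m) (opp m (a, True))) =
      concat (map (\<lambda>c. dart c # back_ends_at (opp m) (int (length a)) c) ?cs)"
    unfolding opp support_node[OF Node.prems] closed_rotation_children[OF Node.prems] by simp
  have "explored m (entry_path a @ [opp m (a, True)]) c \<and> tight m (int (length a) + 1) c" if c: "c \<in> set ?cs"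
    for c
  proof -
    obtain i where i: "i < length ts" "c = annotate (a @ [i]) (ts ! i)" using c by auto
    have "subtree_at t (a @ [i]) = Some (ts ! i)" using subtree_at_snoc(1)[OF Node.prems] i(1) by simp
    from Node.IH[OF nth_mem[OF i(1)] this] show ?thesis
      using opp i(2) by (simp add: entry_path_snoc add.commute)
  qed
  then show ?case
    unfolding annotate.simps explored.simps tight.simps rotation using arranged_tight by blast
qed

lemma support_root_tight:
  "support (rot m) (root_dart m) = root_dart m # back_ends_at (opp m) (-1) (annotate [] t)"
  using support_root inserted_eq_back_ends[of "[]" t] by (simp add: closure_map_simps(4))

sublocale explored_map m "[annotate [] t]"
proof
  have opp: "opp m ([] @ b, True) = ([] @ b, False)" if "b \<in> tree_vertices t" for b
    using opp_closure that by simp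
  show "distinct (contours (opp m) [annotate [] t])"
    using distinct_contour_annotate[of t "opp m" "[]"] opp by simp
  show "set (contours (opp m) [annotate [] t]) = darts m"
    using set_contour_annotate[of t "opp m" "[]"] opp by (simp add: closure_map_simps(1))
  show "arranged (opp m) {} [annotate [] t] (support (rot m) (root_dart m))"
    unfolding support_root_tight using arranged_tight[of "opp m" "{}" "[annotate [] t]" "-1"]
    by (simp add: closure_map_simps(4))
  show "explored m [root_dart m] c" if "c \<in> set [annotate [] t]" for c
    using annotate_explored_tight[of "[]" t] that by (simp add: entry_path_def closure_map_simps(4))
qed

lemma card_edges_closure: "card (edges m) = card (tree_vertices t)"
proof -
  have "leaf_darts \<union> node_darts = dart ` descendants (annotate [] t)"
    unfolding leaf_darts_def node_darts_def upper_darts_eq[symmetric] by simp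
  also have "\<dots> = (\<lambda>b. (b, True)) ` tree_vertices t" by (simp add: upper_darts_annotate)
  finally show ?thesis unfolding card_edges by (simp add: card_image inj_on_def)
qed

end


subsection \<open>Planarity of the closure\<close>

locale noncrossing_tree = labelled_tree +
  assumes no_smaller: "subtree_at t (b @ [i]) = Some s \<Longrightarrow> no_smaller_before (int (length b)) (labels s)"
begin

text \<open>
  The boundary of the faces when only the leaves in \<open>S\<close> have been closed.  Closing the next leaf
  \<open>(a, q)\<close> splits a face in two, because the dart at which the new edge is inserted is still on the
  same face as \<open>(a, True)\<close>: walking around the tree from the leaf to this ancestor only meets
  unclosed leaves.
\<close>

definition face_perm :: "(nat list \<times> int) list \<Rightarrow> nat list \<times> bool \<Rightarrow> nat list \<times> bool" where
  "face_perm S = perm_restrict (close_leaves t S) D \<circ> opp m"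

lemma face_perm_eq: "a \<in> tree_vertices t \<Longrightarrow> face_perm S (a, x) = close_leaves t S (a, \<not> x)"
  by (simp add: face_perm_def opp_closure perm_restrict_def)

definition untouched :: "(nat list \<times> int) list \<Rightarrow> nat list \<Rightarrow> bool" where
  "untouched S b \<longleftrightarrow> (\<forall>(a, q)\<in>set S. \<not> prefix b a)"

lemma untouched_inserted: "untouched S b \<Longrightarrow> inserted S b = []"
  unfolding inserted_def untouched_def filter_empty_conv map_is_Nil_conv using take_is_prefix by blast

lemma untouched_snoc: "untouched S b \<Longrightarrow> untouched S (b @ [i])"
  unfolding untouched_def by (auto dest: append_prefixD)

lemma close_leaves_untouched: "untouched S b \<Longrightarrow> close_leaves t S (b, False) = tree_rot t (b, False)"
  by (rule close_leaves_other) (auto simp: untouched_def)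

context
  fixes S :: "(nat list \<times> int) list"
  assumes distinct_S: "distinct (map fst S)"
begin

lemma face_perm_child:
  assumes "inserted S (b @ [i]) = []" "b @ [i] \<in> tree_vertices t"
  shows "face_perm S (b @ [i], False) = (if i = 0 then (b, False) else (b @ [i - 1], True))"
  using close_leaves_chain[OF distinct_S, of t "b @ [i]"] assms by (simp add: face_perm_eq)

lemma face_perm_climb:
  assumes "b @ [i] \<in> tree_vertices t" and "(b @ [i], False) \<in> orbit (face_perm S) x"
    and "\<And>j. j \<le> i \<Longrightarrow> inserted S (b @ [j]) = []"
    and "\<And>j. j < i \<Longrightarrow> (b @ [j], False) \<in> orbit (face_perm S) (b @ [j], True)"
  shows "(b, False) \<in> orbit (face_perm S) x"
  using assms
proof (induction i)
  case 0
  then show ?case using face_perm_child[of b 0] orbit.step by force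
next
  case (Suc i)
  have "face_perm S (b @ [Suc i], False) = (b @ [i], True)"
    using face_perm_child[of b "Suc i"] Suc.prems(1,3) by simp
  then have "(b @ [i], True) \<in> orbit (face_perm S) x" using orbit.step[OF Suc.prems(2)] by simp
  then have "(b @ [i], False) \<in> orbit (face_perm S) x" using Suc.prems(4)[of i] by (metis lessI orbit_trans)
  moreover obtain ts where "subtree_at t b = Some (Node ts)" "Suc i < length ts"
    using subtree_at_prefixE Suc.prems(1) by blast
  then have "b @ [i] \<in> tree_vertices t" by (simp add: tree_vertices_iff subtree_at_snoc)
  ultimately show ?case using Suc.IH Suc.prems(3,4) by simp
qed

lemma face_perm_untouched:
  "subtree_at t b = Some s \<Longrightarrow> untouched S b \<Longrightarrow> (b, False) \<in> orbit (face_perm S) (b, True)"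
proof (induction s arbitrary: b)
  case (Leaf q)
  have "face_perm S (b, True) = (b, False)"
    using close_leaves_untouched[OF Leaf(2)] arity_Leaf[OF Leaf(1)] Leaf(1)
    by (simp add: face_perm_eq tree_vertices_iff)
  then show ?case using orbit.base by metis
next
  case (Node ts)
  have down: "face_perm S (b, True) = (if ts = [] then (b, False) else (b @ [length ts - 1], True))"
    using close_leaves_untouched[OF Node.prems(2)] arity_Node[OF Node.prems(1)] Node.prems(1)
    by (simp add: face_perm_eq tree_vertices_iff)
  have child: "(b @ [j], False) \<in> orbit (face_perm S) (b @ [j], True)" if "j < length ts" for j
    using Node.IH[of "ts ! j" "b @ [j]"] subtree_at_snoc(1)[OF Node.prems(1)]
      untouched_snoc[OF Node.prems(2)] that
    by simp
  show ?case
  proof (cases ts rule: rev_cases)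
    case Nil
    then show ?thesis using down orbit.base by metis
  next
    case (snoc us s)
    let ?i = "length us"
    have "(b @ [?i], True) \<in> orbit (face_perm S) (b, True)"
      using down snoc orbit.base[of "face_perm S" "(b, True)"] by simp
    then have "(b @ [?i], False) \<in> orbit (face_perm S) (b, True)"
      using child[of ?i] snoc by (metis length_append_singleton lessI orbit_trans)
    moreover have "b @ [?i] \<in> tree_vertices t"
      using subtree_at_snoc(1)[OF Node.prems(1)] snoc by (simp add: tree_vertices_iff)
    ultimately show ?thesis
      using face_perm_climb untouched_inserted[OF untouched_snoc[OF Node.prems(2)]] child snoc by simp
  qed
qed

end

context
  fixes pre S a q assumes leaves: "leaves t = pre @ (a, q) # S"
begin

lemma leaf_a: "subtree_at t a = Some (Leaf q)"
  using leaves in_leaves_iff[of a q t] by simp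

lemma untouched_earlier_sibling:
  assumes a: "a = b @ i # c" and "j < i"
  shows "untouched S (b @ [j])"
  unfolding untouched_def
proof (intro ballI, clarify)
  fix a' q' assume "(a', q') \<in> set S" "prefix (b @ [j]) a'"
  moreover from this(1) have "(a, a') \<in> lexord less_than"
    using leaves_sorted[of t] leaves by (auto simp: sorted_wrt_append)
  ultimately show False using a \<open>j < i\<close> by (auto elim!: prefixE simp: lexord_same_pref_iff)
qed

lemma nothing_inserted_on_path:
  assumes l: "nat (q + 1) \<le> l" "l < length a"
  shows "inserted S (take (Suc l) a) = []"
proof (rule ccontr)
  let ?c = "take (Suc l) a"
  have c: "?c = take l a @ [a ! l]" using l(2) by (rule take_Suc_conv_app_nth)
  assume "inserted S ?c \<noteq> []"
  then obtain a' q' where a': "(a', q') \<in> set S" "take (nat (q' + 1)) a' = ?c"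
    unfolding inserted_def by (auto simp: filter_empty_conv)
  have "subtree_at t a' = Some (Leaf q')" using a'(1) leaves in_leaves_iff[of a' q' t] by simp
  from label[OF this] have q': "-1 \<le> q'" "nat (q' + 1) \<le> length a'" by auto
  then have "nat (q' + 1) = Suc l" using arg_cong[OF a'(2), of length] l(2) by simp
  then have q': "q' = int l" using q'(1) by simp
  obtain s where s: "subtree_at t ?c = Some s"
    using take_in_tree_vertices[of a "Suc l"] leaf_a by (auto simp: tree_vertices_iff)
  obtain vs ws where "S = vs @ (a', q') # ws" using a'(1) by (meson split_list)
  then have "precedes (leaves t) (a, q) (a', q')" unfolding precedes_iff_append leaves by blast
  then have "precedes (filter (\<lambda>(a, q). prefix ?c a) (leaves t)) (a, q) (a', q')"
    using subseq_filter[of "[(a, q), (a', q')]" "leaves t"] a'(2) take_is_prefix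
    by (metis (no_types, lifting) case_prodI filter.simps)
  from subseq_map[OF this, of snd]
  have "precedes (labels s) q (int l)"
    unfolding filter_leaves_prefix[OF s] q' labels_def by (simp add: comp_def case_prod_unfold)
  moreover have "no_smaller_before (int l) (labels s)"
    using no_smaller[of "take l a" "a ! l" s] s c l(2) by simp
  ultimately show False using l(1) label[OF leaf_a] unfolding no_smaller_before_def by fastforce
qed

lemma face_perm_leaf_path: "(take (nat (q + 1)) a, False) \<in> orbit (face_perm S) (a, True)"
proof -
  have S: "distinct (map fst S)" "a \<notin> fst ` set S" using distinct_leaves[of t] leaves by auto
  have "nat (q + 1) \<le> length a" using label[OF leaf_a] by linarith
  then show ?thesis
  proof (induction rule: inc_induct)
    case base
    have "face_perm S (a, True) = (a, False)"
      using close_leaves_other[OF S(2)] arity_Leaf[OF leaf_a] leaf_a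
      by (simp add: face_perm_eq tree_vertices_iff)
    then show ?case using orbit.base[of "face_perm S" "(a, True)"] by simp
  next
    case (step l)
    let ?b = "take l a" and ?i = "a ! l"
    have split: "take (Suc l) a = ?b @ [?i]" using step.hyps(2) by (rule take_Suc_conv_app_nth)
    have "?b @ [?i] \<in> tree_vertices t"
      using take_in_tree_vertices[of a "Suc l"] leaf_a split by (simp add: tree_vertices_iff)
    moreover from this obtain ts where ts: "subtree_at t ?b = Some (Node ts)" "?i < length ts"
      by (rule subtree_at_prefixE)
    have untouched: "untouched S (?b @ [j])" if "j < ?i" for j
      using untouched_earlier_sibling[OF id_take_nth_drop[OF step.hyps(2)] that] .
    have "(?b @ [j], False) \<in> orbit (face_perm S) (?b @ [j], True)" if "j < ?i" for j
      using face_perm_untouched[OF S(1) _ untouched[OF that]] subtree_at_snoc(1)[OF ts(1)] ts(2) that by simp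
    moreover have "inserted S (?b @ [j]) = []" if "j \<le> ?i" for j
      using untouched_inserted[OF untouched, of j] nothing_inserted_on_path[OF step.hyps] split that
      by (cases "j = ?i") auto
    ultimately show ?case using face_perm_climb[OF S(1), of ?b ?i "(a, True)"] step.IH split by simp
  qed
qed

lemma face_perm_Cons:
  "face_perm ((a, q) # S) = face_perm S \<circ> transpose (a, True) (take (nat (q + 1)) a, False)"
proof -
  let ?c = "take (nat (q + 1)) a"
  have a: "a \<in> tree_vertices t" using leaf_a by (simp add: tree_vertices_iff)
  then have c: "?c \<in> tree_vertices t" by (rule take_in_tree_vertices)
  have "a \<notin> fst ` set S" using distinct_leaves[of t] leaves by auto
  then have "close_leaves t S (a, False) = (a, False)"
    using close_leaves_other arity_Leaf[OF leaf_a] by simp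
  then have "close_leaves t ((a, q) # S) = close_leaves t S \<circ> transpose (?c, True) (a, False)"
    by (auto simp: close_leaves_Cons fun_eq_iff transpose_def)
  then have "perm_restrict (close_leaves t ((a, q) # S)) D =
      perm_restrict (close_leaves t S) D \<circ> transpose (?c, True) (a, False)"
    using a c by (auto simp: fun_eq_iff perm_restrict_def transpose_def)
  then have "face_perm ((a, q) # S) = face_perm S \<circ> transpose (opp m (?c, True)) (opp m (a, False))"
    unfolding face_perm_def by (simp only: comp_transpose_opp)
  then show ?thesis using a c by (simp add: opp_closure transpose_commute)
qed

end

lemma tree_rotation_annotate:
  "subtree_at t a = Some s \<Longrightarrow> tree_rotation (opp m) (perm_restrict (tree_rot t) D) (annotate a s)"
proof (induction s arbitrary: a)
  case (Leaf q)
  then show ?case using arity_Leaf[OF Leaf] by (simp add: opp_closure tree_vertices_iff perm_restrict_def)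
next
  case (Node ts)
  let ?r = "perm_restrict (tree_rot t) D"
    and ?cs = "rev (map (\<lambda>i. annotate (a @ [i]) (ts ! i)) [0..<length ts])"
  have child: "subtree_at t (a @ [i]) = Some (ts ! i)" if "i < length ts" for i
    using subtree_at_snoc(1)[OF Node.prems] that by simp
  have op: "opp m (a, True) = (a, False)" using Node.prems by (simp add: opp_closure tree_vertices_iff)
  have darts: "map dart ?cs = closed_rotation [] a (length ts)"
    by (simp add: closed_rotation_def rev_map comp_def)
  have "set ((a, False) # closed_rotation [] a (length ts)) \<subseteq> D"
    using Node.prems child by (auto simp: closed_rotation_def tree_vertices_iff)
  then have restrict: "map ?r ((a, False) # closed_rotation [] a (length ts)) =
      map (tree_rot t) ((a, False) # closed_rotation [] a (length ts))"
    by (intro map_cong perm_restrict_simps(1)) auto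
  have tree_rot_node: "map (tree_rot t) ((a, False) # closed_rotation [] a (length ts)) =
      closed_rotation [] a (length ts) @ [(a, False)]"
    using close_leaves_node[of "[]", OF _ _ Node.prems] by simp
  have "map ?r (opp m (a, True) # map dart ?cs) = map dart ?cs @ [opp m (a, True)]"
    unfolding darts op using restrict tree_rot_node by (rule trans)
  moreover have "tree_rotation (opp m) ?r c" if "c \<in> set ?cs" for c
    using that Node.IH child by auto
  ultimately show ?case unfolding annotate.simps tree_rotation.simps by blast
qed

lemma face_perm_Nil: "face_perm [] permutes D" "num_cycles (face_perm []) D = 1"
proof -
  let ?r = "perm_restrict (tree_rot t) D" and ?w = "contours (opp m) [annotate [] t]"
  have "is_cycle ?r (map dart [annotate [] t])" by (simp add: is_cycle_def perm_restrict_def)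
  then have cycle: "is_cycle (face_perm []) ?w"
    unfolding face_perm_def close_leaves_Nil
    by (intro is_cycle_contours[OF opp_opp _ _ distinct_contour]) (use tree_rotation_annotate in auto)
  have w: "set ?w = D" using set_contour by (simp add: closure_map_simps)
  have "perm_restrict (face_perm []) D permutes D"
    by (rule perm_restrict_permutes) (use cycle w finite_tree_vertices in auto)
  moreover have "perm_restrict (face_perm []) D = face_perm []"
    by (auto simp: fun_eq_iff perm_restrict_def face_perm_def closure_map_simps)
  ultimately show "face_perm [] permutes D" by simp
  show "num_cycles (face_perm []) D = 1"
    using num_cycles_eq_1[OF cycle w] Nil_in_tree_vertices[of t] by blast
qed

lemma num_cycles_face_perm:
  "leaves t = pre @ S \<Longrightarrow> face_perm S permutes D \<and> num_cycles (face_perm S) D = Suc (length S)"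
proof (induction S arbitrary: pre)
  case Nil
  then show ?case using face_perm_Nil by simp
next
  case (Cons x S)
  obtain a q where x: "x = (a, q)" by (cases x)
  let ?c = "take (nat (q + 1)) a"
  have leaves: "leaves t = pre @ (a, q) # S" using Cons.prems x by simp
  have IH: "face_perm S permutes D" "num_cycles (face_perm S) D = Suc (length S)"
    using Cons.IH[of "pre @ [x]"] Cons.prems by auto
  have "a \<in> tree_vertices t" using leaf_a[OF leaves] by (simp add: tree_vertices_iff)
  then have D: "(a, True) \<in> D" "(?c, False) \<in> D" using take_in_tree_vertices by auto
  have "num_cycles (face_perm S \<circ> transpose (a, True) (?c, False)) D = Suc (num_cycles (face_perm S) D)"
    by (rule num_cycles_split[OF IH(1) _ D(1) face_perm_leaf_path[OF leaves]])
      (simp_all add: finite_tree_vertices)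
  then show ?case
    unfolding x face_perm_Cons[OF leaves] using permutes_comp_transpose[OF IH(1) D] IH(2)
    by (metis length_Cons)
qed

lemma planar_closure: "planar_map m"
proof -
  have "face_perm (leaves t) = rot m \<circ> opp m" by (simp add: face_perm_def closure_map_simps)
  then have "num_cycles (rot m \<circ> opp m) (darts m) = Suc (length (leaves t))"
    using num_cycles_face_perm[of "[]" "leaves t"] by (simp add: closure_map_simps)
  moreover have "card leaf_darts = length (leaves t)"
    unfolding card_leaf_darts by (simp add: leaf_list_annotate)
  ultimately show ?thesis using planar_map_iff by simp
qed

end

lemma noncrossing_tree_if_decorated:
  assumes "decorated t"
  shows "noncrossing_tree t"
proof
  show "\<exists>ts. t = Node ts" using assms unfolding decorated_iff by blast
  have local: "locally_decorated (int (length a) - 1) s" if "subtree_at t a = Some s" "a \<noteq> []" for a s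
    using locally_decorated_children_if_decorated[OF assms] that
    unfolding locally_decorated_children_def by blast
  show "-1 \<le> q \<and> q < int (length a) - 1" if "subtree_at t a = Some (Leaf q)" for a q
    using local[OF that] that assms by (cases "a = []") (auto simp: decorated_iff)
  show "no_smaller_before (int (length b)) (labels s)" if "subtree_at t (b @ [i]) = Some s" for b i s
    using local[OF that]
    by (cases s) (auto simp: no_smaller_before_def labels_Leaf precedes_iff_append append_eq_Cons_conv)
qed

lemma closure_map_nonseparable:
  assumes "decorated t"
  shows "planar_map (closure_map t)" "\<not> separable (closure_map t)"
    "card (edges (closure_map t)) = card (tree_vertices t)"
proof -
  interpret noncrossing_tree t by (rule noncrossing_tree_if_decorated[OF assms])
  show "planar_map m" by (rule planar_closure)
  have low_leaves by (rule low_leaves_if_decorated[of "annotate [] t"]) (simp_all add: assms)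
  then show "\<not> separable m" using not_separable_if_low_leaves by simp
  show "card (edges m) = card (tree_vertices t)" by (rule card_edges_closure)
qed


section \<open>Isomorphisms\<close>

lemma map_iso_trans: "map_iso f m1 m2 \<Longrightarrow> map_iso g m2 m3 \<Longrightarrow> map_iso (g \<circ> f) m1 m3"
  unfolding map_iso_def using bij_betw_trans[of f "darts m1" "darts m2" g "darts m3"]
  by (auto dest: bij_betwE)

context
  fixes f :: "'d \<Rightarrow> 'e" and m :: "'d cmap" and m' :: "'e cmap"
  assumes rooted: "rooted_map m" and iso: "map_iso f m m'"
begin

interpretation combinatorial_map m
  using rooted by (rule combinatorial_map_if_rooted)

lemma darts_iso: "darts m' = f ` darts m"
  using iso by (simp add: map_iso_def bij_betw_def)

lemma map_iso_sym: "map_iso (inv_into (darts m) f) m' m"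
proof -
  have inv: "inv_into (darts m) f (f d) = d" if "d \<in> darts m" for d
    using inv_into_f_f[OF iso_facts(1)[OF rooted iso] that] .
  have "inv_into (darts m) f (rot m' d') = rot m (inv_into (darts m) f d') \<and>
      inv_into (darts m) f (opp m' d') = opp m (inv_into (darts m) f d')" if d': "d' \<in> darts m'" for d'
  proof -
    obtain d where d: "d \<in> darts m" "d' = f d" using d' darts_iso by auto
    then have "rot m' d' = f (rot m d)" "opp m' d' = f (opp m d)"
      using iso_facts(2,3)[OF rooted iso] by simp_all
    then show ?thesis using inv d by simp
  qed
  moreover have "inv_into (darts m) f (root_dart m') = root_dart m"
    using iso inv[OF root_in_darts] by (simp add: map_iso_def)
  moreover have "bij_betw (inv_into (darts m) f) (darts m') (darts m)"
    using iso by (simp add: map_iso_def bij_betw_inv_into)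
  ultimately show ?thesis unfolding map_iso_def by blast
qed

lemma edges_iso: "edges m' = (`) f ` edges m"
  unfolding edges_def darts_iso image_image
  by (rule image_cong[OF refl]) (simp add: iso_facts(3)[OF rooted iso])

lemma vertices_iso: "vertices m' = (`) f ` vertices m"
  unfolding vertices_def darts_iso image_image
  by (rule image_cong[OF refl]) (simp add: vertex_iso[OF rooted iso])

lemma faces_iso: "faces m' = (`) f ` faces m"
proof -
  have permutes: "rot m \<circ> opp m permutes darts m" using opp_permutes rot_permutes by (rule permutes_compose)
  have "f ` orbit (rot m \<circ> opp m) d = orbit (rot m' \<circ> opp m') (f d)" if d: "d \<in> darts m" for d
  proof (rule orbit_inverse)
    show "d \<in> orbit (rot m \<circ> opp m) d"
      using permutes finite_darts permutation_permutes permutation_self_in_orbit by metis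
    fix x assume "x \<in> orbit (rot m \<circ> opp m) d"
    then have "x \<in> darts m" using permutes_orbit_subset[OF permutes d] by blast
    then show "(rot m' \<circ> opp m') (f x) = f ((rot m \<circ> opp m) x)" by (simp add: iso_facts[OF rooted iso])
  qed
  then show ?thesis unfolding faces_def darts_iso image_image by simp
qed

lemma inj_on_image_iso: "inj_on ((`) f) (Pow (darts m))"
  by (rule inj_on_image_Pow[OF iso_facts(1)[OF rooted iso]])

lemma card_image_iso: "A \<subseteq> Pow (darts m) \<Longrightarrow> card ((`) f ` A) = card A"
  by (rule card_image[OF inj_on_subset[OF inj_on_image_iso]])

lemma card_edges_iso: "card (edges m') = card (edges m)"
  unfolding edges_iso by (rule card_image_iso[OF edges_subset_Pow])

context
  assumes comb: "combinatorial_map m'"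
begin

interpretation image: combinatorial_map m'
  by (rule comb)

lemma dart_step_iso:
  assumes "d \<in> darts m" "(d, e) \<in> dart_step\<^sup>*"
  shows "e \<in> darts m \<and> (f d, f e) \<in> image.dart_step\<^sup>*"
  using assms(2)
proof induction
  case (step y z)
  then have "z = rot m y \<or> z = opp m y" "y \<in> darts m" by (auto simp: dart_step_def)
  then have "z \<in> darts m" "f z = rot m' (f y) \<or> f z = opp m' (f y)"
    using iso_facts(2,3)[OF rooted iso] by auto
  then show ?case
    using step.IH rtrancl.rtrancl_into_rtrancl[of "f d" "f y" image.dart_step "f z"]
    by (auto simp: image.dart_step_def)
qed (use assms(1) in simp)

lemma rooted_map_iso: "rooted_map m'"
proof -
  have "(d', e') \<in> image.dart_step\<^sup>*" if "d' \<in> darts m'" "e' \<in> darts m'" for d' e'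
    using that rooted dart_step_iso unfolding rooted_map_def dart_step_def[symmetric] darts_iso by blast
  then show ?thesis
    unfolding rooted_map_def image.dart_step_def[symmetric]
    using image.finite_darts image.rot_permutes image.opp_permutes image.opp_involution image.root_in_darts
    by blast
qed

lemma planar_map_iso: "planar_map m \<Longrightarrow> planar_map m'"
  using rooted_map_iso card_edges_iso card_image_iso[OF vertices_subset_Pow] card_image_iso[OF faces_subset_Pow]
  by (simp add: planar_map_def vertices_iso faces_iso)

lemma separable_iso:
  assumes "separable m'"
  shows "separable m"
proof -
  obtain col where opp: "\<forall>d\<in>darts m'. col (opp m' d) \<longleftrightarrow> col d" and both: "bichromatic col (darts m')"
    and cut: "\<exists>!v. v \<in> vertices m' \<and> bichromatic col v"
    using assms unfolding image.separable_iff_cut_colouring cut_colouring_def by (elim exE conjE)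
  have image: "bichromatic (col \<circ> f) v \<longleftrightarrow> bichromatic col (f ` v)" for v
    by (simp add: bichromatic_def)
  obtain v' where v': "v' \<in> vertices m'" "bichromatic col v'"
    and unique: "\<And>u'. u' \<in> vertices m' \<Longrightarrow> bichromatic col u' \<Longrightarrow> u' = v'"
    using cut by (elim ex1E conjE) metis
  obtain v where v: "v \<in> vertices m" "v' = f ` v" using v'(1) by (auto simp: vertices_iso)
  have "\<exists>!v. v \<in> vertices m \<and> bichromatic (col \<circ> f) v"
  proof (rule ex1I[of _ v])
    fix u assume u: "u \<in> vertices m \<and> bichromatic (col \<circ> f) u"
    then have "f ` u = f ` v" using unique[of "f ` u"] v(2) by (simp add: image vertices_iso)
    then show "u = v" by (rule inj_onD[OF inj_on_image_iso]) (use u v(1) vertices_subset_Pow in auto)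
  qed (use v v'(2) image in simp)
  moreover have "\<forall>d\<in>darts m. (col \<circ> f) (opp m d) \<longleftrightarrow> (col \<circ> f) d"
    using opp iso_facts(3)[OF rooted iso] by (simp add: darts_iso)
  moreover have "bichromatic (col \<circ> f) (darts m)" using both by (simp add: image darts_iso)
  ultimately show ?thesis unfolding separable_iff_cut_colouring cut_colouring_def by blast
qed

end

end

lemma iso_class_eq:
  assumes "rooted_map m" "map_iso f m m'"
  shows "iso_class m = iso_class m'"
proof -
  have "(\<exists>g. map_iso g m x) \<longleftrightarrow> (\<exists>g. map_iso g m' x)" for x :: "nat cmap"
    using map_iso_trans[OF assms(2)] map_iso_trans[OF map_iso_sym[OF assms]] by blast
  then show ?thesis by (simp add: iso_class_def)
qed

lemma (in combinatorial_map) exists_nat_copy: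
  obtains f and m' :: "nat cmap" where "map_iso f m m'" "combinatorial_map m'"
proof -
  let ?D = "darts m"
  obtain f :: "'d \<Rightarrow> nat" where inj: "inj_on f ?D" using finite_imp_inj_to_nat_seg[OF finite_darts] by blast
  define m' :: "nat cmap" where
    "m' = \<lparr>darts = f ` ?D, rot = map_permutation ?D f (rot m), opp = map_permutation ?D f (opp m),
      root_dart = f (root_dart m)\<rparr>"
  have copy: "map_permutation ?D f p (f d) = f (p d)" if "d \<in> ?D" for p d
    using map_permutation_apply[OF inj that] .
  have "map_iso f m m'"
    using inj by (simp add: map_iso_def m'_def copy bij_betw_def)
  moreover have "combinatorial_map m'"
  proof
    show "finite (darts m')" "root_dart m' \<in> darts m'"
      using finite_darts root_in_darts by (simp_all add: m'_def)
    show "rot m' permutes darts m'" "opp m' permutes darts m'"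
      using map_permutation_permutes[of f ?D "f ` ?D"] inj rot_permutes opp_permutes
      by (simp_all add: m'_def bij_betw_def)
    show "opp m' d' \<noteq> d' \<and> opp m' (opp m' d') = d'" if "d' \<in> darts m'" for d'
      using that inj opp_involution by (auto simp: m'_def copy inj_on_eq_iff)
  qed
  ultimately show ?thesis by (rule that)
qed


section \<open>Uniqueness of the closure\<close>

lemma set_dart_tree_eq: "set_dart_tree c = dart ` descendants c"
  by (induction c) auto

lemma (in explored_map) set_dart_tree_subset_darts: "c \<in> set forest \<Longrightarrow> set_dart_tree c \<subseteq> darts m"
  using set_contour unfolding set_dart_tree_eq upper_darts_eq[symmetric] by (auto simp: set_contour_eq)

lemma dart_map_dart_tree [simp]: "dart (map_dart_tree f c) = f (dart c)"
  by (cases c) auto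

lemma leaf_list_map_dart_tree: "leaf_list (map_dart_tree f c) = map (\<lambda>(d, q). (f d, q)) (leaf_list c)"
proof (induction c)
  case (DNode d ts)
  then have "map (\<lambda>c. leaf_list (map_dart_tree f c)) (rev ts) =
      map (\<lambda>c. map (\<lambda>(d, q). (f d, q)) (leaf_list c)) (rev ts)"
    by auto
  then show ?case by (simp add: map_concat rev_map comp_def del: map_eq_conv)
qed simp

lemma contour_map_dart_tree:
  assumes "\<And>d. d \<in> set_dart_tree c \<Longrightarrow> f (op d) = op' (f d)"
  shows "contour op' (map_dart_tree f c) = map f (contour op c)"
  using assms
proof (induction c)
  case (DNode d ts)
  then have "map (\<lambda>c. contour op' (map_dart_tree f c)) ts = map (\<lambda>c. map f (contour op c)) ts" by auto
  then show ?case using DNode.prems[of d] by (simp add: map_concat comp_def del: map_eq_conv)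
qed simp

lemma back_ends_at_map_dart_tree:
  assumes "\<And>d. d \<in> set_dart_tree c \<Longrightarrow> f (op d) = op' (f d)"
  shows "back_ends_at op' p (map_dart_tree f c) = map f (back_ends_at op p c)"
proof -
  have "d \<in> set_dart_tree c" if "(d, q) \<in> set (leaf_list c)" for d q
    using that by (force simp: set_dart_tree_eq set_leaf_list)
  then show ?thesis
    unfolding back_ends_at_def leaf_list_map_dart_tree
    by (auto simp: filter_map comp_def case_prod_unfold assms)
qed

lemma tight_support_map_dart_tree:
  assumes "\<And>d. d \<in> set_dart_tree c \<Longrightarrow> f (opp m d) = opp m' (f d)"
    and "tight m p c" "tight m' p (map_dart_tree f c)" "d \<in> set (node_list c)"
  shows "map f (tl (support (rot m) (opp m d))) = tl (support (rot m') (opp m' (f d)))"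
  using assms
proof (induction c arbitrary: p)
  case (DNode e ts)
  show ?case
  proof (cases "d = e")
    case True
    have "back_ends_at (opp m') p (map_dart_tree f c) = map f (back_ends_at (opp m) p c)" if "c \<in> set ts" for c
      by (rule back_ends_at_map_dart_tree) (use that DNode.prems(1) in auto)
    then have "map (\<lambda>c. f (dart c) # back_ends_at (opp m') p (map_dart_tree f c)) ts =
        map (\<lambda>c. map f (dart c # back_ends_at (opp m) p c)) ts" by simp
    then show ?thesis using True DNode.prems(2,3) by (simp add: map_concat comp_def del: map_eq_conv)
  next
    case False
    then obtain c where c: "c \<in> set ts" "d \<in> set (node_list c)" using DNode.prems(4) by auto
    show ?thesis by (rule DNode.IH[OF c(1) _ _ _ c(2), of "p + 1"]) (use c(1) DNode.prems(1-3) in auto)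
  qed
qed simp

lemma map_iso_if_tight:
  assumes m: "explored_map m [c]" "tight m 0 c"
      "support (rot m) (root_dart m) = root_dart m # back_ends_at (opp m) (-1) c"
    and m': "explored_map m' [map_dart_tree f c]" "tight m' 0 (map_dart_tree f c)"
      "support (rot m') (root_dart m') = root_dart m' # back_ends_at (opp m') (-1) (map_dart_tree f c)"
    and opp: "\<And>d. d \<in> darts m \<Longrightarrow> f (opp m d) = opp m' (f d)"
  shows "map_iso f m m'"
proof -
  interpret explored_map m "[c]" by (rule m(1))
  interpret image: explored_map m' "[map_dart_tree f c]" by (rule m'(1))
  have commute: "f (opp m d) = opp m' (f d)" if "d \<in> set_dart_tree c" for d
    using opp that set_dart_tree_subset_darts[of c] by auto
  have "map f (contour (opp m) c) = contour (opp m') (map_dart_tree f c)"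
    using contour_map_dart_tree[of c f "opp m" "opp m'"] commute by simp
  then have bij: "bij_betw f (darts m) (darts m')"
    using set_contour image.set_contour image.distinct_contour distinct_map[of f "contour (opp m) c"]
    by (simp add: bij_betw_def) (metis list.set_map)
  have root: "f (root_dart m) = root_dart m'" using root_first image.root_first by auto
  have support: "support (rot m') (f e) = map f (support (rot m) e)" if e: "e \<in> entry_darts" for e
  proof (cases "e = root_dart m")
    case True
    then show ?thesis
      using back_ends_at_map_dart_tree[of c f "opp m" "opp m'"] commute by (simp add: root m(3) m'(3))
  next
    case False
    then obtain d
      where d: "e = opp m d" "d \<in> set (node_list c)" using e by (auto simp: entry_darts_def node_darts_def)
    then have "d \<in> set_dart_tree c" unfolding set_dart_tree_eq upper_darts_eq[symmetric] by simp
    then show ?thesis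
      using tight_support_map_dart_tree[OF commute m(2) m'(2) d(2)] support_rot_Cons[of e]
        image.support_rot_Cons[of "f e"] commute d(1) by (metis list.simps(9))
  qed
  have "f (rot m d) = rot m' (f d)" if d: "d \<in> darts m" for d
  proof -
    obtain e where e: "e \<in> entry_darts" "d \<in> vertex m e"
      using vertices_eq vertex_in_vertices[OF d] self_in_vertex[of d] by blast
    then have "is_cycle (rot m') (map f (support (rot m) e))" using image.is_cycle_support_rot support by metis
    then show ?thesis using is_cycle_map_commute is_cycle_support_rot e(2) vertex_eq_set_support by metis
  qed
  then show ?thesis unfolding map_iso_def using bij opp root by blast
qed

fun dart_at :: "'d dart_tree \<Rightarrow> nat list \<Rightarrow> 'd" where
  "dart_at c [] = dart c"
| "dart_at (DNode d ts) (i # a) = dart_at (rev ts ! i) a"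
| "dart_at (DLeaf d q) (i # a) = d"

lemma map_dart_tree_annotate:
  assumes "\<And>a. f (b @ a, True) = dart_at c a"
  shows "map_dart_tree f (annotate b (erase c)) = c"
  using assms
proof (induction c arbitrary: b)
  case (DLeaf d q)
  then show ?case using DLeaf[of "[]"] by simp
next
  case (DNode d ts)
  have "map_dart_tree f (annotate (b @ [i]) (erase (rev ts ! i))) = rev ts ! i" if "i < length ts" for i
    by (rule DNode.IH) (use that DNode.prems[of "i # _"] in \<open>auto simp: rev_nth\<close>)
  then have "map (\<lambda>i. map_dart_tree f (annotate (b @ [i]) (map erase (rev ts) ! i))) [0..<length ts] = rev ts"
    by (intro nth_equalityI) auto
  then have "rev (map (\<lambda>i. map_dart_tree f (annotate (b @ [i]) (map erase (rev ts) ! i))) [0..<length ts]) = ts"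
    by simp
  then show ?case using DNode.prems[of "[]"] by (simp add: rev_map comp_def)
qed

lemma map_iso_closure_map:
  assumes "explored_map m [c]" "decorated (erase c)" "tight m 0 c"
    "support (rot m) (root_dart m) = root_dart m # back_ends_at (opp m) (-1) c"
  obtains f where "map_iso f (closure_map (erase c)) m"
proof -
  interpret explored_map m "[c]" by (rule assms(1))
  interpret closure: noncrossing_tree "erase c" by (rule noncrossing_tree_if_decorated[OF assms(2)])
  define f where "f = (\<lambda>(a, x). if x then dart_at c a else opp m (dart_at c a))"
  have tree: "map_dart_tree f (annotate [] (erase c)) = c"
    by (rule map_dart_tree_annotate) (simp add: f_def)
  have "map_iso f closure.m m"
  proof (rule map_iso_if_tight[OF closure.explored_map_axioms _ closure.support_root_tight])
    show "tight closure.m 0 (annotate [] (erase c))" using closure.annotate_explored_tight[of "[]"] by simp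
    show "f (opp closure.m d) = opp m (f d)" if "d \<in> darts closure.m" for d
      using that by (cases d) (auto simp: f_def closure.closure_map_simps(1) closure.opp_closure)
  qed (use assms tree in simp_all)
  then show ?thesis by (rule that)
qed


section \<open>The bijection\<close>

lemma card_tree_vertices: "card (tree_vertices t) = Suc (tree_edges t)"
  unfolding tree_edges_def using card.remove[OF finite_tree_vertices Nil_in_tree_vertices] .

lemma S_map_nonseparable:
  assumes "n > 0" "t \<in> decorated_trees n"
  shows "S_map t \<in> nonsep_maps n" "T_map (S_map t) = t"
proof -
  have t: "decorated t" "tree_edges t = n" using assms(2) by (auto simp: decorated_trees_def)
  interpret noncrossing_tree t by (rule noncrossing_tree_if_decorated[OF t(1)])
  obtain f and m' :: "nat cmap" where f: "map_iso f m m'" and m': "combinatorial_map m'"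
    by (rule exists_nat_copy)
  have planar: "planar_map m'" by (rule planar_map_iso[OF rooted_map f m' planar_closure])
  have edges: "card (edges m') = n + 1"
    using card_edges_iso[OF rooted_map f] closure_map_nonseparable(3)[OF t(1)] card_tree_vertices t(2) by simp
  moreover have "\<not> separable m'"
    using separable_iso[OF rooted_map f m'] closure_map_nonseparable(2)[OF t(1)] by blast
  ultimately have "nonseparable m'" using planar assms(1) by (simp add: nonseparable_def)
  moreover have S: "S_map t = iso_class m'" unfolding S_map_def by (rule iso_class_eq[OF rooted_map f])
  ultimately show "S_map t \<in> nonsep_maps n" using edges by (auto simp: nonsep_maps_def)
  have "T_map (S_map t) = dfs_tree m'" unfolding S by (rule T_map_iso_class[OF planar])
  also have "\<dots> = dfs_tree m" by (rule dfs_tree_iso[OF rooted_map f])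
  also have "\<dots> = t" using dfs_tree_eq by simp
  finally show "T_map (S_map t) = t" .
qed

lemma T_map_decorated:
  assumes "M \<in> nonsep_maps n"
  shows "T_map M \<in> decorated_trees n" "S_map (T_map M) = M"
proof -
  obtain m :: "nat cmap" where m: "nonseparable m" "card (edges m) = n + 1" and M: "M = iso_class m"
    using assms by (auto simp: nonsep_maps_def)
  have planar: "planar_map m" and rooted: "rooted_map m"
    using m(1) by (auto simp: nonseparable_def planar_map_def)
  obtain forest where "explored_map m forest" using explored_map_exists[OF rooted] by blast
  then interpret explored_map m forest .
  obtain c where c: "forest = [c]" "decorated (erase c)" "tight m 0 c"
    "support (rot m) (root_dart m) = root_dart m # back_ends_at (opp m) (-1) c"
    using exploration_tree_nonseparable m(1) unfolding nonseparable_def by blast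
  have T: "T_map M = erase c" using T_map_iso_class[OF planar] dfs_tree_eq c(1) M by simp
  have "explored_map m [c]" using explored_map_axioms c(1) by simp
  then obtain f where f: "map_iso f (closure_map (erase c)) m"
    using c(2-4) by (rule map_iso_closure_map)
  have closure: "rooted_map (closure_map (erase c))"
    using closure_map_nonseparable(1)[OF c(2)] by (simp add: planar_map_def)
  have "tree_edges (erase c) = n"
    using card_edges_iso[OF closure f] closure_map_nonseparable(3)[OF c(2)] card_tree_vertices m(2) by simp
  then show "T_map M \<in> decorated_trees n" using T c(2) by (simp add: decorated_trees_def)
  show "S_map (T_map M) = M" unfolding T S_map_def using iso_class_eq[OF closure f] M by simp
qed

theorem theorem3:
  fixes n :: nat
  assumes "n > 0"
  shows "bij_betw T_map (nonsep_maps n) (decorated_trees n) \<and>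
    (\<forall>M\<in>nonsep_maps n. S_map (T_map M) = M) \<and>
    (\<forall>t\<in>decorated_trees n. T_map (S_map t) = t)"
proof (intro conjI ballI)
  show "bij_betw T_map (nonsep_maps n) (decorated_trees n)"
    by (rule bij_betw_byWitness[where f' = S_map])
      (use S_map_nonseparable[OF assms] T_map_decorated in auto)
qed (use S_map_nonseparable[OF assms] T_map_decorated in auto)

end
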